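(* Let $\Gamma_h:=\Theta_h^\Gamma(\Gamma^{\mathrm{lin}})$. Then $$\operatorname{dist}(\Gamma_h,\Gamma)\lesssim h^{k+1}.$$
   Context: Setting: $d\in\{2,3\}$, $k\ge1$ an integer; $\Omega\subset\mathbb R^d$ is a bounded connected polygonal (polyhedral) domain; $\phi$ is a level set function with smooth compact zero level $\Gamma=\{x\in\Omega:\phi(x)=0\}\subset\Omega$, and there is an open neighborhood $U\subset\Omega$ of $\Gamma$ with $\phi\in C^{k+2}(U)$, $\|\nabla\phi(x)\|\sim1$ and $\|D^2\phi(x)\|\le c$ for $x\in U$. $\mathcal T$ runs through a quasi-uniform family of simplicial triangulations of $\Omega$ (not fitted to $\Gamma$) with mesh size $h\sim h_T:=\operatorname{diam}(T)$. $V_h^k$ is the space of continuous piecewise polynomials of degree at most $k$ on $\mathcal T$, $I_k$ the nodal interpolation into it. $\phi_h\in V_h^k$ is given with $\max_{T\in\mathcal T}|\phi_h-\phi|_{m,\infty,T\cap U}\lesssim h^{k+1-m}$, $0\le m\le k+1$ ($H^{m,\infty}$ seminorms). $\hat\phi_h:=I_1\phi_h$, $\Gamma^{\mathrm{lin}}:=\{\hat\phi_h=0\}$, $\mathcal T^\Gamma:=\{T\in\mathcal T:T\cap\Gamma^{\mathrm{lin}}\ne\emptyset\}$, $\Omega^\Gamma:=\bigcup_{T\in\mathcal T^\Gamma}T$. $h$ is sufficiently small; in particular the elements of $\mathcal T^\Gamma$ and their neighbors lie in $U$. $A\lesssim B$ means $A\le cB$ with $c$ independent of $h$ and of how $\Gamma$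 intersects $\mathcal T$ ($c$ may depend on $\phi$); $\sim$ means $\lesssim$ and $\gtrsim$. $P_h^\Gamma$ maps elementwise continuous (possibly discontinuous across elements) vector functions $v$ on $\mathcal T^\Gamma$ to the continuous piecewise degree-$k$ function on $\Omega^\Gamma$ whose value at each finite element (Lagrange) node $x_i$ is the arithmetic mean of $v_{|T}(x_i)$ over all $T\in\mathcal T^\Gamma$ having $x_i$ as a node. $G_h$ is either $\nabla\phi_h$ or $P_h^\Gamma\nabla\phi_h$. For $x\in T\in\mathcal T^\Gamma$, $d_h(x)$ is the smallest number in absolute value with $\mathcal E_T\phi_h(x+d_h(x)G_h(x))=\hat\phi_h(x)$, where $\mathcal E_T\phi_h$ is the polynomial extension of $\phi_h|_T$ to $\mathbb R^d$; $\Psi_h^\Gamma(x):=x+d_h(x)G_h(x)$ for $x\in T\in\mathcal T^\Gamma$, and $\Theta_h^\Gamma:=P_h^\Gamma\Psi_h^\Gamma$. $\operatorname{dist}$ denotes the Hausdorff distance. *)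

theory Defs
  imports "HOL-Analysis.Analysis"
begin

section \<open>Hausdorff distance\<close>

text \<open>Valued in \<^typ>\<open>ennreal\<close>: the infimum over the empty set is infinite and the
  supremum over the empty set is zero.\<close>

definition hausdorff_distance :: "'a::metric_space set \<Rightarrow> 'a set \<Rightarrow> ennreal" where
  "hausdorff_distance A B =
     max (SUP x\<in>A. INF y\<in>B. ennreal (dist x y)) (SUP y\<in>B. INF x\<in>A. ennreal (dist x y))"


section \<open>Derivatives\<close>

definition gradient :: "('a::euclidean_space \<Rightarrow> real) \<Rightarrow> 'a \<Rightarrow> 'a" where
  "gradient f x = (THE D. GDERIV f x :> D)"

text \<open>For basis vectors \<open>b\<^sub>1, \<dots>, b\<^sub>m\<close> this is the mixed partial derivative of order \<open>m\<close>;
  it is meaningful where the intermediate derivatives are differentiable.\<close>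

fun partials :: "'a::euclidean_space list \<Rightarrow> ('a \<Rightarrow> real) \<Rightarrow> 'a \<Rightarrow> real" where
  "partials [] f = f"
| "partials (b # bs) f = partials bs (\<lambda>x. frechet_derivative f (at x) b)"

definition Cm_on :: "nat \<Rightarrow> ('a::euclidean_space \<Rightarrow> real) \<Rightarrow> 'a set \<Rightarrow> bool" where
  "Cm_on m f U \<longleftrightarrow>
     (\<forall>bs. set bs \<subseteq> Basis \<and> length bs < m \<longrightarrow> partials bs f differentiable_on U) \<and>
     (\<forall>bs. set bs \<subseteq> Basis \<and> length bs \<le> m \<longrightarrow> continuous_on U (partials bs f))"

text \<open>The \<open>H\<^bsup>m,\<infinity>\<^esup>\<close> seminorm on an open set \<open>S\<close>, for a function that is \<open>C\<^sup>m\<close> on \<open>S\<close>; for such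
  functions the essential supremum is the supremum.\<close>

definition seminorm_inf :: "nat \<Rightarrow> ('a::euclidean_space \<Rightarrow> real) \<Rightarrow> 'a set \<Rightarrow> ennreal" where
  "seminorm_inf m f S =
     (SUP bs\<in>{bs. set bs \<subseteq> Basis \<and> length bs = m}. SUP x\<in>S. ennreal \<bar>partials bs f x\<bar>)"


section \<open>Polygonal domains and triangulations\<close>

definition polyhedral_domain :: "'a::euclidean_space set \<Rightarrow> bool" where
  "polyhedral_domain \<Omega> \<longleftrightarrow> \<Omega> \<noteq> {} \<and> connected \<Omega> \<and>
     (\<exists>\<P>. finite \<P> \<and> (\<forall>P\<in>\<P>. polytope P) \<and> \<Omega> = interior (\<Union>\<P>))"

definition triangulation_of :: "'a::euclidean_space set set \<Rightarrow> 'a set \<Rightarrow> bool" where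
  "triangulation_of \<T> \<Omega> \<longleftrightarrow>
     triangulation \<T> \<and> (\<forall>T\<in>\<T>. int DIM('a) simplex T) \<and> \<Union>\<T> = closure \<Omega>"

definition quasi_uniform :: "('i \<Rightarrow> 'a::euclidean_space set set) \<Rightarrow> ('i \<Rightarrow> real) \<Rightarrow> bool" where
  "quasi_uniform \<T> h \<longleftrightarrow>
     (\<forall>i. h i > 0) \<and>
     (\<exists>c1>0. \<exists>c2. \<forall>i. \<forall>T\<in>\<T> i. c1 * h i \<le> diameter T \<and> diameter T \<le> c2 * h i) \<and>
     (\<exists>\<rho>>0. \<forall>i. \<forall>T\<in>\<T> i. \<exists>z. cball z (\<rho> * diameter T) \<subseteq> T)"


section \<open>Finite element functions\<close>

definition multi_indices :: "nat \<Rightarrow> ('a::euclidean_space \<Rightarrow> nat) set" where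
  "multi_indices k = {\<alpha>. (\<forall>b. b \<notin> Basis \<longrightarrow> \<alpha> b = 0) \<and> (\<Sum>b\<in>Basis. \<alpha> b) \<le> k}"

definition poly_deg_le :: "nat \<Rightarrow> ('a::euclidean_space \<Rightarrow> 'b::euclidean_space) \<Rightarrow> bool" where
  "poly_deg_le k p \<longleftrightarrow>
     (\<exists>c. \<forall>x. p x = (\<Sum>\<alpha>\<in>multi_indices k. (\<Prod>b\<in>Basis. (x \<bullet> b) ^ \<alpha> b) *\<^sub>R c \<alpha>))"

text \<open>Only the values on \<open>\<Union>\<S>\<close> matter for membership. The mesh \<open>\<S>\<close> may be a
  submesh of a triangulation.\<close>

definition fe_space :: "nat \<Rightarrow> 'a::euclidean_space set set \<Rightarrow> ('a \<Rightarrow> 'b::euclidean_space) set" where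
  "fe_space k \<S> = {w. continuous_on (\<Union>\<S>) w \<and>
     (\<forall>T\<in>\<S>. \<exists>p. poly_deg_le k p \<and> (\<forall>x\<in>T. w x = p x))}"

text \<open>The points of the simplex \<open>T\<close> with barycentric coordinates in \<open>{0, 1/k, \<dots>, 1}\<close>, for
  \<open>k \<ge> 1\<close>.\<close>

definition lagrange_nodes :: "nat \<Rightarrow> 'a::euclidean_space set \<Rightarrow> 'a set" where
  "lagrange_nodes k T =
     {(\<Sum>v | v extreme_point_of T. (real (\<alpha> v) / real k) *\<^sub>R v) | \<alpha> :: 'a \<Rightarrow> nat.
        (\<Sum>v | v extreme_point_of T. \<alpha> v) = k}"

text \<open>The value \<open>0\<close> off the mesh is a convention that makes the interpolant unique as a total
  function.\<close>

definition nodal_interp ::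
  "nat \<Rightarrow> 'a::euclidean_space set set \<Rightarrow> ('a \<Rightarrow> 'b::euclidean_space) \<Rightarrow> 'a \<Rightarrow> 'b" where
  "nodal_interp k \<S> f = (THE w. w \<in> fe_space k \<S> \<and>
     (\<forall>T\<in>\<S>. \<forall>x\<in>lagrange_nodes k T. w x = f x) \<and> (\<forall>x. x \<notin> \<Union>\<S> \<longrightarrow> w x = 0))"

definition poly_ext :: "nat \<Rightarrow> 'a::euclidean_space set \<Rightarrow> ('a \<Rightarrow> real) \<Rightarrow> 'a \<Rightarrow> real" where
  "poly_ext k T f = (THE p. poly_deg_le k p \<and> (\<forall>x\<in>T. p x = f x))"

text \<open>Functions that may jump across element boundaries are written \<open>v T x\<close>: the value at
  \<open>x \<in> T\<close> of the restriction to the closed element \<open>T\<close>.\<close>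

definition elem_gradient ::
  "nat \<Rightarrow> ('a::euclidean_space \<Rightarrow> real) \<Rightarrow> 'a set \<Rightarrow> 'a \<Rightarrow> 'a" where
  "elem_gradient k f T x = gradient (poly_ext k T f) x"

definition node_mean ::
  "nat \<Rightarrow> 'a::euclidean_space set set \<Rightarrow> ('a set \<Rightarrow> 'a \<Rightarrow> 'b::euclidean_space) \<Rightarrow> 'a \<Rightarrow> 'b" where
  "node_mean k \<S> v x =
     (\<Sum>T | T \<in> \<S> \<and> x \<in> lagrange_nodes k T. v T x) /\<^sub>R
       real (card {T \<in> \<S>. x \<in> lagrange_nodes k T})"

definition node_averaging ::
  "nat \<Rightarrow> 'a::euclidean_space set set \<Rightarrow> ('a set \<Rightarrow> 'a \<Rightarrow> 'b::euclidean_space) \<Rightarrow> 'a \<Rightarrow> 'b" where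
  "node_averaging k \<S> v = nodal_interp k \<S> (node_mean k \<S> v)"


section \<open>The isoparametric mapping\<close>

definition Gamma_lin :: "'a::euclidean_space set set \<Rightarrow> ('a \<Rightarrow> real) \<Rightarrow> 'a set" where
  "Gamma_lin \<T> \<phi>h = {x \<in> \<Union>\<T>. nodal_interp 1 \<T> \<phi>h x = 0}"

definition cut_elements :: "'a::euclidean_space set set \<Rightarrow> ('a \<Rightarrow> real) \<Rightarrow> 'a set set" where
  "cut_elements \<T> \<phi>h = {T \<in> \<T>. T \<inter> Gamma_lin \<T> \<phi>h \<noteq> {}}"

definition search_direction ::
  "nat \<Rightarrow> 'a::euclidean_space set set \<Rightarrow> ('a \<Rightarrow> real) \<Rightarrow> ('a set \<Rightarrow> 'a \<Rightarrow> 'a) \<Rightarrow> bool" where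
  "search_direction k \<T> \<phi>h G \<longleftrightarrow>
     G = elem_gradient k \<phi>h \<or>
     G = (\<lambda>T. node_averaging k (cut_elements \<T> \<phi>h) (elem_gradient k \<phi>h))"

definition d_h ::
  "nat \<Rightarrow> 'a::euclidean_space set set \<Rightarrow> ('a \<Rightarrow> real) \<Rightarrow> ('a set \<Rightarrow> 'a \<Rightarrow> 'a) \<Rightarrow> 'a set \<Rightarrow> 'a \<Rightarrow> real"
where
  "d_h k \<T> \<phi>h G T x =
     (ARG_MIN abs d. poly_ext k T \<phi>h (x + d *\<^sub>R G T x) = nodal_interp 1 \<T> \<phi>h x)"

definition Psi_h ::
  "nat \<Rightarrow> 'a::euclidean_space set set \<Rightarrow> ('a \<Rightarrow> real) \<Rightarrow> ('a set \<Rightarrow> 'a \<Rightarrow> 'a) \<Rightarrow> 'a set \<Rightarrow> 'a \<Rightarrow> 'a"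
where
  "Psi_h k \<T> \<phi>h G T x = x + d_h k \<T> \<phi>h G T x *\<^sub>R G T x"

definition Theta_h ::
  "nat \<Rightarrow> 'a::euclidean_space set set \<Rightarrow> ('a \<Rightarrow> real) \<Rightarrow> ('a set \<Rightarrow> 'a \<Rightarrow> 'a) \<Rightarrow> 'a \<Rightarrow> 'a"
where
  "Theta_h k \<T> \<phi>h G = node_averaging k (cut_elements \<T> \<phi>h) (Psi_h k \<T> \<phi>h G)"

definition Gamma_h ::
  "nat \<Rightarrow> 'a::euclidean_space set set \<Rightarrow> ('a \<Rightarrow> real) \<Rightarrow> ('a set \<Rightarrow> 'a \<Rightarrow> 'a) \<Rightarrow> 'a set"
where
  "Gamma_h k \<T> \<phi>h G = Theta_h k \<T> \<phi>h G ` Gamma_lin \<T> \<phi>h"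

end

theory Submission
  imports Defs
begin

text \<open>Measure the distance to \<open>\<Gamma>\<close> by \<open>\<phi>\<close>. The exact mapping \<open>x + d x *\<^sub>R gradient \<phi> x\<close> with
  \<open>\<phi> (x + d x *\<^sub>R gradient \<phi> x) = I\<^sub>1 \<phi>\<^sub>h x\<close> sends the zero set of \<open>I\<^sub>1 \<phi>\<^sub>h\<close> onto
  \<open>\<Gamma>\<close>, so it is enough to show that \<open>\<Theta>\<^sub>h\<close> agrees with it up to \<open>O(h\<^sup>k\<^sup>+\<^sup>1)\<close> on every cut
  element \<open>T\<close>. Instead of differentiating the implicit function \<open>d\<close>, a simplified Newton
  iteration on Taylor polynomials, whose coefficients stay bounded, is run on \<open>T\<close>; truncating
  the result gives a polynomial of degree \<open>k\<close> that satisfies the equation up to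
  \<open>O(h\<^sup>k\<^sup>+\<^sup>1)\<close>. At each Lagrange node the values of \<open>\<Psi>\<^sub>h\<close> from all adjacent elements are close to
  this polynomial, because \<open>\<phi>\<close> is strictly monotone along the search direction. Their mean is then
  close to it too, and Lagrange interpolation reproduces polynomials of degree \<open>k\<close> and is stable on
  shape-regular elements.\<close>

section \<open>Polynomials of bounded degree\<close>

text \<open>\<open>Psi_h\<close> is defined element by element through a minimizer on an unfitted
  mesh, so its smoothness is hard to control; only its values at Lagrange nodes are used. Newton
  starts from step 0, whose residual of order \<open>h ^ 2\<close> is the linear interpolation
  error, and gains one power of \<open>h\<close> per step until the Taylor error of order
  \<open>h ^ (k + 1)\<close> takes over. The gradient is replaced by its own Taylor polynomial with
  the same remainder order; this is where \<open>k + 2\<close> derivatives of \<phi> enter. A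
  direction error of order \<open>h ^ k\<close> is harmless because the step it multiplies has
  length of order \<open>h ^ 2\<close>. Constants are uniform because all happens in a compact
  neighbourhood of \<Gamma>: the patch condition puts a ball of radius of order \<open>h\<close>
  into \<open>U\<close> around a zero of the linear interpolant, \<phi> must vanish in that ball,
  and so cut elements lie within a multiple of \<open>h\<close> of \<Gamma>. The converse half of
  the Hausdorff distance is an intermediate value argument: among the points moved to a given point
  of \<Gamma> by varying step lengths, one is a zero of the linear interpolant.\<close>

lemma sum_scaleR_single:
  fixes c :: "'b::real_vector"
  assumes "finite A" "a \<in> A"
  shows "(\<Sum>b\<in>A. f b *\<^sub>R (if b = a then c else 0)) = f a *\<^sub>R c"
proof -
  have "(\<Sum>b\<in>A - {a}. f b *\<^sub>R (if b = a then c else 0)) = 0"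
    by (rule sum.neutral) auto
  then show ?thesis
    using assms by (simp only: sum.remove[of A a]) simp
qed

lemma finite_multi_indices: "finite (multi_indices k :: ('a::euclidean_space \<Rightarrow> nat) set)"
proof (rule finite_subset)
  show "(multi_indices k :: ('a \<Rightarrow> nat) set)
      \<subseteq> {f. \<forall>x. (x \<in> Basis \<longrightarrow> f x \<in> {0..k}) \<and> (x \<notin> Basis \<longrightarrow> f x = 0)}"
    unfolding multi_indices_def
    by (auto intro: order_trans[OF member_le_sum])
  show "finite {f. \<forall>x::'a. (x \<in> Basis \<longrightarrow> f x \<in> {0..k}) \<and> (x \<notin> Basis \<longrightarrow> f x = 0)}"
    by (rule finite_set_of_finite_funs) auto
qed

lemma poly_deg_le_monomial:
  assumes "\<alpha> \<in> multi_indices k"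
  shows "poly_deg_le k (\<lambda>x. (\<Prod>b\<in>Basis. (x \<bullet> b) ^ \<alpha> b) *\<^sub>R c)"
  unfolding poly_deg_le_def
proof (intro exI allI)
  fix x :: 'a
  show "(\<Prod>b\<in>Basis. (x \<bullet> b) ^ \<alpha> b) *\<^sub>R c
      = (\<Sum>\<beta>\<in>multi_indices k. (\<Prod>b\<in>Basis. (x \<bullet> b) ^ \<beta> b) *\<^sub>R (if \<beta> = \<alpha> then c else 0))"
    by (rule sum_scaleR_single[OF finite_multi_indices assms, symmetric])
qed

lemma poly_deg_le_add:
  assumes "poly_deg_le k p" "poly_deg_le k q"
  shows "poly_deg_le k (\<lambda>x. p x + q x)"
proof -
  from assms obtain c d where
    "\<And>x. p x = (\<Sum>\<alpha>\<in>multi_indices k. (\<Prod>b\<in>Basis. (x \<bullet> b) ^ \<alpha> b) *\<^sub>R c \<alpha>)"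
    "\<And>x. q x = (\<Sum>\<alpha>\<in>multi_indices k. (\<Prod>b\<in>Basis. (x \<bullet> b) ^ \<alpha> b) *\<^sub>R d \<alpha>)"
    unfolding poly_deg_le_def by auto
  then show ?thesis
    unfolding poly_deg_le_def
    by (intro exI[of _ "\<lambda>\<alpha>. c \<alpha> + d \<alpha>"]) (simp add: scaleR_add_right sum.distrib)
qed

lemma poly_deg_le_scaleR:
  assumes "poly_deg_le k p"
  shows "poly_deg_le k (\<lambda>x. a *\<^sub>R p x)"
proof -
  from assms obtain c where
    "\<And>x. p x = (\<Sum>\<alpha>\<in>multi_indices k. (\<Prod>b\<in>Basis. (x \<bullet> b) ^ \<alpha> b) *\<^sub>R c \<alpha>)"
    unfolding poly_deg_le_def by auto
  then show ?thesis
    unfolding poly_deg_le_def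
    by (intro exI[of _ "\<lambda>\<alpha>. a *\<^sub>R c \<alpha>"] allI)
      (simp only: scaleR_sum_right scaleR_left_commute[of a])
qed

lemma poly_deg_le_const: "poly_deg_le k (\<lambda>x. c)"
  using poly_deg_le_monomial[of "\<lambda>_. 0" k c] by (simp add: multi_indices_def)

lemma poly_deg_le_sum:
  assumes "\<And>i. i \<in> I \<Longrightarrow> poly_deg_le k (p i)"
  shows "poly_deg_le k (\<lambda>x. \<Sum>i\<in>I. p i x)"
proof (cases "finite I")
  case True
  then show ?thesis
    using assms by (induction I rule: finite_induct) (auto intro: poly_deg_le_const poly_deg_le_add)
qed (simp add: poly_deg_le_const)

lemma poly_deg_le_coord_scaleR:
  fixes p :: "'a::euclidean_space \<Rightarrow> 'b::euclidean_space"
  assumes "poly_deg_le k p" and b: "b \<in> Basis"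
  shows "poly_deg_le (Suc k) (\<lambda>x. (x \<bullet> b) *\<^sub>R p x)"
proof -
  from assms obtain c where
    c: "\<And>x. p x = (\<Sum>\<alpha>\<in>multi_indices k. (\<Prod>b\<in>Basis. (x \<bullet> b) ^ \<alpha> b) *\<^sub>R c \<alpha>)"
    unfolding poly_deg_le_def by auto
  have "poly_deg_le (Suc k) (\<lambda>x. (\<Prod>b'\<in>Basis. (x \<bullet> b') ^ (\<alpha>(b := Suc (\<alpha> b))) b') *\<^sub>R c \<alpha>)"
    if "\<alpha> \<in> multi_indices k" for \<alpha> :: "'a \<Rightarrow> nat"
  proof (rule poly_deg_le_monomial)
    have "(\<Sum>b'\<in>Basis. (\<alpha>(b := Suc (\<alpha> b))) b') = Suc (\<alpha> b) + sum \<alpha> (Basis - {b})"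
      using b by (simp add: sum.remove[OF _ b])
    also have "\<dots> = Suc (sum \<alpha> Basis)"
      using b by (simp add: sum.remove[OF _ b, of \<alpha>])
    finally show "\<alpha>(b := Suc (\<alpha> b)) \<in> multi_indices (Suc k)"
      using that b unfolding multi_indices_def by auto
  qed
  moreover have "(\<Prod>b'\<in>Basis. (x \<bullet> b') ^ (\<alpha>(b := Suc (\<alpha> b))) b')
      = (x \<bullet> b) * (\<Prod>b'\<in>Basis. (x \<bullet> b') ^ \<alpha> b')" for x and \<alpha> :: "'a \<Rightarrow> nat"
  proof -
    have "(\<Prod>b'\<in>Basis. (x \<bullet> b') ^ (\<alpha>(b := Suc (\<alpha> b))) b')
        = (x \<bullet> b) ^ Suc (\<alpha> b) * (\<Prod>b'\<in>Basis - {b}. (x \<bullet> b') ^ (\<alpha>(b := Suc (\<alpha> b))) b')"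
      using b by (simp add: prod.remove[OF _ b])
    also have "(\<Prod>b'\<in>Basis - {b}. (x \<bullet> b') ^ (\<alpha>(b := Suc (\<alpha> b))) b')
        = (\<Prod>b'\<in>Basis - {b}. (x \<bullet> b') ^ \<alpha> b')"
      by (intro prod.cong) auto
    finally show ?thesis
      using b by (simp add: prod.remove[OF _ b, of "\<lambda>b'. (x \<bullet> b') ^ \<alpha> b'"])
  qed
  ultimately have "poly_deg_le (Suc k)
      (\<lambda>x. \<Sum>\<alpha>\<in>multi_indices k. ((x \<bullet> b) * (\<Prod>b'\<in>Basis. (x \<bullet> b') ^ \<alpha> b')) *\<^sub>R c \<alpha>)"
    by (intro poly_deg_le_sum) (simp only:)
  then show ?thesis
    by (simp only: c scaleR_sum_right scaleR_scaleR)
qed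

lemma poly_deg_le_Suc:
  fixes p :: "'a::euclidean_space \<Rightarrow> 'b::euclidean_space"
  assumes "poly_deg_le k p"
  shows "poly_deg_le (Suc k) p"
proof -
  from assms obtain c where
    c: "p = (\<lambda>x. \<Sum>\<alpha>\<in>multi_indices k. (\<Prod>b\<in>Basis. (x \<bullet> b) ^ \<alpha> b) *\<^sub>R c \<alpha>)"
    unfolding poly_deg_le_def by auto
  show ?thesis
    unfolding c by (intro poly_deg_le_sum poly_deg_le_monomial) (auto simp: multi_indices_def)
qed

lemma poly_deg_le_mono:
  assumes "poly_deg_le k p" "k \<le> n"
  shows "poly_deg_le n p"
  using assms(2,1) by (induction rule: dec_induct) (auto intro: poly_deg_le_Suc)

lemma poly_deg_le_affine_scaleR:
  fixes p :: "'a::euclidean_space \<Rightarrow> 'b::euclidean_space"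
  assumes "poly_deg_le k p"
  shows "poly_deg_le (Suc k) (\<lambda>x. (a + m \<bullet> x) *\<^sub>R p x)"
proof -
  have "(a + m \<bullet> x) *\<^sub>R p x = a *\<^sub>R p x + (\<Sum>b\<in>Basis. (m \<bullet> b) *\<^sub>R (x \<bullet> b) *\<^sub>R p x)" for x
    by (simp add: scaleR_add_left scaleR_sum_left[symmetric] euclidean_inner[of m x])
  then show ?thesis
    by (simp only:) (intro poly_deg_le_add poly_deg_le_scaleR poly_deg_le_sum
        poly_deg_le_coord_scaleR poly_deg_le_Suc assms)
qed

text \<open>Falling factorials of an affine function are built one affine factor at a time; each
  factor of \<open>lagrange_fun\<close> has this shape.\<close>

lemma poly_deg_le_gbinomial_scaleR:
  fixes p :: "'a::euclidean_space \<Rightarrow> 'b::euclidean_space"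
  assumes "poly_deg_le k p"
  shows "poly_deg_le (k + n) (\<lambda>x. ((a + m \<bullet> x) gchoose n) *\<^sub>R p x)"
proof -
  have "poly_deg_le (k + n) (\<lambda>x. (\<Prod>i<n. (a + m \<bullet> x) - real i) *\<^sub>R p x)" for n
  proof (induction n)
    case (Suc n)
    show ?case
      using poly_deg_le_affine_scaleR[OF Suc, of "a - real n" m]
      by (simp add: algebra_simps)
  qed (use assms in simp)
  from poly_deg_le_scaleR[OF this[of n], of "1 / fact n"] show ?thesis
    by (simp add: gbinomial_prod_rev atLeast0LessThan)
qed

text \<open>Continuity of the gradient is recorded to pass from the interior of an element to its
  closure.\<close>

lemma poly_deg_le_gderiv:
  fixes p :: "'a::euclidean_space \<Rightarrow> real"
  assumes "poly_deg_le k p"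
  obtains p' where "\<And>x. GDERIV p x :> p' x" "continuous_on UNIV p'"
proof -
  define Q where "Q p \<longleftrightarrow> (\<exists>p'. (\<forall>x. GDERIV p x :> p' x) \<and> continuous_on UNIV p')"
    for p :: "'a \<Rightarrow> real"
  have cont: "continuous_on UNIV p" if "\<And>x. GDERIV p x :> p' x" for p p' :: "'a \<Rightarrow> _"
    using that by (auto simp: continuous_on_eq_continuous_at gderiv_def intro: has_derivative_continuous)
  have mult: "Q (\<lambda>x. p x * q x)" if p: "Q p" and q: "Q q" for p q
  proof -
    obtain p' q' where *: "\<And>x. GDERIV p x :> p' x" "continuous_on UNIV p'"
      "\<And>x. GDERIV q x :> q' x" "continuous_on UNIV q'"
      using p q unfolding Q_def by auto
    show ?thesis
      unfolding Q_def
      by (rule exI[of _ "\<lambda>x. p x *\<^sub>R q' x + q x *\<^sub>R p' x"])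
        (use * in \<open>auto intro!: GDERIV_mult continuous_intros cont\<close>)
  qed
  have add: "Q (\<lambda>x. p x + q x)" if p: "Q p" and q: "Q q" for p q
  proof -
    obtain p' q' where *: "\<And>x. GDERIV p x :> p' x" "continuous_on UNIV p'"
      "\<And>x. GDERIV q x :> q' x" "continuous_on UNIV q'"
      using p q unfolding Q_def by auto
    show ?thesis
      unfolding Q_def
      by (rule exI[of _ "\<lambda>x. p' x + q' x"]) (use * in \<open>auto intro!: GDERIV_add continuous_intros\<close>)
  qed
  have const: "Q (\<lambda>x. c)" for c
    unfolding Q_def by (auto intro!: GDERIV_const exI[of _ "\<lambda>_. 0"])
  have coord: "Q (\<lambda>x. x \<bullet> b)" for b
    unfolding Q_def gderiv_def
    by (auto intro!: exI[of _ "\<lambda>_. b"] derivative_eq_intros)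
  have power: "Q (\<lambda>x. (x \<bullet> b) ^ n)" for b n
    by (induction n) (auto intro: const mult coord)
  have prod: "Q (\<lambda>x. \<Prod>b\<in>B. (x \<bullet> b) ^ \<alpha> b)" if "finite B" for B and \<alpha> :: "'a \<Rightarrow> nat"
    using that by (induction B) (auto intro: const mult power)
  have sum: "Q (\<lambda>x. \<Sum>i\<in>I. f i x)" if "finite I" "\<And>i. i \<in> I \<Longrightarrow> Q (f i)"
    for I :: "('a \<Rightarrow> nat) set" and f
    using that by (induction I) (auto intro: const add)
  obtain c where
    c: "p = (\<lambda>x. \<Sum>\<alpha>\<in>multi_indices k. (\<Prod>b\<in>Basis. (x \<bullet> b) ^ \<alpha> b) *\<^sub>R c \<alpha>)"
    using assms unfolding poly_deg_le_def by auto
  have "Q p"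
    unfolding c real_scaleR_def
    by (intro sum mult const prod finite_multi_indices) auto
  then show ?thesis
    using that unfolding Q_def by blast
qed

section \<open>Lagrange interpolation on a simplex\<close>

text \<open>Barycentric coordinates as total functions on the whole space; under
  \<open>full_simplex\<close> existence and uniqueness make the choice canonical.\<close>

definition bary :: "'a::euclidean_space set \<Rightarrow> 'a \<Rightarrow> 'a \<Rightarrow> real" where
  "bary V v x =
    (SOME u. (\<forall>v. v \<notin> V \<longrightarrow> u v = 0) \<and> sum u V = 1 \<and> (\<Sum>v\<in>V. u v *\<^sub>R v) = x) v"

text \<open>Prescribing 0 off \<open>V\<close> makes a multi-index a single function, so the set is
  finite and, for \<open>k \<ge> 1\<close>, a sum over \<open>lattice V k\<close> meets every node
  once.\<close>

definition lattice :: "'a set \<Rightarrow> nat \<Rightarrow> ('a \<Rightarrow> nat) set" where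
  "lattice V m = {\<alpha>. (\<forall>v. v \<notin> V \<longrightarrow> \<alpha> v = 0) \<and> sum \<alpha> V = m}"

definition lattice_node :: "nat \<Rightarrow> 'a::euclidean_space set \<Rightarrow> ('a \<Rightarrow> nat) \<Rightarrow> 'a" where
  "lattice_node k V \<alpha> = (\<Sum>v\<in>V. (real (\<alpha> v) / real k) *\<^sub>R v)"

text \<open>For \<open>\<alpha> \<in> lattice V k\<close> this is the Lagrange basis function of the node with barycentric
  coordinates \<open>\<alpha> v / k\<close>.\<close>

definition lagrange_fun :: "nat \<Rightarrow> 'a::euclidean_space set \<Rightarrow> ('a \<Rightarrow> nat) \<Rightarrow> 'a \<Rightarrow> real" where
  "lagrange_fun k V \<alpha> x = (\<Prod>v\<in>V. (real k * bary V v x) gchoose \<alpha> v)"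

text \<open>\<open>V\<close> spans the whole space affinely, so barycentric coordinates exist also
  outside the simplex, where polynomial extensions are evaluated.\<close>

locale full_simplex =
  fixes V :: "'a::euclidean_space set"
  assumes indep: "\<not> affine_dependent V" and full: "affine hull V = UNIV"
begin

lemma finite_V: "finite V"
  using indep by (rule aff_independent_finite)

section \<open>Barycentric coordinates\<close>

lemma bary_props:
  shows bary_outside: "v \<notin> V \<Longrightarrow> bary V v x = 0"
    and sum_bary: "(\<Sum>v\<in>V. bary V v x) = 1"
    and bary_combination: "(\<Sum>v\<in>V. bary V v x *\<^sub>R v) = x"
proof -
  define P where "P u \<longleftrightarrow> (\<forall>v. v \<notin> V \<longrightarrow> u v = 0) \<and> sum u V = 1 \<and> (\<Sum>v\<in>V. u v *\<^sub>R v) = x"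
    for u :: "'a \<Rightarrow> real"
  have "x \<in> affine hull V"
    using full by simp
  then obtain u where u: "sum u V = 1" "(\<Sum>v\<in>V. u v *\<^sub>R v) = x"
    unfolding affine_hull_finite[OF finite_V] by auto
  have "P (\<lambda>v. if v \<in> V then u v else 0)"
    using u by (simp add: P_def if_distrib[of "\<lambda>a. a *\<^sub>R _"] cong: sum.cong)
  then have *: "P (SOME u. P u)"
    by (rule someI[of P])
  have "(SOME u. P u) v = bary V v x" for v
    unfolding bary_def P_def ..
  with * show "v \<notin> V \<Longrightarrow> bary V v x = 0" "(\<Sum>v\<in>V. bary V v x) = 1"
    "(\<Sum>v\<in>V. bary V v x *\<^sub>R v) = x"
    unfolding P_def by auto
qed

lemma bary_unique:
  assumes "sum u V = 1" "(\<Sum>v\<in>V. u v *\<^sub>R v) = x" and v: "v \<in> V"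
  shows "bary V v x = u v"
proof (rule ccontr)
  assume "bary V v x \<noteq> u v"
  define w where "w v = bary V v x - u v" for v
  have "sum w V = 0"
    using assms(1) by (simp add: w_def sum_subtractf sum_bary)
  moreover have "(\<Sum>v\<in>V. w v *\<^sub>R v) = 0"
    using assms(2) by (simp add: w_def sum_subtractf scaleR_diff_left bary_combination)
  moreover have "w v \<noteq> 0"
    using \<open>bary V v x \<noteq> u v\<close> by (simp add: w_def)
  ultimately have "affine_dependent V"
    unfolding affine_dependent_explicit_finite[OF finite_V] using v by auto
  then show False
    using indep by simp
qed

text \<open>Uniqueness of the coordinates gives this identity, of which additivity and homogeneity
  of the linear part are both instances.\<close>

lemma bary_add_diff: "bary V v (x + c *\<^sub>R (y - z)) = bary V v x + c * (bary V v y - bary V v z)"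
proof (cases "v \<in> V")
  case True
  show ?thesis
  proof (rule bary_unique[OF _ _ True])
    show "(\<Sum>v\<in>V. bary V v x + c * (bary V v y - bary V v z)) = 1"
      by (simp add: sum.distrib sum_distrib_left[symmetric] sum_subtractf sum_bary)
    have "(\<Sum>v\<in>V. (bary V v x + c * (bary V v y - bary V v z)) *\<^sub>R v)
        = (\<Sum>v\<in>V. bary V v x *\<^sub>R v) + c *\<^sub>R ((\<Sum>v\<in>V. bary V v y *\<^sub>R v) - (\<Sum>v\<in>V. bary V v z *\<^sub>R v))"
      by (simp add: scaleR_sum_right scaleR_add_left scaleR_diff_left sum.distrib[symmetric]
          sum_subtractf[symmetric] scaleR_diff_right algebra_simps)
    then show "(\<Sum>v\<in>V. (bary V v x + c * (bary V v y - bary V v z)) *\<^sub>R v) = x + c *\<^sub>R (y - z)"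
      by (simp add: bary_combination)
  qed
qed (simp add: bary_outside)

lemma bary_affine: "\<exists>m. \<forall>x. bary V v x = bary V v x0 + m \<bullet> (x - x0)"
proof -
  define L where "L w = bary V v (x0 + w) - bary V v x0" for w
  have "linear L"
  proof (rule linearI)
    fix a b :: 'a and c :: real
    show "L (a + b) = L a + L b"
      using bary_add_diff[of v "x0 + a" 1 "x0 + b" x0] by (simp add: L_def algebra_simps)
    show "L (c *\<^sub>R a) = c *\<^sub>R L a"
      using bary_add_diff[of v x0 c "x0 + a" x0] by (simp add: L_def)
  qed
  then have *: "L w = (adjoint L (1::real)) \<bullet> w" for w
    using adjoint_works[of L w "1::real"] by (simp add: inner_commute)
  then have "bary V v x = bary V v x0 + adjoint L (1::real) \<bullet> (x - x0)" for x
    using L_def[of "x - x0"] *[of "x - x0"] by simp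
  then show ?thesis
    by blast
qed

lemma bary_hull:
  assumes "x \<in> convex hull V"
  shows "0 \<le> bary V v x" "bary V v x \<le> 1"
proof -
  obtain u where u: "\<forall>v\<in>V. 0 \<le> u v" "sum u V = 1" "(\<Sum>v\<in>V. u v *\<^sub>R v) = x"
    using assms unfolding convex_hull_finite[OF finite_V] by auto
  then have "v \<in> V \<Longrightarrow> bary V v x = u v"
    by (intro bary_unique)
  moreover have "v \<in> V \<Longrightarrow> u v \<le> 1"
    using u member_le_sum[of v V u] finite_V by auto
  ultimately show "0 \<le> bary V v x" "bary V v x \<le> 1"
    using u by (cases "v \<in> V"; simp add: bary_outside)+
qed

section \<open>Lagrange functions and their values at the nodes\<close>

lemma finite_lattice: "finite (lattice V m)"
proof (rule finite_subset)
  show "lattice V m \<subseteq> {f. \<forall>x. (x \<in> V \<longrightarrow> f x \<in> {0..m}) \<and> (x \<notin> V \<longrightarrow> f x = 0)}"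
    unfolding lattice_def using finite_V by (auto intro: member_le_sum)
  show "finite {f. \<forall>x. (x \<in> V \<longrightarrow> f x \<in> {0..m}) \<and> (x \<notin> V \<longrightarrow> f x = 0)}"
    by (rule finite_set_of_finite_funs) (auto simp: finite_V)
qed

lemma bary_lattice_node:
  assumes "\<alpha> \<in> lattice V k" "k \<ge> 1"
  shows "bary V v (lattice_node k V \<alpha>) = real (\<alpha> v) / real k"
proof (cases "v \<in> V")
  case True
  have "(\<Sum>v\<in>V. real (\<alpha> v) / real k) = 1"
    using assms by (simp add: lattice_def sum_divide_distrib[symmetric] of_nat_sum[symmetric] del: of_nat_sum)
  then show ?thesis
    by (rule bary_unique) (auto simp: lattice_node_def True)
qed (use assms in \<open>auto simp: lattice_def bary_outside\<close>)

lemma lattice_node_hull: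
  assumes "\<alpha> \<in> lattice V k" "k \<ge> 1"
  shows "lattice_node k V \<alpha> \<in> convex hull V"
proof -
  have "(\<Sum>v\<in>V. real (\<alpha> v) / real k) = 1"
    using assms by (simp add: lattice_def sum_divide_distrib[symmetric] of_nat_sum[symmetric] del: of_nat_sum)
  then show ?thesis
    unfolding convex_hull_finite[OF finite_V] lattice_node_def
    by (intro CollectI exI[of _ "\<lambda>v. real (\<alpha> v) / real k"]) auto
qed

text \<open>At a node the value is the product of the binomials
  \<open>\<beta> v choose \<alpha> v\<close>. Both multi-indices have sum \<open>k\<close>, so
  distinct ones satisfy \<open>\<beta> v < \<alpha> v\<close> at some vertex, and that factor
  vanishes.\<close>

lemma lagrange_fun_node:
  assumes "\<alpha> \<in> lattice V k" "\<beta> \<in> lattice V k" "k \<ge> 1"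
  shows "lagrange_fun k V \<alpha> (lattice_node k V \<beta>) = (if \<alpha> = \<beta> then 1 else 0)"
proof -
  have eq: "lagrange_fun k V \<alpha> (lattice_node k V \<beta>) = (\<Prod>v\<in>V. real (\<beta> v choose \<alpha> v))"
    unfolding lagrange_fun_def using assms
    by (intro prod.cong refl) (simp add: bary_lattice_node binomial_gbinomial)
  show ?thesis
  proof (cases "\<alpha> = \<beta>")
    case False
    have "\<exists>v\<in>V. \<beta> v < \<alpha> v"
    proof (rule ccontr)
      assume "\<not> (\<exists>v\<in>V. \<beta> v < \<alpha> v)"
      then have le: "\<alpha> v \<le> \<beta> v" if "v \<in> V" for v
        using that by force
      obtain v where "\<alpha> v \<noteq> \<beta> v"
        using False by auto
      moreover from this have "v \<in> V"
        using assms unfolding lattice_def by (metis (mono_tags, lifting) mem_Collect_eq)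
      ultimately have "sum \<alpha> V < sum \<beta> V"
        using le by (intro sum_strict_mono_ex1[OF finite_V]) (auto intro!: bexI[of _ v] simp: order_less_le)
      then show False
        using assms by (simp add: lattice_def)
    qed
    then show ?thesis
      using False finite_V by (auto simp: eq)
  next
    case True
    then show ?thesis
      using eq by simp
  qed
qed

text \<open>The scale \<open>k\<close> inside \<open>lagrange_fun\<close> stays fixed while the
  level \<open>m\<close> grows up to \<open>k\<close>; the intermediate levels permit induction on
  the degree of a monomial.\<close>

definition lagrange_span :: "nat \<Rightarrow> nat \<Rightarrow> ('a \<Rightarrow> 'b::real_vector) \<Rightarrow> bool" where
  "lagrange_span k m p \<longleftrightarrow> (\<exists>c. \<forall>x. p x = (\<Sum>\<alpha>\<in>lattice V m. lagrange_fun k V \<alpha> x *\<^sub>R c \<alpha>))"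

section \<open>Monomials lie in the span of the Lagrange functions\<close>

lemma lattice_Suc:
  assumes "\<alpha> \<in> lattice V m" "v \<in> V"
  shows "\<alpha>(v := Suc (\<alpha> v)) \<in> lattice V (Suc m)"
proof -
  have "sum (\<alpha>(v := Suc (\<alpha> v))) V = Suc (\<alpha> v) + sum (\<alpha>(v := Suc (\<alpha> v))) (V - {v})"
    using sum.remove[OF finite_V assms(2), of "\<alpha>(v := Suc (\<alpha> v))"] by simp
  also have "sum (\<alpha>(v := Suc (\<alpha> v))) (V - {v}) = sum \<alpha> (V - {v})"
    by (intro sum.cong) auto
  also have "Suc (\<alpha> v) + sum \<alpha> (V - {v}) = Suc (sum \<alpha> V)"
    using sum.remove[OF finite_V assms(2), of \<alpha>] by simp
  finally show ?thesis
    using assms by (auto simp: lattice_def)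
qed

text \<open>The recurrence \<open>a * (a gchoose n) = n * (a gchoose n) + Suc n * (a gchoose Suc
  n)\<close> in the factor of \<open>v\<close>: multiplying by a barycentric coordinate raises the
  level by at most one.\<close>

lemma bary_mult_lagrange_fun:
  assumes "v \<in> V"
  shows "real k * bary V v x * lagrange_fun k V \<alpha> x
    = real (Suc (\<alpha> v)) * lagrange_fun k V (\<alpha>(v := Suc (\<alpha> v))) x
      + real (\<alpha> v) * lagrange_fun k V \<alpha> x"
proof -
  define R where "R = (\<Prod>w\<in>V - {v}. (real k * bary V w x) gchoose \<alpha> w)"
  have 1: "lagrange_fun k V \<alpha> x = ((real k * bary V v x) gchoose \<alpha> v) * R"
    unfolding lagrange_fun_def R_def by (rule prod.remove[OF finite_V assms])
  have "lagrange_fun k V (\<alpha>(v := Suc (\<alpha> v))) x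
      = ((real k * bary V v x) gchoose Suc (\<alpha> v))
        * (\<Prod>w\<in>V - {v}. (real k * bary V w x) gchoose (\<alpha>(v := Suc (\<alpha> v))) w)"
    unfolding lagrange_fun_def by (subst prod.remove[OF finite_V assms]) simp
  also have "(\<Prod>w\<in>V - {v}. (real k * bary V w x) gchoose (\<alpha>(v := Suc (\<alpha> v))) w) = R"
    unfolding R_def by (intro prod.cong) auto
  finally have 2: "lagrange_fun k V (\<alpha>(v := Suc (\<alpha> v))) x
      = ((real k * bary V v x) gchoose Suc (\<alpha> v)) * R" .
  show ?thesis
    unfolding 1 2 using gbinomial_mult_1[of "real k * bary V v x" "\<alpha> v"]
    by (simp add: algebra_simps)
qed

lemma lagrange_span_add:
  assumes "lagrange_span k m p" "lagrange_span k m q"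
  shows "lagrange_span k m (\<lambda>x. p x + q x)"
proof -
  from assms obtain c d where
    "\<And>x. p x = (\<Sum>\<alpha>\<in>lattice V m. lagrange_fun k V \<alpha> x *\<^sub>R c \<alpha>)"
    "\<And>x. q x = (\<Sum>\<alpha>\<in>lattice V m. lagrange_fun k V \<alpha> x *\<^sub>R d \<alpha>)"
    unfolding lagrange_span_def by auto
  then show ?thesis
    unfolding lagrange_span_def
    by (intro exI[of _ "\<lambda>\<alpha>. c \<alpha> + d \<alpha>"]) (simp add: scaleR_add_right sum.distrib)
qed

lemma lagrange_span_scaleR:
  assumes "lagrange_span k m p"
  shows "lagrange_span k m (\<lambda>x. a *\<^sub>R p x)"
proof -
  from assms obtain c where
    "\<And>x. p x = (\<Sum>\<alpha>\<in>lattice V m. lagrange_fun k V \<alpha> x *\<^sub>R c \<alpha>)"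
    unfolding lagrange_span_def by auto
  then show ?thesis
    unfolding lagrange_span_def
    by (intro exI[of _ "\<lambda>\<alpha>. a *\<^sub>R c \<alpha>"] allI)
      (simp only: scaleR_sum_right scaleR_left_commute[of a])
qed

lemma lagrange_span_sum:
  assumes "\<And>i. i \<in> I \<Longrightarrow> lagrange_span k m (p i)"
  shows "lagrange_span k m (\<lambda>x. \<Sum>i\<in>I. p i x)"
proof -
  have zero: "lagrange_span k m (\<lambda>x. 0)"
    unfolding lagrange_span_def by (intro exI[of _ "\<lambda>_. 0"]) simp
  show ?thesis
  proof (cases "finite I")
    case True
    then show ?thesis
      using assms by (induction I rule: finite_induct) (auto intro: zero lagrange_span_add)
  qed (simp add: zero)
qed

lemma lagrange_span_basis:
  assumes "\<alpha> \<in> lattice V m"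
  shows "lagrange_span k m (\<lambda>x. lagrange_fun k V \<alpha> x *\<^sub>R c)"
  unfolding lagrange_span_def
proof (intro exI allI)
  fix x :: 'a
  show "lagrange_fun k V \<alpha> x *\<^sub>R c
      = (\<Sum>\<beta>\<in>lattice V m. lagrange_fun k V \<beta> x *\<^sub>R (if \<beta> = \<alpha> then c else 0))"
    by (rule sum_scaleR_single[OF finite_lattice assms, symmetric])
qed

text \<open>Since the barycentric coordinates sum to \<open>1\<close>, multiplying by
  \<open>k - m = (\<Sum>v\<in>V. k * bary V v x - \<alpha> v)\<close> raises the level.\<close>

lemma lagrange_span_Suc:
  assumes p: "lagrange_span k m p" and "m < k"
  shows "lagrange_span k (Suc m) p"
proof -
  obtain c where
    c: "p = (\<lambda>x. \<Sum>\<alpha>\<in>lattice V m. lagrange_fun k V \<alpha> x *\<^sub>R c \<alpha>)"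
    using p unfolding lagrange_span_def by auto
  have "lagrange_fun k V \<alpha> x *\<^sub>R c \<alpha> = (\<Sum>v\<in>V. (real (Suc (\<alpha> v)) / (real k - real m)) *\<^sub>R
      (lagrange_fun k V (\<alpha>(v := Suc (\<alpha> v))) x *\<^sub>R c \<alpha>))" if "\<alpha> \<in> lattice V m" for \<alpha> x
  proof -
    have "(real k - real m) * lagrange_fun k V \<alpha> x
        = (\<Sum>v\<in>V. real k * bary V v x * lagrange_fun k V \<alpha> x - real (\<alpha> v) * lagrange_fun k V \<alpha> x)"
      using that sum_bary[of x]
      by (simp add: sum_subtractf sum_distrib_right[symmetric] sum_distrib_left[symmetric]
          lattice_def of_nat_sum[symmetric] left_diff_distrib del: of_nat_sum)
    also have "\<dots> = (\<Sum>v\<in>V. real (Suc (\<alpha> v)) * lagrange_fun k V (\<alpha>(v := Suc (\<alpha> v))) x)"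
      by (intro sum.cong refl) (simp add: bary_mult_lagrange_fun)
    finally have "lagrange_fun k V \<alpha> x
        = (\<Sum>v\<in>V. real (Suc (\<alpha> v)) / (real k - real m) * lagrange_fun k V (\<alpha>(v := Suc (\<alpha> v))) x)"
      using \<open>m < k\<close> by (simp add: sum_divide_distrib[symmetric] field_simps del: of_nat_Suc)
    then show ?thesis
      by (simp add: scaleR_sum_left del: of_nat_Suc)
  qed
  then have "p = (\<lambda>x. \<Sum>\<alpha>\<in>lattice V m. \<Sum>v\<in>V. (real (Suc (\<alpha> v)) / (real k - real m)) *\<^sub>R
      (lagrange_fun k V (\<alpha>(v := Suc (\<alpha> v))) x *\<^sub>R c \<alpha>))"
    unfolding c by (intro ext sum.cong refl)
  then show ?thesis
    by (elim ssubst) (intro lagrange_span_sum lagrange_span_scaleR lagrange_span_basis lattice_Suc)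
qed

text \<open>The recurrence yields a term of level \<open>Suc m\<close> and one of level
  \<open>m\<close>; the latter is lifted by \<open>lagrange_span_Suc\<close>.\<close>

lemma lagrange_span_bary:
  assumes p: "lagrange_span k m p" and "m < k" and v: "v \<in> V"
  shows "lagrange_span k (Suc m) (\<lambda>x. bary V v x *\<^sub>R p x)"
proof -
  obtain c where
    c: "p = (\<lambda>x. \<Sum>\<alpha>\<in>lattice V m. lagrange_fun k V \<alpha> x *\<^sub>R c \<alpha>)"
    using p unfolding lagrange_span_def by auto
  have "bary V v x *\<^sub>R lagrange_fun k V \<alpha> x *\<^sub>R c \<alpha>
      = (real (Suc (\<alpha> v)) / k) *\<^sub>R (lagrange_fun k V (\<alpha>(v := Suc (\<alpha> v))) x *\<^sub>R c \<alpha>)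
        + (real (\<alpha> v) / k) *\<^sub>R (lagrange_fun k V \<alpha> x *\<^sub>R c \<alpha>)" for \<alpha> x
  proof -
    have "bary V v x * lagrange_fun k V \<alpha> x
      = real (Suc (\<alpha> v)) / k * lagrange_fun k V (\<alpha>(v := Suc (\<alpha> v))) x
        + real (\<alpha> v) / k * lagrange_fun k V \<alpha> x"
      using bary_mult_lagrange_fun[OF v, of k x \<alpha>] \<open>m < k\<close> by (simp add: field_simps del: of_nat_Suc)
    then show ?thesis
      by (simp add: scaleR_add_left[symmetric] del: of_nat_Suc)
  qed
  then have "(\<lambda>x. bary V v x *\<^sub>R p x) = (\<lambda>x. \<Sum>\<alpha>\<in>lattice V m.
      (real (Suc (\<alpha> v)) / k) *\<^sub>R (lagrange_fun k V (\<alpha>(v := Suc (\<alpha> v))) x *\<^sub>R c \<alpha>)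
        + (real (\<alpha> v) / k) *\<^sub>R (lagrange_fun k V \<alpha> x *\<^sub>R c \<alpha>))"
    unfolding c scaleR_sum_right by (intro ext sum.cong refl)
  then show ?thesis
    by (elim ssubst) (intro lagrange_span_sum lagrange_span_add lagrange_span_scaleR
        lagrange_span_Suc[OF lagrange_span_basis \<open>m < k\<close>] lagrange_span_basis lattice_Suc v)
qed

text \<open>A Cartesian coordinate is the combination of the barycentric ones with weights
  \<open>v \<bullet> b\<close>.\<close>

lemma lagrange_span_coord:
  assumes "lagrange_span k m p" and "m < k"
  shows "lagrange_span k (Suc m) (\<lambda>x. (x \<bullet> b) *\<^sub>R p x)"
proof -
  have eq: "(x \<bullet> b) = (\<Sum>v\<in>V. (v \<bullet> b) * bary V v x)" for x
  proof -
    have "x \<bullet> b = (\<Sum>v\<in>V. bary V v x *\<^sub>R v) \<bullet> b"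
      by (simp add: bary_combination)
    then show ?thesis
      by (simp add: inner_sum_left mult.commute)
  qed
  have "(x \<bullet> b) *\<^sub>R p x = (\<Sum>v\<in>V. (v \<bullet> b) *\<^sub>R (bary V v x *\<^sub>R p x))" for x
    by (simp only: eq[of x] scaleR_sum_left scaleR_scaleR)
  then show ?thesis
    by (simp only:) (intro lagrange_span_sum lagrange_span_scaleR lagrange_span_bary assms)
qed

lemma lagrange_span_mono:
  assumes "lagrange_span k m p" "m \<le> n" "n \<le> k"
  shows "lagrange_span k n p"
  using assms(2,1,3) by (induction rule: dec_induct) (auto intro: lagrange_span_Suc)

lemma lagrange_span_coord_power:
  assumes "lagrange_span k m p" and "m + n \<le> k"
  shows "lagrange_span k (m + n) (\<lambda>x. (x \<bullet> b) ^ n *\<^sub>R p x)"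
  using assms(2)
proof (induction n)
  case (Suc n)
  then show ?case
    using lagrange_span_coord[of k "m + n" "\<lambda>x. (x \<bullet> b) ^ n *\<^sub>R p x" b]
    by (simp only: power_Suc scaleR_scaleR add_Suc_right)
qed (use assms in simp)

lemma lagrange_span_monomial:
  assumes "finite B" "sum \<alpha> B \<le> k"
  shows "lagrange_span k (sum \<alpha> B) (\<lambda>x. (\<Prod>b\<in>B. (x \<bullet> b) ^ \<alpha> b) *\<^sub>R c)"
  using assms
proof (induction B rule: finite_induct)
  case empty
  \<comment> \<open>Level 0 holds only the zero multi-index, whose function is the constant
    1.\<close>
  have "lattice V 0 = {\<lambda>_. 0}"
    using finite_V by (auto simp: lattice_def)
  then show ?case
    unfolding lagrange_span_def by (auto simp: lagrange_fun_def intro!: exI[of _ "\<lambda>_. c"])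
next
  case (insert b B)
  then show ?case
    using lagrange_span_coord_power[of k "sum \<alpha> B" "\<lambda>x. (\<Prod>b\<in>B. (x \<bullet> b) ^ \<alpha> b) *\<^sub>R c" "\<alpha> b" b]
    by (simp only: prod.insert sum.insert scaleR_scaleR add.commute insert.hyps)
qed

text \<open>All monomials of degree at most \<open>k\<close> lie in the span, and since the
  functions are dual to the nodes, evaluation at the nodes reads off the coefficients.\<close>

lemma lagrange_reproduction:
  fixes p :: "'a \<Rightarrow> 'b::euclidean_space"
  assumes "poly_deg_le k p" "k \<ge> 1"
  shows "p x = (\<Sum>\<alpha>\<in>lattice V k. lagrange_fun k V \<alpha> x *\<^sub>R p (lattice_node k V \<alpha>))"
proof -
  obtain c0 where
    "p = (\<lambda>x. \<Sum>\<alpha>\<in>multi_indices k. (\<Prod>b\<in>Basis. (x \<bullet> b) ^ \<alpha> b) *\<^sub>R c0 \<alpha>)"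
    using assms unfolding poly_deg_le_def by auto
  then have "lagrange_span k k p"
    by (auto simp: multi_indices_def intro!: lagrange_span_sum lagrange_span_mono[OF lagrange_span_monomial])
  then obtain c where c: "\<And>x. p x = (\<Sum>\<alpha>\<in>lattice V k. lagrange_fun k V \<alpha> x *\<^sub>R c \<alpha>)"
    unfolding lagrange_span_def by auto
  have "p (lattice_node k V \<beta>) = c \<beta>" if "\<beta> \<in> lattice V k" for \<beta>
  proof -
    have "p (lattice_node k V \<beta>) = (\<Sum>\<alpha>\<in>lattice V k. (if \<alpha> = \<beta> then c \<alpha> else 0))"
      unfolding c using assms(2) that by (intro sum.cong) (auto simp: lagrange_fun_node)
    then show ?thesis
      using that finite_lattice by simp
  qed
  then show ?thesis
    by (subst c) (intro sum.cong refl, simp only:)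
qed

text \<open>Each vertex contributes \<open>\<alpha> v\<close> affine factors, and these numbers add
  up to \<open>k\<close>.\<close>

lemma poly_deg_le_lagrange_fun:
  fixes c :: "'b::euclidean_space"
  assumes "\<alpha> \<in> lattice V k"
  shows "poly_deg_le k (\<lambda>x. lagrange_fun k V \<alpha> x *\<^sub>R c)"
proof -
  have "poly_deg_le (sum \<alpha> W) (\<lambda>x. (\<Prod>v\<in>W. (real k * bary V v x) gchoose \<alpha> v) *\<^sub>R c)"
    if "finite W" for W
    using that
  proof (induction W rule: finite_induct)
    case (insert v W)
    obtain m where m: "\<And>x. bary V v x = bary V v 0 + m \<bullet> (x - 0)"
      using bary_affine[of v 0] by auto
    have eq: "real k * bary V v x = real k * bary V v 0 + (real k *\<^sub>R m) \<bullet> x" for x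
      using m[of x] by (simp add: algebra_simps)
    show ?case
      using poly_deg_le_gbinomial_scaleR[OF insert.IH,
          of "\<alpha> v" "real k * bary V v 0" "real k *\<^sub>R m"]
      by (simp only: eq[symmetric] scaleR_scaleR prod.insert[OF insert.hyps]
          sum.insert[OF insert.hyps] add.commute[of "\<alpha> v"])
  qed (simp add: poly_deg_le_const)
  from this[OF finite_V] show ?thesis
    using assms by (simp add: lagrange_fun_def lattice_def)
qed

end

section \<open>Interpolation on a mesh\<close>

text \<open>The local part of \<open>triangulation_of\<close>; it passes to submeshes such as
  \<open>cut_elements\<close>.\<close>

definition full_mesh :: "'a::euclidean_space set set \<Rightarrow> bool" where
  "full_mesh S \<longleftrightarrow> triangulation S \<and> (\<forall>T\<in>S. int DIM('a) simplex T)"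

definition verts :: "'a::euclidean_space set \<Rightarrow> 'a set" where
  "verts T = {v. v extreme_point_of T}"

text \<open>A polynomial on the whole space; \<open>nodal_interp\<close> glues its restrictions to
  the elements.\<close>

definition elem_interp ::
  "nat \<Rightarrow> 'a::euclidean_space set \<Rightarrow> ('a \<Rightarrow> 'b::euclidean_space) \<Rightarrow> 'a \<Rightarrow> 'b" where
  "elem_interp k T f x = (\<Sum>\<alpha>\<in>lattice (verts T) k.
     lagrange_fun k (verts T) \<alpha> x *\<^sub>R f (lattice_node k (verts T) \<alpha>))"

lemma triangulation_of_imp_full_mesh: "triangulation_of S D \<Longrightarrow> full_mesh S"
  by (simp add: triangulation_of_def full_mesh_def)

lemma full_mesh_subset: "full_mesh S \<Longrightarrow> S' \<subseteq> S \<Longrightarrow> full_mesh S'"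
  unfolding full_mesh_def triangulation_def by (meson finite_subset subsetD)

lemma full_mesh_finite: "full_mesh S \<Longrightarrow> finite S"
  by (simp add: full_mesh_def triangulation_def)

lemma full_mesh_simplex:
  fixes T :: "'a::euclidean_space set"
  assumes "full_mesh S" "T \<in> S"
  shows full_mesh_full_simplex: "full_simplex (verts T)"
    and full_mesh_hull: "convex hull (verts T) = T"
    and full_mesh_card: "card (verts T) = DIM('a) + 1"
    and full_mesh_compact: "compact T"
    and full_mesh_convex: "convex T"
proof -
  have T: "int DIM('a) simplex T"
    using assms by (simp add: full_mesh_def)
  then obtain C where C: "\<not> affine_dependent C" "int (card C) = int DIM('a) + 1" "T = convex hull C"
    unfolding simplex_def by auto
  then have "verts T = C"
    by (auto simp: verts_def extreme_point_of_convex_hull_affine_independent)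
  moreover have "affine hull C = UNIV"
    using C aff_dim_simplex[OF T] by (simp add: aff_dim_eq_full)
  ultimately show "full_simplex (verts T)" "convex hull (verts T) = T" "card (verts T) = DIM('a) + 1"
    using C by (auto simp: full_simplex_def)
  show "compact T" "convex T"
    using T by (auto intro: compact_simplex convex_simplex)
qed

text \<open>The intersection is a face of both simplices. Extreme points of a face are those of the
  simplex lying in it, and a compact convex set is the hull of its extreme points.\<close>

lemma full_mesh_Int:
  assumes "full_mesh S" "T \<in> S" "T' \<in> S"
  shows "T \<inter> T' = convex hull (verts T \<inter> verts T')"
proof -
  have "T1 \<inter> T2 face_of T1" if "T1 \<in> S" "T2 \<in> S" for T1 T2
    using assms(1) that by (auto simp: full_mesh_def triangulation_def)
  from this[OF assms(2,3)] this[OF assms(3,2)]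
  have F: "(T \<inter> T') face_of T" "(T \<inter> T') face_of T'"
    by (simp_all add: Int_commute)
  have "compact (T \<inter> T')" "convex (T \<inter> T')"
    by (rule compact_Int[OF full_mesh_compact[OF assms(1,2)] full_mesh_compact[OF assms(1,3)]],
        rule convex_Int[OF full_mesh_convex[OF assms(1,2)] full_mesh_convex[OF assms(1,3)]])
  then have "T \<inter> T' = convex hull {v. v extreme_point_of (T \<inter> T')}"
    by (rule Krein_Milman_Minkowski)
  moreover have "v extreme_point_of (T \<inter> T') \<longleftrightarrow> v \<in> verts T \<and> v \<in> verts T'" for v
  proof -
    have mem: "v extreme_point_of A \<Longrightarrow> v \<in> A" for A :: "'a set"
      by (simp add: extreme_point_of_def)
    show ?thesis
      using extreme_point_of_face[OF F(1), of v] extreme_point_of_face[OF F(2), of v]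
        mem[of T] mem[of T']
      unfolding verts_def Int_iff mem_Collect_eq by argo
  qed
  then have "{v. v extreme_point_of (T \<inter> T')} = verts T \<inter> verts T'"
    by blast
  ultimately show ?thesis
    by simp
qed

lemma lagrange_nodes_eq:
  "lagrange_nodes k T = lattice_node k (verts T) ` lattice (verts T) k"
proof (intro set_eqI iffI)
  fix x
  assume "x \<in> lagrange_nodes k T"
  then obtain \<alpha> where \<alpha>: "sum \<alpha> (verts T) = k" "x = (\<Sum>v\<in>verts T. (real (\<alpha> v) / real k) *\<^sub>R v)"
    by (auto simp: lagrange_nodes_def verts_def)
  define \<beta> where "\<beta> v = (if v \<in> verts T then \<alpha> v else 0)" for v
  have "\<beta> \<in> lattice (verts T) k" "x = lattice_node k (verts T) \<beta>"
    using \<alpha> by (auto simp: lattice_def \<beta>_def lattice_node_def cong: sum.cong)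
  then show "x \<in> lattice_node k (verts T) ` lattice (verts T) k"
    by auto
next
  fix x
  assume "x \<in> lattice_node k (verts T) ` lattice (verts T) k"
  then show "x \<in> lagrange_nodes k T"
    by (auto simp: lagrange_nodes_def verts_def lattice_def lattice_node_def)
qed

lemma lagrange_nodes_subset:
  assumes "full_mesh S" "T \<in> S" "k \<ge> 1"
  shows "lagrange_nodes k T \<subseteq> T"
  using full_simplex.lattice_node_hull[OF full_mesh_full_simplex[OF assms(1,2)] _ assms(3)]
    full_mesh_hull[OF assms(1,2)]
  by (auto simp: lagrange_nodes_eq)

context full_simplex
begin

text \<open>On a face only the nodes of that face contribute, which makes interpolants on
  neighbouring elements match.\<close>

lemma lagrange_sum_face:
  fixes f :: "'a \<Rightarrow> 'b::real_vector"
  assumes W: "W \<subseteq> V" and u: "\<forall>v. v \<notin> W \<longrightarrow> u v = 0" "sum u W = 1" "(\<Sum>v\<in>W. u v *\<^sub>R v) = x"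
  shows "(\<Sum>\<alpha>\<in>lattice V k. lagrange_fun k V \<alpha> x *\<^sub>R f (lattice_node k V \<alpha>))
    = (\<Sum>\<alpha>\<in>lattice W k. (\<Prod>v\<in>W. (real k * u v) gchoose \<alpha> v) *\<^sub>R f (lattice_node k W \<alpha>))"
proof -
  have W': "finite W" "finite V"
    using W finite_V finite_subset by auto
  have "sum u V = 1" "(\<Sum>v\<in>V. u v *\<^sub>R v) = x"
    using u sum.mono_neutral_left[of V W u] sum.mono_neutral_left[of V W "\<lambda>v. u v *\<^sub>R v"]
      finite_V W by auto
  then have bary: "bary V v x = u v" for v
    using bary_unique[of u x v] u(1) bary_outside[of v x] W by (cases "v \<in> V") auto
  have sub: "lattice W k \<subseteq> lattice V k"
  proof
    fix \<alpha> assume "\<alpha> \<in> lattice W k"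
    then show "\<alpha> \<in> lattice V k"
      using sum.mono_neutral_left[of V W \<alpha>] W W' by (auto simp: lattice_def)
  qed
  have zero: "lagrange_fun k V \<alpha> x = 0" if "\<alpha> \<in> lattice V k - lattice W k" for \<alpha>
  proof -
    have "\<exists>v\<in>V - W. \<alpha> v \<noteq> 0"
    proof (rule ccontr)
      assume "\<not> (\<exists>v\<in>V - W. \<alpha> v \<noteq> 0)"
      then have "\<alpha> \<in> lattice W k"
        using that W W' sum.mono_neutral_left[of V W \<alpha>] by (auto simp: lattice_def)
      then show False
        using that by simp
    qed
    then obtain v where v: "v \<in> V - W" "\<alpha> v \<noteq> 0"
      by auto
    then have "(real k * bary V v x) gchoose \<alpha> v = 0"
      using u(1) by (cases "\<alpha> v") (auto simp: bary)
    then show ?thesis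
      unfolding lagrange_fun_def using v finite_V by (intro prod_zero) auto
  qed
  have "(\<Sum>\<alpha>\<in>lattice V k. lagrange_fun k V \<alpha> x *\<^sub>R f (lattice_node k V \<alpha>))
      = (\<Sum>\<alpha>\<in>lattice W k. lagrange_fun k V \<alpha> x *\<^sub>R f (lattice_node k V \<alpha>))"
    using zero by (intro sum.mono_neutral_right finite_lattice sub) auto
  also have "\<dots> = (\<Sum>\<alpha>\<in>lattice W k. (\<Prod>v\<in>W. (real k * u v) gchoose \<alpha> v) *\<^sub>R f (lattice_node k W \<alpha>))"
  proof (intro sum.cong refl arg_cong2[of _ _ _ _ scaleR] arg_cong[of _ _ f])
    fix \<alpha> assume \<alpha>: "\<alpha> \<in> lattice W k"
    have "lagrange_fun k V \<alpha> x = (\<Prod>v\<in>V. (real k * u v) gchoose \<alpha> v)"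
      by (simp add: lagrange_fun_def bary)
    also have "\<dots> = (\<Prod>v\<in>W. (real k * u v) gchoose \<alpha> v)"
      using \<alpha> W W' by (intro prod.mono_neutral_right) (auto simp: lattice_def)
    finally show "lagrange_fun k V \<alpha> x = (\<Prod>v\<in>W. (real k * u v) gchoose \<alpha> v)" .
    show "lattice_node k V \<alpha> = lattice_node k W \<alpha>"
      unfolding lattice_node_def
      using \<alpha> W W' by (intro sum.mono_neutral_right) (auto simp: lattice_def)
  qed
  finally show ?thesis .
qed

end

text \<open>On the common face both sides reduce to one sum over \<open>lattice W k\<close> that no
  longer mentions the element; this gives continuity of the glued interpolant.\<close>

lemma elem_interp_agree:
  assumes S: "full_mesh S" "T \<in> S" "T' \<in> S" and x: "x \<in> T" "x \<in> T'"
  shows "elem_interp k T f x = elem_interp k T' f x"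
proof -
  define W where "W = verts T \<inter> verts T'"
  have fin: "finite W"
    using full_simplex.finite_V[OF full_mesh_full_simplex[OF S(1,2)]] by (auto simp: W_def)
  have "x \<in> convex hull W"
    using full_mesh_Int[OF S] x by (auto simp: W_def)
  then obtain u' where u': "sum u' W = 1" "(\<Sum>v\<in>W. u' v *\<^sub>R v) = x"
    unfolding convex_hull_finite[OF fin] by auto
  define u where "u v = (if v \<in> W then u' v else 0)" for v
  have u: "\<forall>v. v \<notin> W \<longrightarrow> u v = 0" "sum u W = 1" "(\<Sum>v\<in>W. u v *\<^sub>R v) = x"
    using u' by (auto simp: u_def)
  have W: "W \<subseteq> verts T" "W \<subseteq> verts T'"
    by (auto simp: W_def)
  show ?thesis
    unfolding elem_interp_def
    unfolding full_simplex.lagrange_sum_face[OF full_mesh_full_simplex[OF S(1,2)] W(1) u,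
        where k = k and f = f]
      full_simplex.lagrange_sum_face[OF full_mesh_full_simplex[OF S(1,3)] W(2) u,
        where k = k and f = f] ..
qed

lemma poly_deg_le_elem_interp:
  assumes "full_mesh S" "T \<in> S"
  shows "poly_deg_le k (elem_interp k T f)"
proof -
  interpret full_simplex "verts T"
    using assms by (rule full_mesh_full_simplex)
  have "poly_deg_le k (\<lambda>x. elem_interp k T f x)"
    unfolding elem_interp_def by (intro poly_deg_le_sum poly_deg_le_lagrange_fun)
  then show ?thesis .
qed

lemma elem_interp_node:
  assumes "full_mesh S" "T \<in> S" "k \<ge> 1" "x \<in> lagrange_nodes k T"
  shows "elem_interp k T f x = f x"
proof -
  interpret full_simplex "verts T"
    using assms(1,2) by (rule full_mesh_full_simplex)
  obtain \<beta> where \<beta>: "\<beta> \<in> lattice (verts T) k" "x = lattice_node k (verts T) \<beta>"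
    using assms(4) by (auto simp: lagrange_nodes_eq)
  have "elem_interp k T f x = (\<Sum>\<alpha>\<in>lattice (verts T) k.
      (if \<alpha> = \<beta> then 1 else 0) *\<^sub>R f (lattice_node k (verts T) \<alpha>))"
    unfolding elem_interp_def using \<beta> assms(3)
    by (intro sum.cong refl) (simp add: lagrange_fun_node)
  also have "\<dots> = (\<Sum>\<alpha>\<in>lattice (verts T) k. if \<alpha> = \<beta> then f (lattice_node k (verts T) \<alpha>) else 0)"
    by (intro sum.cong refl) auto
  finally show ?thesis
    using \<beta> finite_lattice by simp
qed

lemma elem_interp_unique:
  fixes p :: "'a::euclidean_space \<Rightarrow> 'b::euclidean_space"
  assumes "full_mesh S" "T \<in> S" "k \<ge> 1" "poly_deg_le k p"
    and "\<And>x. x \<in> lagrange_nodes k T \<Longrightarrow> p x = f x"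
  shows "p x = elem_interp k T f x"
proof -
  interpret full_simplex "verts T"
    using assms(1,2) by (rule full_mesh_full_simplex)
  have "p x = (\<Sum>\<alpha>\<in>lattice (verts T) k.
      lagrange_fun k (verts T) \<alpha> x *\<^sub>R p (lattice_node k (verts T) \<alpha>))"
    by (rule lagrange_reproduction[OF assms(4,3)])
  also have "\<dots> = elem_interp k T f x"
    unfolding elem_interp_def using assms(5)
    by (intro sum.cong refl) (auto simp: lagrange_nodes_eq)
  finally show ?thesis .
qed

lemma poly_deg_le_continuous_on:
  fixes p :: "'a::euclidean_space \<Rightarrow> 'b::euclidean_space"
  assumes "poly_deg_le k p"
  shows "continuous_on A p"
proof -
  obtain c where
    "p = (\<lambda>x. \<Sum>\<alpha>\<in>multi_indices k. (\<Prod>b\<in>Basis. (x \<bullet> b) ^ \<alpha> b) *\<^sub>R c \<alpha>)"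
    using assms unfolding poly_deg_le_def by auto
  then show ?thesis
    by (auto intro!: continuous_intros)
qed

lemma nodal_interp_props:
  fixes f :: "'a::euclidean_space \<Rightarrow> 'b::euclidean_space"
  assumes S: "full_mesh S" and k: "k \<ge> 1"
  shows nodal_interp_fe_space: "nodal_interp k S f \<in> fe_space k S"
    and nodal_interp_eq: "\<And>T x. T \<in> S \<Longrightarrow> x \<in> T \<Longrightarrow> nodal_interp k S f x = elem_interp k T f x"
proof -
  \<comment> \<open>Witness for the definite description in \<open>nodal_interp\<close>; by
    \<open>elem_interp_agree\<close> it does not matter which element \<open>SOME\<close>
    picks.\<close>
  define w where "w x = (if x \<in> \<Union>S then elem_interp k (SOME T. T \<in> S \<and> x \<in> T) f x else 0)" for x
  have w: "w x = elem_interp k T f x" if "T \<in> S" "x \<in> T" for T x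
  proof -
    have "(SOME T. T \<in> S \<and> x \<in> T) \<in> S \<and> x \<in> (SOME T. T \<in> S \<and> x \<in> T)"
      by (rule someI[of _ T]) (use that in auto)
    then show ?thesis
      using that elem_interp_agree[OF S, of "SOME T. T \<in> S \<and> x \<in> T" T x k f] by (auto simp: w_def)
  qed
  have "continuous_on (\<Union>T\<in>S. T) w"
  proof (rule continuous_on_closed_Union[OF full_mesh_finite[OF S]])
    fix T assume T: "T \<in> S"
    show "closed T"
      using full_mesh_compact[OF S T] by (rule compact_imp_closed)
    have *: "continuous_on T (elem_interp k T f)"
      by (rule poly_deg_le_continuous_on[OF poly_deg_le_elem_interp[OF S T]])
    show "continuous_on T w"
      by (rule continuous_on_eq[OF *]) (simp only: w[OF T])
  qed
  then have fe: "w \<in> fe_space k S"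
    unfolding fe_space_def using poly_deg_le_elem_interp[OF S] w by auto
  have "nodal_interp k S f = w"
    unfolding nodal_interp_def
  proof (rule the_equality)
    show "w \<in> fe_space k S \<and> (\<forall>T\<in>S. \<forall>x\<in>lagrange_nodes k T. w x = f x) \<and> (\<forall>x. x \<notin> \<Union>S \<longrightarrow> w x = 0)"
      using fe w elem_interp_node[OF S _ k] lagrange_nodes_subset[OF S _ k]
      by (auto simp: w_def subset_iff)
    fix w' assume w': "w' \<in> fe_space k S \<and> (\<forall>T\<in>S. \<forall>x\<in>lagrange_nodes k T. w' x = f x)
      \<and> (\<forall>x. x \<notin> \<Union>S \<longrightarrow> w' x = 0)"
    show "w' = w"
    proof
      fix x
      show "w' x = w x"
      proof (cases "x \<in> \<Union>S")
        case True
        then obtain T where T: "T \<in> S" "x \<in> T"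
          by auto
        then obtain p where p: "poly_deg_le k p" "\<forall>x\<in>T. w' x = p x"
          using w' unfolding fe_space_def by auto
        have *: "p y = f y" if "y \<in> lagrange_nodes k T" for y
        proof -
          have "y \<in> T"
            using lagrange_nodes_subset[OF S T(1) k] that by blast
          then have "p y = w' y"
            using p(2) by simp
          also have "w' y = f y"
            using w' T(1) that by blast
          finally show ?thesis .
        qed
        then show ?thesis
        proof -
          have "w' x = p x"
            using p(2) T(2) by simp
          also have "\<dots> = elem_interp k T f x"
            by (rule elem_interp_unique[OF S T(1) k p(1) *])
          also have "\<dots> = w x"
            by (rule w[OF T, symmetric])
          finally show ?thesis .
        qed
      next
        case False
        then show ?thesis
          using w' by (auto simp: w_def)
      qed
    qed
  qed
  then show "nodal_interp k S f \<in> fe_space k S"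
    "\<And>T x. T \<in> S \<Longrightarrow> x \<in> T \<Longrightarrow> nodal_interp k S f x = elem_interp k T f x"
    using fe w by auto
qed

lemma elem_interp_1:
  assumes "full_mesh S" "T \<in> S"
  shows "elem_interp 1 T f x = (\<Sum>v\<in>verts T. bary (verts T) v x *\<^sub>R f v)"
proof -
  interpret full_simplex "verts T"
    using assms by (rule full_mesh_full_simplex)
  have bary: "poly_deg_le 1 (\<lambda>x. bary (verts T) v x *\<^sub>R c)" for v and c :: 'b
  proof -
    obtain m where m: "\<And>x. bary (verts T) v x = bary (verts T) v 0 + m \<bullet> (x - 0)"
      using bary_affine[of v 0] by blast
    have "bary (verts T) v x = bary (verts T) v 0 + m \<bullet> x" for x
      using m[of x] by simp
    then have "(\<lambda>x. bary (verts T) v x *\<^sub>R c) = (\<lambda>x. (bary (verts T) v 0 + m \<bullet> x) *\<^sub>R c)"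
      by (intro ext arg_cong2[of _ _ _ _ scaleR] refl)
    then show ?thesis
      using poly_deg_le_affine_scaleR[OF poly_deg_le_const[of 0 c], of "bary (verts T) v 0" m]
      by (simp only: One_nat_def)
  qed
  have "(\<Sum>v\<in>verts T. bary (verts T) v x *\<^sub>R f v) = elem_interp 1 T f x"
  proof (rule elem_interp_unique[OF assms])
    show "poly_deg_le 1 (\<lambda>x. \<Sum>v\<in>verts T. bary (verts T) v x *\<^sub>R f v)"
      by (intro poly_deg_le_sum bary)
    fix y assume "y \<in> lagrange_nodes 1 T"
    then obtain \<alpha> where \<alpha>: "\<alpha> \<in> lattice (verts T) 1" "y = lattice_node 1 (verts T) \<alpha>"
      by (auto simp: lagrange_nodes_eq)
    then have "sum \<alpha> (verts T) = Suc 0"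
      by (simp add: lattice_def)
    \<comment> \<open>Naturals with sum 1 single out one vertex, so for \<open>k = 1\<close> the
      nodes are the vertices.\<close>
    then obtain v where v: "v \<in> verts T" "\<alpha> v = Suc 0" "\<forall>w\<in>verts T. v \<noteq> w \<longrightarrow> \<alpha> w = 0"
      unfolding sum_eq_Suc0_iff[OF finite_V] by auto
    have *: "(\<Sum>w\<in>verts T. real (\<alpha> w) *\<^sub>R g w) = g v" for g :: "'a \<Rightarrow> 'c::real_vector"
    proof -
      have "(\<Sum>w\<in>verts T. real (\<alpha> w) *\<^sub>R g w) = (\<Sum>w\<in>{v}. real (\<alpha> w) *\<^sub>R g w)"
        using v finite_V by (intro sum.mono_neutral_right) auto
      then show ?thesis
        using v by simp
    qed
    have "y = v"
      using \<alpha>(2) *[of "\<lambda>w. w"] by (simp add: lattice_node_def)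
    moreover have "bary (verts T) w y = real (\<alpha> w)" for w
      using bary_lattice_node[OF \<alpha>(1), of w] \<alpha>(2) by simp
    ultimately show "(\<Sum>v\<in>verts T. bary (verts T) v y *\<^sub>R f v) = f y"
      using *[of f] by simp
  qed simp
  then show ?thesis
    by simp
qed

text \<open>The nodes lie in \<open>T\<close> and determine a polynomial of degree at most
  \<open>k\<close>, so the \<open>THE\<close> in \<open>poly_ext\<close> is well defined.\<close>

lemma poly_ext_props:
  assumes S: "full_mesh S" "T \<in> S" and k: "k \<ge> 1" and f: "f \<in> fe_space k S"
  shows poly_ext_poly: "poly_deg_le k (poly_ext k T f)"
    and poly_ext_eq: "\<And>x. x \<in> T \<Longrightarrow> poly_ext k T f x = f x"
proof -
  obtain p where p: "poly_deg_le k p" "\<forall>x\<in>T. f x = p x"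
    using f S(2) unfolding fe_space_def by auto
  have sub: "lagrange_nodes k T \<subseteq> T"
    by (rule lagrange_nodes_subset[OF S k])
  have "poly_ext k T f = p"
    unfolding poly_ext_def
  proof (rule the_equality)
    fix q assume q: "poly_deg_le k q \<and> (\<forall>x\<in>T. q x = f x)"
    have "q x = elem_interp k T f x" "p x = elem_interp k T f x" for x
      using q p sub by (auto intro!: elem_interp_unique[OF S k])
    then show "q = p"
      by auto
  qed (use p in auto)
  then show "poly_deg_le k (poly_ext k T f)" "\<And>x. x \<in> T \<Longrightarrow> poly_ext k T f x = f x"
    using p by auto
qed

section \<open>Bounds depending only on the shape of the elements\<close>

lemma gbinomial_abs_le:
  fixes a :: real
  assumes "\<bar>a\<bar> + real n \<le> M"
  shows "\<bar>a gchoose n\<bar> \<le> M ^ n"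
proof -
  have "\<bar>\<Prod>i=0..<n. a - real i\<bar> \<le> (\<Prod>i=0..<n. M)"
    unfolding abs_prod using assms by (intro prod_mono) auto
  then have "\<bar>\<Prod>i=0..<n. a - real i\<bar> \<le> M ^ n"
    by simp
  moreover have "\<bar>\<Prod>i=0..<n. a - real i\<bar> / fact n \<le> \<bar>\<Prod>i=0..<n. a - real i\<bar> / 1"
    by (intro divide_left_mono) (auto simp: fact_ge_1)
  ultimately show ?thesis
    by (simp add: gbinomial_prod_rev abs_divide)
qed

context full_simplex
begin

text \<open>Moving from \<open>z\<close> by length \<open>r\<close> along the gradient
  \<open>m\<close> of the coordinate stays in the simplex and raises the coordinate by
  \<open>r * norm m\<close>; coordinates lie between 0 and 1 there, so
  \<open>norm m \<le> 1 / r\<close>.\<close>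

lemma bary_lipschitz:
  assumes z: "cball z r \<subseteq> convex hull V" and r: "r > 0"
  shows "\<bar>bary V v x - bary V v y\<bar> \<le> dist x y / r"
proof -
  obtain m where m: "\<And>x. bary V v x = bary V v z + m \<bullet> (x - z)"
    using bary_affine[of v z] by blast
  have "norm m \<le> 1 / r"
  proof (cases "m = 0")
    case False
    define y where "y = z + (r / norm m) *\<^sub>R m"
    have "z \<in> convex hull V" "y \<in> convex hull V"
      using z r False by (auto simp: y_def dist_norm)
    then have "bary V v y - bary V v z \<le> 1"
      using bary_hull[of y v] bary_hull[of z v] by linarith
    moreover have "bary V v y - bary V v z = r * norm m"
      using m[of y] False by (simp add: y_def dot_square_norm power2_eq_square)
    ultimately show ?thesis
      using r by (simp add: field_simps)
  qed (use r in simp)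
  have "bary V v x - bary V v y = m \<bullet> (x - y)"
    using m[of x] m[of y] by (simp add: inner_diff_right)
  then have "\<bar>bary V v x - bary V v y\<bar> \<le> norm m * norm (x - y)"
    using Cauchy_Schwarz_ineq2[of m "x - y"] by simp
  also have "\<dots> \<le> 1 / r * norm (x - y)"
    by (intro mult_right_mono \<open>norm m \<le> 1 / r\<close>) auto
  finally show ?thesis
    by (simp add: dist_norm)
qed

text \<open>Within distance \<open>c * r\<close> of the simplex, barycentric coordinates have
  modulus at most \<open>1 + c\<close>; the orders of the binomial factors add up to
  \<open>k\<close>, whence a single power.\<close>

lemma lagrange_fun_abs_le:
  assumes z: "cball z r \<subseteq> convex hull V" and r: "r > 0"
    and x: "x \<in> convex hull V" and y: "dist x y \<le> c * r" and \<alpha>: "\<alpha> \<in> lattice V k"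
  shows "\<bar>lagrange_fun k V \<alpha> y\<bar> \<le> (real k * (2 + c)) ^ k"
proof -
  have "\<bar>bary V v y\<bar> \<le> 1 + c" for v
    using bary_lipschitz[OF z r, of v x y] bary_hull[OF x, of v] y r
      divide_right_mono[OF y, of r] by auto
  then have "real k * \<bar>bary V v y\<bar> + real k \<le> real k * (2 + c)" for v
    using mult_left_mono[of "\<bar>bary V v y\<bar>" "1 + c" "real k"] by (simp add: algebra_simps)
  moreover have "\<alpha> v \<le> k" if "v \<in> V" for v
    using \<alpha> member_le_sum[of v V \<alpha>] that finite_V by (auto simp: lattice_def)
  ultimately have "real k * \<bar>bary V v y\<bar> + real (\<alpha> v) \<le> real k * (2 + c)" if "v \<in> V" for v
    using that by (meson add_left_mono of_nat_mono order_trans)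
  then have "\<bar>lagrange_fun k V \<alpha> y\<bar> \<le> (\<Prod>v\<in>V. (real k * (2 + c)) ^ \<alpha> v)"
    unfolding lagrange_fun_def abs_prod
    by (intro prod_mono conjI abs_ge_zero gbinomial_abs_le) (auto simp: abs_mult)
  also have "\<dots> = (real k * (2 + c)) ^ k"
    using \<alpha> by (simp add: power_sum[symmetric] lattice_def)
  finally show ?thesis .
qed

lemma card_lattice_le: "card (lattice V k) \<le> (k + 1) ^ card V"
proof -
  have "inj_on (\<lambda>\<alpha>. restrict \<alpha> V) (lattice V k)"
  proof (rule inj_onI)
    fix \<alpha> \<beta> assume "\<alpha> \<in> lattice V k" "\<beta> \<in> lattice V k" and eq: "restrict \<alpha> V = restrict \<beta> V"
    moreover have "\<alpha> v = \<beta> v" if "v \<in> V" for v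
      using fun_cong[OF eq, of v] that by simp
    ultimately show "\<alpha> = \<beta>"
      by (intro ext) (metis (mono_tags, lifting) lattice_def mem_Collect_eq)
  qed
  moreover have "(\<lambda>\<alpha>. restrict \<alpha> V) ` lattice V k \<subseteq> PiE V (\<lambda>_. {0..k})"
    using finite_V by (auto simp: lattice_def intro: member_le_sum)
  ultimately have "card (lattice V k) \<le> card (PiE V (\<lambda>_. {0..k}))"
    using finite_V by (intro card_inj_on_le finite_PiE) auto
  then show ?thesis
    by (simp add: card_PiE finite_V)
qed

end

text \<open>A bound for the number of Lagrange nodes times the bound of
  \<open>lagrange_fun_abs_le\<close> for one basis function. Here \<open>c\<close> measures the
  distance from the element in units of the inscribed radius, so the size of the element does not
  enter.\<close>

definition growth_const :: "'a::euclidean_space itself \<Rightarrow> nat \<Rightarrow> real \<Rightarrow> real" where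
  "growth_const _ k c = real ((k + 1) ^ (DIM('a) + 1)) * (real k * (2 + c)) ^ k"

text \<open>Lagrange reproduction spreads nodal bounds to a neighbourhood of the element. With
  \<open>c = 0\<close> this is stability of interpolation; with \<open>c = 1\<close> it controls
  polynomial extensions off the element.\<close>

lemma poly_growth:
  fixes q :: "'a::euclidean_space \<Rightarrow> 'b::euclidean_space"
  assumes S: "full_mesh S" "T \<in> S" and k: "k \<ge> 1" and q: "poly_deg_le k q"
    and z: "cball z r \<subseteq> T" "r > 0" and x: "x \<in> T" and y: "dist x y \<le> c * r"
    and \<epsilon>: "\<And>x. x \<in> lagrange_nodes k T \<Longrightarrow> norm (q x) \<le> \<epsilon>"
  shows "norm (q y) \<le> growth_const TYPE('a) k c * \<epsilon>"
proof -
  interpret full_simplex "verts T"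
    using S by (rule full_mesh_full_simplex)
  note hull = full_mesh_hull[OF S]
  obtain \<beta> where "\<beta> \<in> lattice (verts T) k"
  proof -
    obtain v where v: "v \<in> verts T"
      using full_mesh_card[OF S] by fastforce
    then have "(\<lambda>w. if w = v then k else 0) \<in> lattice (verts T) k"
      using finite_V by (auto simp: lattice_def)
    then show ?thesis
      by (rule that)
  qed
  then have "lattice_node k (verts T) \<beta> \<in> lagrange_nodes k T"
    by (auto simp: lagrange_nodes_eq)
  from \<epsilon>[OF this] have "\<epsilon> \<ge> 0"
    by (rule order_trans[OF norm_ge_zero])
  have "0 \<le> c * r"
    using y by (rule order_trans[OF zero_le_dist])
  then have c: "c \<ge> 0"
    using z(2) by (simp add: zero_le_mult_iff)
  have "q y = (\<Sum>\<alpha>\<in>lattice (verts T) k. lagrange_fun k (verts T) \<alpha> y *\<^sub>R q (lattice_node k (verts T) \<alpha>))"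
    by (rule lagrange_reproduction[OF q k])
  then have "norm (q y) \<le> (\<Sum>\<alpha>\<in>lattice (verts T) k.
      norm (lagrange_fun k (verts T) \<alpha> y *\<^sub>R q (lattice_node k (verts T) \<alpha>)))"
    by (simp only: norm_sum)
  also have "\<dots> \<le> (\<Sum>\<alpha>\<in>lattice (verts T) k. (real k * (2 + c)) ^ k * \<epsilon>)"
  proof (rule sum_mono)
    fix \<alpha> assume \<alpha>: "\<alpha> \<in> lattice (verts T) k"
    have 1: "\<bar>lagrange_fun k (verts T) \<alpha> y\<bar> \<le> (real k * (2 + c)) ^ k"
      by (rule lagrange_fun_abs_le[of z r x]) (use z x y \<alpha> in \<open>simp_all only: hull\<close>)
    have 2: "norm (q (lattice_node k (verts T) \<alpha>)) \<le> \<epsilon>"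
      by (rule \<epsilon>) (use \<alpha> in \<open>auto simp: lagrange_nodes_eq\<close>)
    show "norm (lagrange_fun k (verts T) \<alpha> y *\<^sub>R q (lattice_node k (verts T) \<alpha>))
        \<le> (real k * (2 + c)) ^ k * \<epsilon>"
      unfolding norm_scaleR using c by (intro mult_mono[OF 1 2]) auto
  qed
  also have "\<dots> = real (card (lattice (verts T) k)) * ((real k * (2 + c)) ^ k * \<epsilon>)"
    by simp
  also have "\<dots> \<le> real ((k + 1) ^ (DIM('a) + 1)) * ((real k * (2 + c)) ^ k * \<epsilon>)"
  proof (rule mult_right_mono)
    show "real (card (lattice (verts T) k)) \<le> real ((k + 1) ^ (DIM('a) + 1))"
      using card_lattice_le[of k] unfolding full_mesh_card[OF S] by (rule of_nat_mono)
  qed (use c \<open>\<epsilon> \<ge> 0\<close> in simp)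
  finally show ?thesis
    by (simp add: growth_const_def mult.assoc)
qed

section \<open>Taylor expansion\<close>

text \<open>\<open>partials\<close> consumes its list from the head, so the last entry is the
  outermost derivative; the Taylor argument differentiates at this end.\<close>

lemma partials_snoc:
  "partials (bs @ [b]) f x = frechet_derivative (partials bs f) (at x) b"
  by (induction bs arbitrary: f) auto

lemma gradient_eqI:
  assumes "GDERIV f x :> D"
  shows "gradient f x = D"
  unfolding gradient_def
proof (rule the_equality)
  fix E assume "GDERIV f x :> E"
  then have "(\<lambda>h. h \<bullet> E) = (\<lambda>h. h \<bullet> D)"
    using assms unfolding gderiv_def by (rule has_derivative_unique)
  then have "(E - D) \<bullet> E = (E - D) \<bullet> D"
    by (rule fun_cong)
  then have "(E - D) \<bullet> (E - D) = 0"
    by (simp only: inner_diff_right[of "E - D" E D])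
  then show "E = D"
    by simp
qed (rule assms)

lemma Cm_on_partials:
  assumes "Cm_on (Suc m) f U" "b \<in> Basis"
  shows "Cm_on m (partials [b] f) U"
proof -
  have "partials bs (partials [b] f) = partials (b # bs) f" for bs
    by simp
  moreover have "partials (b # bs) f differentiable_on U"
    if "set bs \<subseteq> Basis" "length bs < m" for bs
    using assms that unfolding Cm_on_def by (metis insert_subset length_Cons list.simps(15) Suc_less_eq)
  moreover have "continuous_on U (partials (b # bs) f)"
    if "set bs \<subseteq> Basis" "length bs \<le> m" for bs
    using assms that unfolding Cm_on_def by (metis insert_subset length_Cons list.simps(15) Suc_le_mono)
  ultimately show ?thesis
    unfolding Cm_on_def by (simp only:) blast
qed

lemma Cm_on_mono: "Cm_on m f U \<Longrightarrow> n \<le> m \<Longrightarrow> Cm_on n f U"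
  unfolding Cm_on_def by (meson le_trans less_le_trans)

lemma partials_has_derivative:
  assumes "Cm_on m f U" "open U" "set bs \<subseteq> Basis" "length bs < m" "x \<in> U"
  shows "(partials bs f has_derivative (\<lambda>w. \<Sum>b\<in>Basis. (w \<bullet> b) * partials (bs @ [b]) f x)) (at x)"
proof -
  let ?D = "frechet_derivative (partials bs f) (at x)"
  have "partials bs f differentiable_on U"
    using assms unfolding Cm_on_def by blast
  then have "partials bs f differentiable (at x)"
    using assms(2,5) by (metis differentiable_on_def at_within_open)
  then have D: "(partials bs f has_derivative ?D) (at x)"
    by (simp add: frechet_derivative_works)
  then have "linear ?D"
    by (rule has_derivative_linear)
  have "?D w = (\<Sum>b\<in>Basis. (w \<bullet> b) * partials (bs @ [b]) f x)" for w
  proof -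
    have "?D w = ?D (\<Sum>b\<in>Basis. (w \<bullet> b) *\<^sub>R b)"
      by (simp only: euclidean_representation)
    also have "\<dots> = (\<Sum>b\<in>Basis. (w \<bullet> b) * ?D b)"
      by (simp only: linear_sum[OF \<open>linear ?D\<close>] linear_scale[OF \<open>linear ?D\<close>] real_scaleR_def)
    finally show ?thesis
      by (simp only: partials_snoc)
  qed
  then have "?D = (\<lambda>w. \<Sum>b\<in>Basis. (w \<bullet> b) * partials (bs @ [b]) f x)"
    by (rule ext)
  with D show ?thesis
    by simp
qed

section \<open>Gradients and first-order expansion\<close>

lemma Cm_on_gderiv:
  assumes "Cm_on m f U" "open U" "m \<ge> 1" "x \<in> U"
  shows "GDERIV f x :> gradient f x"
    and "b \<in> Basis \<Longrightarrow> gradient f x \<bullet> b = partials [b] f x"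
    and "gradient f x = (\<Sum>b\<in>Basis. partials [b] f x *\<^sub>R b)"
proof -
  have "(f has_derivative (\<lambda>w. \<Sum>b\<in>Basis. (w \<bullet> b) * partials [b] f x)) (at x)"
    using partials_has_derivative[OF assms(1,2), of "[]" x] assms by simp
  moreover have "(\<Sum>b\<in>Basis. (w \<bullet> b) * partials [b] f x) = w \<bullet> (\<Sum>b\<in>Basis. partials [b] f x *\<^sub>R b)" for w
    by (simp add: inner_sum_right mult.commute)
  ultimately have G: "GDERIV f x :> (\<Sum>b\<in>Basis. partials [b] f x *\<^sub>R b)"
    unfolding gderiv_def by simp
  then show eq: "gradient f x = (\<Sum>b\<in>Basis. partials [b] f x *\<^sub>R b)"
    by (rule gradient_eqI)
  with G show "GDERIV f x :> gradient f x"
    by simp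
  show "b \<in> Basis \<Longrightarrow> gradient f x \<bullet> b = partials [b] f x"
    unfolding eq by (simp add: inner_sum_left_Basis)
qed

lemma Cm_on_gradient_derivative:
  assumes "Cm_on m f U" "open U" "m \<ge> 2" "x \<in> U"
  shows "(gradient f has_derivative frechet_derivative (gradient f) (at x)) (at x)"
proof -
  have "(\<lambda>y. \<Sum>b\<in>Basis. partials [b] f y *\<^sub>R b) differentiable (at x)"
  proof (intro differentiable_sum ballI finite_Basis differentiable_scaleR differentiable_const)
    fix b :: 'a assume "b \<in> Basis"
    then show "partials [b] f differentiable at x"
      using partials_has_derivative[OF assms(1,2), of "[b]" x] assms(3,4)
      unfolding differentiable_def by auto
  qed
  then obtain D where "((\<lambda>y. \<Sum>b\<in>Basis. partials [b] f y *\<^sub>R b) has_derivative D) (at x)"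
    unfolding differentiable_def by blast
  then have "(gradient f has_derivative D) (at x)"
    by (rule has_derivative_transform_within_open[OF _ assms(2,4)])
      (use assms in \<open>simp add: Cm_on_gderiv(3)\<close>)
  then show ?thesis
    by (metis differentiable_def frechet_derivative_works)
qed

lemma gradient_lipschitz:
  assumes f: "Cm_on m f U" "open U" "m \<ge> 2"
    and c: "\<And>x. x \<in> U \<Longrightarrow> onorm (frechet_derivative (gradient f) (at x)) \<le> c"
    and S: "convex S" "S \<subseteq> U" "x \<in> S" "y \<in> S"
  shows "norm (gradient f x - gradient f y) \<le> c * norm (x - y)"
proof (rule differentiable_bound[OF S(1) _ _ S(3,4)])
  fix x assume "x \<in> S"
  then have x: "x \<in> U"
    using S by auto
  show "(gradient f has_derivative frechet_derivative (gradient f) (at x)) (at x within S)"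
    using Cm_on_gradient_derivative[OF f x] by (rule has_derivative_at_withinI)
  show "onorm (frechet_derivative (gradient f) (at x)) \<le> c"
    using x by (rule c)
qed

text \<open>The mean value inequality for \<open>f\<close> minus its linearization at
  \<open>x0\<close>, whose gradient is at most \<open>c * s\<close> within distance \<open>s\<close>
  of \<open>x0\<close>. As \<open>x0\<close> may differ from \<open>y\<close>, the derivative can be
  frozen at a base point, as the Newton steps require.\<close>

lemma first_order_expansion:
  assumes f: "Cm_on m f U" "open U" "m \<ge> 2"
    and c: "\<And>x. x \<in> U \<Longrightarrow> onorm (frechet_derivative (gradient f) (at x)) \<le> c"
    and S: "convex S" "S \<subseteq> U" "x0 \<in> S"
    and y: "y \<in> S" "dist x0 y \<le> s" and y': "y' \<in> S" "dist x0 y' \<le> s"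
  shows "\<bar>f y' - f y - gradient f x0 \<bullet> (y' - y)\<bar> \<le> c * s * norm (y' - y)"
proof -
  define g where "g x = f x - gradient f x0 \<bullet> x" for x
  have c0: "c \<ge> 0"
    using c[of x0] S onorm_pos_le[OF has_derivative_bounded_linear[OF Cm_on_gradient_derivative[OF f, of x0]]]
    by auto
  have "norm (g y' - g y) \<le> (c * s) * norm (y' - y)"
  proof (rule differentiable_bound[where S = "S \<inter> cball x0 s"])
    show "convex (S \<inter> cball x0 s)"
      using S by (auto intro: convex_Int)
    fix x assume x: "x \<in> S \<inter> cball x0 s"
    then have "x \<in> U"
      using S by auto
    then have "(f has_derivative (\<lambda>w. w \<bullet> gradient f x)) (at x)"
      using Cm_on_gderiv(1)[OF f(1,2), of x] f(3) by (simp add: gderiv_def)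
    then have "(g has_derivative (\<lambda>w. w \<bullet> gradient f x - gradient f x0 \<bullet> w)) (at x)"
      unfolding g_def by (intro derivative_intros) auto
    then have "(g has_derivative (\<lambda>w. w \<bullet> (gradient f x - gradient f x0))) (at x)"
      by (simp add: inner_diff_right inner_commute)
    then show "(g has_derivative (\<lambda>w. w \<bullet> (gradient f x - gradient f x0))) (at x within S \<inter> cball x0 s)"
      by (rule has_derivative_at_withinI)
    have "norm (gradient f x - gradient f x0) \<le> c * norm (x - x0)"
      using x S by (intro gradient_lipschitz[OF f c S(1,2)]) auto
    also have "\<dots> \<le> c * s"
      using x c0 by (intro mult_left_mono) (auto simp: dist_norm norm_minus_commute)
    finally have *: "norm (gradient f x - gradient f x0) \<le> c * s" .
    have "norm (w \<bullet> (gradient f x - gradient f x0)) \<le> c * s * norm w" for w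
    proof -
      have "norm (w \<bullet> (gradient f x - gradient f x0)) \<le> norm w * norm (gradient f x - gradient f x0)"
        using Cauchy_Schwarz_ineq2[of w "gradient f x - gradient f x0"] by simp
      also have "\<dots> \<le> norm w * (c * s)"
        using * by (intro mult_left_mono) auto
      finally show ?thesis
        by (simp add: mult_ac)
    qed
    then show "onorm (\<lambda>w. w \<bullet> (gradient f x - gradient f x0)) \<le> c * s"
      by (rule onorm_le)
  qed (use y y' in auto)
  then show ?thesis
    by (simp add: g_def inner_diff_right algebra_simps)
qed

text \<open>The derivative of order \<open>m\<close> applied to \<open>m\<close> copies of
  \<open>w\<close>; summing over ordered lists instead of multi-indices avoids multinomial
  coefficients.\<close>

definition taylor_term :: "nat \<Rightarrow> ('a::euclidean_space \<Rightarrow> real) \<Rightarrow> 'a \<Rightarrow> 'a \<Rightarrow> real" where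
  "taylor_term m f x w =
    (\<Sum>bs\<in>{bs. set bs \<subseteq> Basis \<and> length bs = m}. (\<Prod>b\<leftarrow>bs. w \<bullet> b) * partials bs f x)"

lemma taylor_term_0: "taylor_term 0 f x w = f x"
proof -
  have "{bs :: 'a list. set bs \<subseteq> Basis \<and> length bs = 0} = {[]}"
    by auto
  then show ?thesis
    unfolding taylor_term_def by simp
qed

lemma finite_basis_lists: "finite {bs. set bs \<subseteq> (Basis :: 'a::euclidean_space set) \<and> length bs = m}"
  by (rule finite_lists_length_eq[OF finite_Basis])

lemma taylor_term_Suc:
  "taylor_term (Suc m) f x w = (\<Sum>bs\<in>{bs. set bs \<subseteq> Basis \<and> length bs = m}.
     (\<Prod>b\<leftarrow>bs. w \<bullet> b) * (\<Sum>b\<in>Basis. (w \<bullet> b) * partials (bs @ [b]) f x))"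
proof -
  have "(\<Sum>bs\<in>{bs. set bs \<subseteq> Basis \<and> length bs = m}.
      (\<Prod>b\<leftarrow>bs. w \<bullet> b) * (\<Sum>b\<in>Basis. (w \<bullet> b) * partials (bs @ [b]) f x))
    = (\<Sum>(bs, b)\<in>{bs. set bs \<subseteq> Basis \<and> length bs = m} \<times> Basis.
      (\<Prod>b\<leftarrow>bs @ [b]. w \<bullet> b) * partials (bs @ [b]) f x)"
    by (simp add: sum.cartesian_product[symmetric] sum_distrib_left mult.assoc)
  also have "\<dots> = taylor_term (Suc m) f x w"
    unfolding taylor_term_def
    by (rule sum.reindex_bij_witness[of _ "\<lambda>cs. (butlast cs, last cs)" "\<lambda>(bs, b). bs @ [b]"])
      (auto simp: append_butlast_last_id[OF length_greater_0_conv[THEN iffD1]]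
        dest: in_set_butlastD, (metis last_in_set length_0_conv nat.distinct(1) subsetD)+)
  finally show ?thesis
    by simp
qed

lemma taylor_term_deriv:
  assumes "Cm_on M f U" "open U" "m < M" "x + t *\<^sub>R w \<in> U"
  shows "((\<lambda>t. taylor_term m f (x + t *\<^sub>R w) w) has_real_derivative
    taylor_term (Suc m) f (x + t *\<^sub>R w) w) (at t)"
proof -
  have "((\<lambda>t. partials bs f (x + t *\<^sub>R w)) has_real_derivative
      (\<Sum>b\<in>Basis. (w \<bullet> b) * partials (bs @ [b]) f (x + t *\<^sub>R w))) (at t)"
    if "set bs \<subseteq> Basis" "length bs = m" for bs
  proof -
    have "((\<lambda>t. partials bs f (x + t *\<^sub>R w)) has_derivative
        (\<lambda>s. \<Sum>b\<in>Basis. ((s *\<^sub>R w) \<bullet> b) * partials (bs @ [b]) f (x + t *\<^sub>R w))) (at t)"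
      by (rule has_derivative_compose[OF _ partials_has_derivative[OF assms(1,2) that(1)]])
        (use assms that in \<open>auto intro!: derivative_eq_intros\<close>)
    then show ?thesis
      unfolding has_field_derivative_def
      by (rule has_derivative_eq_rhs) (auto simp: sum_distrib_left sum_distrib_right mult_ac)
  qed
  then show ?thesis
    unfolding taylor_term_def[of m] taylor_term_Suc
    by (intro DERIV_sum DERIV_cmult) auto
qed

lemma prod_list_inner_abs_le:
  assumes "set bs \<subseteq> Basis"
  shows "\<bar>\<Prod>b\<leftarrow>bs. w \<bullet> b\<bar> \<le> norm w ^ length bs"
  using assms
  by (induction bs) (auto simp: abs_mult Basis_le_norm intro!: mult_mono)

lemma taylor_term_abs_le:
  fixes x w :: "'a::euclidean_space"
  assumes "\<And>bs. set bs \<subseteq> Basis \<Longrightarrow> length bs = m \<Longrightarrow> \<bar>partials bs f x\<bar> \<le> M"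
  shows "\<bar>taylor_term m f x w\<bar> \<le> real (DIM('a)) ^ m * M * norm w ^ m"
proof -
  have "\<bar>taylor_term m f x w\<bar> \<le> (\<Sum>bs\<in>{bs. set bs \<subseteq> (Basis :: 'a set) \<and> length bs = m}. norm w ^ m * M)"
    unfolding taylor_term_def
  proof (rule order_trans[OF sum_abs], rule sum_mono)
    fix bs :: "'a list" assume "bs \<in> {bs. set bs \<subseteq> Basis \<and> length bs = m}"
    then have "\<bar>\<Prod>b\<leftarrow>bs. w \<bullet> b\<bar> * \<bar>partials bs f x\<bar> \<le> norm w ^ m * M"
      using prod_list_inner_abs_le[of bs w] assms[of bs] by (intro mult_mono) auto
    then show "\<bar>(\<Prod>b\<leftarrow>bs. w \<bullet> b) * partials bs f x\<bar> \<le> norm w ^ m * M"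
      by (simp add: abs_mult)
  qed
  then show ?thesis
    by (simp add: card_lists_length_eq mult_ac)
qed

text \<open>Along the segment from \<open>x0\<close> to \<open>x\<close> the successive derivatives
  of \<open>f\<close> are the Taylor terms in direction \<open>w\<close>, so the one-dimensional
  theorem applies. The remainder is a sum over \<open>DIM('a) ^ n\<close> lists, and
  \<open>fact n\<close> is estimated by 1.\<close>

lemma taylor_remainder:
  fixes x0 :: "'a::euclidean_space"
  assumes f: "Cm_on n f U" "open U" "n > 0" and ball: "cball x0 r \<subseteq> U"
    and M: "\<And>bs y. set bs \<subseteq> Basis \<Longrightarrow> length bs \<le> n \<Longrightarrow> y \<in> cball x0 r \<Longrightarrow> \<bar>partials bs f y\<bar> \<le> M"
    and x: "x \<in> cball x0 r"
  shows "\<bar>f x - (\<Sum>m<n. taylor_term m f x0 (x - x0) / fact m)\<bar> \<le> real (DIM('a)) ^ n * M * dist x0 x ^ n"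
proof -
  define w where "w = x - x0"
  have seg: "x0 + t *\<^sub>R w \<in> cball x0 r" if "0 \<le> t" "t \<le> 1" for t
  proof -
    have "t * norm w \<le> 1 * norm w"
      using that by (intro mult_right_mono) auto
    then show ?thesis
      using that x by (simp add: w_def dist_norm norm_minus_commute)
  qed
  have "\<exists>t>0. t < 1 \<and> f x = (\<Sum>m<n. taylor_term m f x0 w / fact m) + taylor_term n f (x0 + t *\<^sub>R w) w / fact n"
    using Taylor[of n "\<lambda>m t. taylor_term m f (x0 + t *\<^sub>R w) w" "\<lambda>t. f (x0 + t *\<^sub>R w)" 0 1 0 1]
      f(3) taylor_term_deriv[OF f(1,2)] seg ball
    by (auto simp: taylor_term_0 w_def subset_iff)
  then obtain t where t: "0 < t" "t < 1"
    "f x - (\<Sum>m<n. taylor_term m f x0 w / fact m) = taylor_term n f (x0 + t *\<^sub>R w) w / fact n"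
    by auto
  have "\<bar>taylor_term n f (x0 + t *\<^sub>R w) w / fact n\<bar> \<le> \<bar>taylor_term n f (x0 + t *\<^sub>R w) w\<bar> / 1"
    unfolding abs_divide by (intro divide_left_mono) (auto simp: fact_ge_1)
  also have "\<dots> \<le> real (DIM('a)) ^ n * M * norm w ^ n"
    using taylor_term_abs_le[of n f "x0 + t *\<^sub>R w" M w] M seg t by simp
  finally show ?thesis
    using t(3) by (simp add: w_def dist_norm norm_minus_commute)
qed

section \<open>Polynomials with bounded coefficients\<close>

text \<open>A list of pairs of a coefficient and a list of basis vectors represents the polynomial with
  these monomials, centred at \<open>x0\<close>. The representation is not unique; \<open>C\<close> bounds the sum of the
  absolute values of the coefficients and \<open>N\<close> the degree.\<close>

definition pl_eval :: "'a::euclidean_space \<Rightarrow> (real \<times> 'a list) list \<Rightarrow> 'a \<Rightarrow> real" where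
  "pl_eval x0 L x = (\<Sum>(c, bs)\<leftarrow>L. c * (\<Prod>b\<leftarrow>bs. (x - x0) \<bullet> b))"

definition pl_norm :: "(real \<times> 'a::euclidean_space list) list \<Rightarrow> real" where
  "pl_norm L = (\<Sum>(c, bs)\<leftarrow>L. \<bar>c\<bar>)"

definition pl_deg :: "nat \<Rightarrow> (real \<times> 'a::euclidean_space list) list \<Rightarrow> bool" where
  "pl_deg N L \<longleftrightarrow> (\<forall>(c, bs)\<in>set L. set bs \<subseteq> Basis \<and> length bs \<le> N)"

definition bpoly :: "'a::euclidean_space \<Rightarrow> nat \<Rightarrow> real \<Rightarrow> ('a \<Rightarrow> real) \<Rightarrow> bool" where
  "bpoly x0 N C f \<longleftrightarrow> (\<exists>L. f = pl_eval x0 L \<and> pl_norm L \<le> C \<and> pl_deg N L)"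

lemma pl_simps:
  "pl_eval x0 [] x = 0"
  "pl_eval x0 ((c, bs) # L) x = c * (\<Prod>b\<leftarrow>bs. (x - x0) \<bullet> b) + pl_eval x0 L x"
  "pl_eval x0 (L @ L') x = pl_eval x0 L x + pl_eval x0 L' x"
  "pl_norm [] = 0"
  "pl_norm ((c, bs) # L) = \<bar>c\<bar> + pl_norm L"
  "pl_norm (L @ L') = pl_norm L + pl_norm L'"
  "pl_deg N []"
  "pl_deg N ((c, bs) # L) \<longleftrightarrow> set bs \<subseteq> Basis \<and> length bs \<le> N \<and> pl_deg N L"
  "pl_deg N (L @ L') \<longleftrightarrow> pl_deg N L \<and> pl_deg N L'"
  by (auto simp: pl_eval_def pl_norm_def pl_deg_def)

lemma pl_norm_nonneg: "pl_norm L \<ge> 0"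
  by (induction L) (auto simp: pl_simps)

lemma pl_deg_mono: "pl_deg N L \<Longrightarrow> N \<le> N' \<Longrightarrow> pl_deg N' L"
  by (induction L) (auto simp: pl_simps)

lemma bpoly_mono: "bpoly x0 N C f \<Longrightarrow> N \<le> N' \<Longrightarrow> C \<le> C' \<Longrightarrow> bpoly x0 N' C' f"
  unfolding bpoly_def using pl_deg_mono order_trans by blast

lemma bpoly_monomial:
  assumes "set bs \<subseteq> Basis" "length bs \<le> N" "\<bar>c\<bar> \<le> C"
  shows "bpoly x0 N C (\<lambda>x. c * (\<Prod>b\<leftarrow>bs. (x - x0) \<bullet> b))"
  unfolding bpoly_def using assms
  by (intro exI[of _ "[(c, bs)]"]) (auto simp: pl_simps fun_eq_iff)

lemma bpoly_const: "\<bar>c\<bar> \<le> C \<Longrightarrow> bpoly x0 N C (\<lambda>x. c)"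
  using bpoly_monomial[of "[]" N c C x0] by simp

lemma bpoly_coord: "b \<in> Basis \<Longrightarrow> N \<ge> 1 \<Longrightarrow> bpoly x0 N 1 (\<lambda>x. (x - x0) \<bullet> b)"
  using bpoly_monomial[of "[b]" N 1 1 x0] by simp

lemma bpoly_add:
  assumes "bpoly x0 N C f" "bpoly x0 N D g"
  shows "bpoly x0 N (C + D) (\<lambda>x. f x + g x)"
proof -
  obtain L L' where L: "f = pl_eval x0 L" "pl_norm L \<le> C" "pl_deg N L"
    "g = pl_eval x0 L'" "pl_norm L' \<le> D" "pl_deg N L'"
    using assms unfolding bpoly_def by blast
  then show ?thesis
    unfolding bpoly_def by (intro exI[of _ "L @ L'"]) (auto simp: pl_simps fun_eq_iff)
qed

lemma bpoly_sum:
  assumes "finite I" "\<And>i. i \<in> I \<Longrightarrow> bpoly x0 N (C i) (f i)"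
  shows "bpoly x0 N (sum C I) (\<lambda>x. \<Sum>i\<in>I. f i x)"
  using assms
  by (induction I rule: finite_induct) (auto intro: bpoly_const bpoly_add)

lemma pl_mult_single:
  "\<exists>L'. (\<forall>x. pl_eval x0 L' x = c * (\<Prod>b\<leftarrow>bs. (x - x0) \<bullet> b) * pl_eval x0 L x)
    \<and> pl_norm L' = \<bar>c\<bar> * pl_norm L
    \<and> (\<forall>N M. set bs \<subseteq> Basis \<longrightarrow> length bs \<le> N \<longrightarrow> pl_deg M L \<longrightarrow> pl_deg (N + M) L')"
proof (induction L)
  case Nil
  show ?case
    by (rule exI[of _ "[]"]) (auto simp: pl_simps)
next
  case (Cons a L)
  obtain d cs where a: "a = (d, cs)"
    by (cases a)
  obtain L' where L': "\<forall>x. pl_eval x0 L' x = c * (\<Prod>b\<leftarrow>bs. (x - x0) \<bullet> b) * pl_eval x0 L x"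
    "pl_norm L' = \<bar>c\<bar> * pl_norm L"
    "\<forall>N M. set bs \<subseteq> Basis \<longrightarrow> length bs \<le> N \<longrightarrow> pl_deg M L \<longrightarrow> pl_deg (N + M) L'"
    using Cons.IH by blast
  show ?case
    by (rule exI[of _ "(c * d, bs @ cs) # L'"])
      (auto simp: pl_simps a L' algebra_simps abs_mult intro: add_mono)
qed

lemma bpoly_mult:
  assumes "bpoly x0 N C f" "bpoly x0 M D g"
  shows "bpoly x0 (N + M) (C * D) (\<lambda>x. f x * g x)"
proof -
  obtain L K where L: "f = pl_eval x0 L" "pl_norm L \<le> C" "pl_deg N L"
    and K: "g = pl_eval x0 K" "pl_norm K \<le> D" "pl_deg M K"
    using assms unfolding bpoly_def by blast
  have "\<exists>L'. (\<forall>x. pl_eval x0 L' x = pl_eval x0 L x * pl_eval x0 K x)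
      \<and> pl_norm L' \<le> pl_norm L * pl_norm K \<and> pl_deg (N + M) L'"
    using L(3)
  proof (induction L)
    case Nil
    show ?case
      by (rule exI[of _ "[]"]) (auto simp: pl_simps)
  next
    case (Cons a L)
    obtain c bs where a: "a = (c, bs)"
      by (cases a)
    then have bs: "set bs \<subseteq> Basis" "length bs \<le> N" "pl_deg N L"
      using Cons.prems by (auto simp: pl_simps)
    obtain L1 where L1: "\<forall>x. pl_eval x0 L1 x = pl_eval x0 L x * pl_eval x0 K x"
      "pl_norm L1 \<le> pl_norm L * pl_norm K" "pl_deg (N + M) L1"
      using Cons.IH bs by blast
    obtain L2 where L2: "\<forall>x. pl_eval x0 L2 x = c * (\<Prod>b\<leftarrow>bs. (x - x0) \<bullet> b) * pl_eval x0 K x"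
      "pl_norm L2 = \<bar>c\<bar> * pl_norm K" "pl_deg (N + M) L2"
      using pl_mult_single[of x0 c bs K] bs K(3) by blast
    show ?case
      by (rule exI[of _ "L2 @ L1"]) (use L1 L2 in \<open>auto simp: pl_simps a algebra_simps\<close>)
  qed
  then obtain L' where L': "\<forall>x. pl_eval x0 L' x = pl_eval x0 L x * pl_eval x0 K x"
    "pl_norm L' \<le> pl_norm L * pl_norm K" "pl_deg (N + M) L'"
    by blast
  have "pl_norm L * pl_norm K \<le> C * D"
    using L K pl_norm_nonneg[of K] pl_norm_nonneg[of L] by (intro mult_mono) auto
  then show ?thesis
    unfolding bpoly_def using L' L K by (intro exI[of _ L']) auto
qed

lemma bpoly_cmult: "bpoly x0 N C f \<Longrightarrow> \<bar>c\<bar> \<le> D \<Longrightarrow> bpoly x0 N (D * C) (\<lambda>x. c * f x)"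
  using bpoly_mult[OF bpoly_const[of c D x0 0]] by simp

lemma bpoly_diff:
  assumes "bpoly x0 N C f" "bpoly x0 N D g"
  shows "bpoly x0 N (C + D) (\<lambda>x. f x - g x)"
  using bpoly_add[OF assms(1) bpoly_cmult[OF assms(2), of "-1" 1]] by simp

text \<open>A discarded monomial has degree at least \<open>Suc n\<close>, so for
  \<open>h \<le> 1\<close> it is at most its coefficient times \<open>h ^ Suc n\<close>; the
  coefficient sum bounds the total. One truncation \<open>g\<close> serves all radii
  \<open>h\<close>.\<close>

lemma bpoly_truncate:
  assumes "bpoly x0 N C f"
  obtains g where "bpoly x0 n C g"
    "\<And>x h. norm (x - x0) \<le> h \<Longrightarrow> h \<le> 1 \<Longrightarrow> \<bar>f x - g x\<bar> \<le> C * h ^ Suc n"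
proof -
  obtain L where L: "f = pl_eval x0 L" "pl_norm L \<le> C" "pl_deg N L"
    using assms unfolding bpoly_def by blast
  have "\<exists>K. pl_norm K \<le> pl_norm L \<and> pl_deg n K \<and>
      (\<forall>x h. norm (x - x0) \<le> h \<longrightarrow> h \<le> 1 \<longrightarrow> \<bar>pl_eval x0 L x - pl_eval x0 K x\<bar> \<le> pl_norm L * h ^ Suc n)"
    using L(3)
  proof (induction L)
    case Nil
    show ?case
      by (rule exI[of _ "[]"]) (auto simp: pl_simps)
  next
    case (Cons a L)
    obtain c bs where a: "a = (c, bs)"
      by (cases a)
    then have bs: "set bs \<subseteq> Basis" "pl_deg N L"
      using Cons.prems by (auto simp: pl_simps)
    then obtain K where K: "pl_norm K \<le> pl_norm L" "pl_deg n K"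
      and K': "\<And>x h. norm (x - x0) \<le> h \<Longrightarrow> h \<le> 1 \<Longrightarrow>
        \<bar>pl_eval x0 L x - pl_eval x0 K x\<bar> \<le> pl_norm L * h ^ Suc n"
      using Cons.IH by blast
    show ?case
    proof (cases "length bs \<le> n")
      case True
      have "\<bar>pl_eval x0 (a # L) x - pl_eval x0 (a # K) x\<bar> \<le> pl_norm (a # L) * h ^ Suc n"
        if h: "norm (x - x0) \<le> h" "h \<le> 1" for x h
      proof -
        have "h \<ge> 0"
          using h norm_ge_zero order_trans by blast
        then have "\<bar>c\<bar> * h ^ Suc n \<ge> 0"
          by simp
        with K'[OF h] show ?thesis
          by (simp add: a pl_simps distrib_right del: power_Suc)
      qed
      then show ?thesis
        using K True bs by (intro exI[of _ "a # K"]) (auto simp: pl_simps a)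
    next
      case False
      have "\<bar>pl_eval x0 (a # L) x - pl_eval x0 K x\<bar> \<le> pl_norm (a # L) * h ^ Suc n"
        if h: "norm (x - x0) \<le> h" "h \<le> 1" for x h
      proof -
        have "h \<ge> 0"
          using h norm_ge_zero order_trans by blast
        have "\<bar>\<Prod>b\<leftarrow>bs. (x - x0) \<bullet> b\<bar> \<le> norm (x - x0) ^ length bs"
          using bs by (intro prod_list_inner_abs_le)
        also have "\<dots> \<le> h ^ length bs"
          using h by (intro power_mono) auto
        also have "\<dots> \<le> h ^ Suc n"
          using h \<open>h \<ge> 0\<close> False by (intro power_decreasing) auto
        finally have "\<bar>c * (\<Prod>b\<leftarrow>bs. (x - x0) \<bullet> b)\<bar> \<le> \<bar>c\<bar> * h ^ Suc n"
          unfolding abs_mult by (intro mult_left_mono) auto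
        with K'[OF h] show ?thesis
          by (simp add: a pl_simps distrib_right del: power_Suc)
      qed
      then show ?thesis
        using K by (intro exI[of _ K]) (auto simp: pl_simps a)
    qed
  qed
  then obtain K where K: "pl_norm K \<le> pl_norm L" "pl_deg n K"
    and K': "\<And>x h. norm (x - x0) \<le> h \<Longrightarrow> h \<le> 1 \<Longrightarrow>
        \<bar>pl_eval x0 L x - pl_eval x0 K x\<bar> \<le> pl_norm L * h ^ Suc n"
    by blast
  show ?thesis
  proof (rule that[of "pl_eval x0 K"])
    show "bpoly x0 n C (pl_eval x0 K)"
      unfolding bpoly_def using K L by (intro exI[of _ K]) auto
    fix x h assume h: "norm (x - x0) \<le> h" "h \<le> 1"
    then have "h \<ge> 0"
      using norm_ge_zero order_trans by blast
    have "\<bar>f x - pl_eval x0 K x\<bar> \<le> pl_norm L * h ^ Suc n"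
      using K'[OF h] L by simp
    also have "\<dots> \<le> C * h ^ Suc n"
      using L \<open>h \<ge> 0\<close> by (intro mult_right_mono) auto
    finally show "\<bar>f x - pl_eval x0 K x\<bar> \<le> C * h ^ Suc n" .
  qed
qed

lemma bpoly_poly_deg_le:
  assumes "bpoly x0 N C f"
  shows "poly_deg_le N f"
proof -
  have mono: "poly_deg_le (length bs) (\<lambda>x. c * (\<Prod>b\<leftarrow>bs. (x - x0) \<bullet> b))"
    for bs :: "'a list" and c :: real
  proof (induction bs)
    case (Cons b bs)
    have "(- (x0 \<bullet> b) + b \<bullet> x) *\<^sub>R (c * (\<Prod>b\<leftarrow>bs. (x - x0) \<bullet> b))
        = c * (\<Prod>b\<leftarrow>b # bs. (x - x0) \<bullet> b)" for x
      by (simp add: inner_diff_left inner_diff_right inner_commute)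
    with poly_deg_le_affine_scaleR[OF Cons.IH, of "- (x0 \<bullet> b)" b] show ?case
      by (simp only: length_Cons)
  qed (simp add: poly_deg_le_const)
  obtain L where L: "f = pl_eval x0 L" "pl_deg N L"
    using assms unfolding bpoly_def by blast
  have "poly_deg_le N (\<lambda>x. pl_eval x0 L x)"
    using L(2)
  proof (induction L)
    case (Cons a L)
    then show ?case
      by (cases a) (auto simp: pl_simps intro!: poly_deg_le_add poly_deg_le_mono[OF mono])
  next
    case Nil
    have "pl_eval x0 [] = (\<lambda>x. 0)"
      by (simp add: fun_eq_iff pl_simps)
    then show ?case
      by (simp add: poly_deg_le_const)
  qed
  then show ?thesis
    by (simp add: L)
qed

text \<open>\<open>Y\<close> is expanded about the same centre \<open>x0\<close>, so each factor of
  a monomial is simply replaced by a bounded polynomial; \<open>D \<ge> 1\<close> lets monomials of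
  lower degree share the bound \<open>D ^ N\<close>.\<close>

lemma bpoly_compose:
  assumes f: "bpoly x0 N C f" and Y: "\<And>b. b \<in> Basis \<Longrightarrow> bpoly x0 M D (\<lambda>x. (Y x - x0) \<bullet> b)"
    and "D \<ge> 1"
  shows "bpoly x0 (N * M) (C * D ^ N) (\<lambda>x. f (Y x))"
proof -
  have prod: "bpoly x0 (length bs * M) (D ^ length bs) (\<lambda>x. \<Prod>b\<leftarrow>bs. (Y x - x0) \<bullet> b)"
    if "set bs \<subseteq> Basis" for bs
    using that
  proof (induction bs)
    case (Cons b bs)
    then show ?case
      using bpoly_mult[OF Y[of b], of "length bs * M" "D ^ length bs"] by simp
  qed (simp add: bpoly_const)
  obtain L where L: "f = pl_eval x0 L" "pl_norm L \<le> C" "pl_deg N L"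
    using f unfolding bpoly_def by blast
  have "bpoly x0 (N * M) (pl_norm L * D ^ N) (\<lambda>x. pl_eval x0 L (Y x))"
    using L(3)
  proof (induction L)
    case (Cons a L)
    obtain c bs where a: "a = (c, bs)"
      by (cases a)
    then have bs: "set bs \<subseteq> Basis" "length bs \<le> N" "pl_deg N L"
      using Cons.prems by (auto simp: pl_simps)
    have "bpoly x0 (N * M) (\<bar>c\<bar> * D ^ N) (\<lambda>x. c * (\<Prod>b\<leftarrow>bs. (Y x - x0) \<bullet> b))"
      using bs \<open>D \<ge> 1\<close>
      by (intro bpoly_mono[OF bpoly_cmult[OF prod order_refl]] mult_le_mono mult_left_mono power_increasing)
        auto
    from bpoly_add[OF this Cons.IH[OF bs(3)]] show ?case
      by (simp add: a pl_simps distrib_right)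
  qed (simp add: pl_simps bpoly_const)
  then show ?thesis
    unfolding L(1)
    by (rule bpoly_mono) (use L \<open>D \<ge> 1\<close> in \<open>auto intro!: mult_right_mono\<close>)
qed

lemma taylor_bpoly:
  fixes x0 :: "'a::euclidean_space"
  assumes f: "Cm_on (Suc k) f U" "open U" and ball: "cball x0 r \<subseteq> U" "r \<ge> 0"
    and M: "\<And>bs y. set bs \<subseteq> Basis \<Longrightarrow> length bs \<le> Suc k \<Longrightarrow> y \<in> cball x0 r \<Longrightarrow> \<bar>partials bs f y\<bar> \<le> M"
  obtains P where "bpoly x0 k (\<Sum>m<Suc k. real (DIM('a)) ^ m * M) P"
    "\<And>x. x \<in> cball x0 r \<Longrightarrow> \<bar>f x - P x\<bar> \<le> real (DIM('a)) ^ Suc k * M * dist x0 x ^ Suc k"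
proof
  define P where "P x = (\<Sum>m<Suc k. taylor_term m f x0 (x - x0) / fact m)" for x
  show "\<bar>f x - P x\<bar> \<le> real (DIM('a)) ^ Suc k * M * dist x0 x ^ Suc k" if "x \<in> cball x0 r" for x
    unfolding P_def by (rule taylor_remainder[OF f _ ball(1) M that]) auto
  have "bpoly x0 k (real (DIM('a)) ^ m * M) (\<lambda>x. taylor_term m f x0 (x - x0) / fact m)"
    if "m < Suc k" for m
  proof -
    have "bpoly x0 k (\<Sum>bs\<in>{bs. set bs \<subseteq> (Basis :: 'a set) \<and> length bs = m}. M)
        (\<lambda>x. \<Sum>bs\<in>{bs. set bs \<subseteq> Basis \<and> length bs = m}.
          (partials bs f x0 / fact m) * (\<Prod>b\<leftarrow>bs. (x - x0) \<bullet> b))"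
    proof (rule bpoly_sum[OF finite_basis_lists], rule bpoly_monomial)
      fix bs :: "'a list" assume bs: "bs \<in> {bs. set bs \<subseteq> Basis \<and> length bs = m}"
      have "\<bar>partials bs f x0 / fact m\<bar> \<le> \<bar>partials bs f x0\<bar> / 1"
        unfolding abs_divide by (intro divide_left_mono) (auto simp: fact_ge_1)
      also have "\<dots> \<le> M"
        using M[of bs x0] bs that ball(2) by simp
      finally show "\<bar>partials bs f x0 / fact m\<bar> \<le> M" .
    qed (use that in auto)
    then show ?thesis
      by (simp add: taylor_term_def sum_divide_distrib card_lists_length_eq mult.commute)
  qed
  then show "bpoly x0 k (\<Sum>m<Suc k. real (DIM('a)) ^ m * M) P"
    unfolding P_def by (intro bpoly_sum) auto
qed

section \<open>Level sets\<close>

text \<open>The explicit smallness requirements on \<open>h\<close> are put into this form, so that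
  sufficiently small becomes a finite conjunction of events.\<close>

lemma eventually_at_right_mult_le:
  assumes "a > 0"
  shows "\<forall>\<^sub>F h in at_right (0::real). c * h \<le> a"
proof -
  have "((\<lambda>h. c * h) \<longlongrightarrow> c * 0) (at_right (0::real))"
    by (intro tendsto_intros)
  then have "\<forall>\<^sub>F h in at_right (0::real). c * h < a"
    using assms by (intro order_tendstoD(2)[of "\<lambda>h. c * h" 0]) auto
  then show ?thesis
    by (rule eventually_mono) simp
qed

lemma poly_deg_le_scaleR_const:
  assumes "poly_deg_le k p"
  shows "poly_deg_le k (\<lambda>x. p x *\<^sub>R w)"
proof -
  from assms obtain c where
    "\<And>x. p x = (\<Sum>\<alpha>\<in>multi_indices k. (\<Prod>b\<in>Basis. (x \<bullet> b) ^ \<alpha> b) *\<^sub>R c \<alpha>)"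
    unfolding poly_deg_le_def by auto
  then show ?thesis
    unfolding poly_deg_le_def
    by (intro exI[of _ "\<lambda>\<alpha>. c \<alpha> *\<^sub>R w"]) (simp add: scaleR_sum_left)
qed

lemma norm_le_sum_Basis:
  fixes x :: "'a::euclidean_space"
  assumes "\<And>b. b \<in> Basis \<Longrightarrow> \<bar>x \<bullet> b\<bar> \<le> a"
  shows "norm x \<le> real DIM('a) * a"
proof -
  have "norm x \<le> (\<Sum>b\<in>Basis. \<bar>x \<bullet> b\<bar>)"
    by (rule norm_le_l1)
  also have "\<dots> \<le> (\<Sum>b\<in>(Basis :: 'a set). a)"
    using assms by (rule sum_mono)
  finally show ?thesis
    by simp
qed

text \<open>\<open>U\<close> is not assumed convex, so estimates along segments are made on convex
  subsets of it, mostly balls.\<close>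

locale level_set =
  fixes \<phi> :: "'a::euclidean_space \<Rightarrow> real" and U :: "'a set" and k :: nat and c1 c2 cH :: real
  assumes smooth: "Cm_on (k + 2) \<phi> U" and k: "k \<ge> 1" and open_U: "open U"
    and c1: "c1 > 0" and c2: "c2 > 0" and cH: "cH \<ge> 0"
    and grad_lower: "\<And>x. x \<in> U \<Longrightarrow> c1 \<le> norm (gradient \<phi> x)"
    and grad_upper: "\<And>x. x \<in> U \<Longrightarrow> norm (gradient \<phi> x) \<le> c2"
    and hess: "\<And>x. x \<in> U \<Longrightarrow> onorm (frechet_derivative (gradient \<phi>) (at x)) \<le> cH"
begin

lemma phi_gderiv: "x \<in> U \<Longrightarrow> GDERIV \<phi> x :> gradient \<phi> x"
  using Cm_on_gderiv(1)[OF smooth open_U] by simp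

lemma phi_continuous_on: "S \<subseteq> U \<Longrightarrow> continuous_on S \<phi>"
  using phi_gderiv unfolding gderiv_def
  by (meson continuous_at_imp_continuous_on has_derivative_continuous subsetD)

lemma grad_lipschitz:
  "convex S \<Longrightarrow> S \<subseteq> U \<Longrightarrow> x \<in> S \<Longrightarrow> y \<in> S \<Longrightarrow>
    norm (gradient \<phi> x - gradient \<phi> y) \<le> cH * norm (x - y)"
  by (rule gradient_lipschitz[OF smooth open_U _ hess]) auto

lemma expansion:
  "convex S \<Longrightarrow> S \<subseteq> U \<Longrightarrow> x0 \<in> S \<Longrightarrow> y \<in> S \<Longrightarrow> dist x0 y \<le> s \<Longrightarrow> y' \<in> S \<Longrightarrow> dist x0 y' \<le> s \<Longrightarrow>
    \<bar>\<phi> y' - \<phi> y - gradient \<phi> x0 \<bullet> (y' - y)\<bar> \<le> cH * s * norm (y' - y)"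
  by (rule first_order_expansion[OF smooth open_U _ hess]) auto

lemma phi_lipschitz:
  assumes S: "convex S" "S \<subseteq> U" "x \<in> S" "y \<in> S"
  shows "\<bar>\<phi> x - \<phi> y\<bar> \<le> c2 * norm (x - y)"
proof -
  have "norm (\<phi> x - \<phi> y) \<le> c2 * norm (x - y)"
  proof (rule differentiable_bound[OF S(1) _ _ S(3,4)])
    fix x assume "x \<in> S"
    then have x: "x \<in> U"
      using S by auto
    show "(\<phi> has_derivative (\<lambda>w. w \<bullet> gradient \<phi> x)) (at x within S)"
      using phi_gderiv[OF x] unfolding gderiv_def by (rule has_derivative_at_withinI)
    have "norm (w \<bullet> gradient \<phi> x) \<le> c2 * norm w" for w
    proof -
      have "norm (w \<bullet> gradient \<phi> x) \<le> norm w * norm (gradient \<phi> x)"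
        using Cauchy_Schwarz_ineq2[of w "gradient \<phi> x"] by simp
      also have "\<dots> \<le> norm w * c2"
        using grad_upper[OF x] by (intro mult_left_mono) auto
      finally show ?thesis
        by (simp add: mult_ac)
    qed
    then show "onorm (\<lambda>w. w \<bullet> gradient \<phi> x) \<le> c2"
      by (rule onorm_le)
  qed
  then show ?thesis
    by simp
qed

text \<open>A move by \<open>s\<close> along plus or minus the unit gradient brackets the value 0.
  This turns smallness of \<phi> into a distance to its zero set.\<close>

lemma zero_near:
  assumes ball: "cball x \<delta> \<subseteq> U" and small: "\<bar>\<phi> x\<bar> \<le> \<epsilon>" "2 * \<epsilon> \<le> c1 * \<delta>" "2 * cH * \<delta> \<le> c1"
  shows "\<exists>z\<in>cball x (2 * \<epsilon> / c1). \<phi> z = 0"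
proof -
  \<comment> \<open>With \<open>c1 * s = 2 * \<epsilon>\<close> the first-order change along
    \<open>v\<close> pays for both \<open>\<bar>\<phi> x\<bar> \<le> \<epsilon>\<close> and the
    second-order error, which is at most \<open>\<epsilon>\<close> as well.\<close>
  define s where "s = 2 * \<epsilon> / c1"
  have s: "0 \<le> s" "s \<le> \<delta>" "c1 * s = 2 * \<epsilon>"
    using small c1 by (auto simp: s_def field_simps)
  have sub: "cball x s \<subseteq> U"
    using ball s(2) by (meson order_trans subset_cball)
  then have xU: "x \<in> U"
    using s(1) by auto
  define g where "g = gradient \<phi> x"
  have g: "c1 \<le> norm g" "norm g > 0"
    using grad_lower[OF xU] c1 by (auto simp: g_def)
  define v where "v = g /\<^sub>R norm g"
  have v: "norm v = 1" "g \<bullet> v = norm g"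
    using g by (auto simp: v_def inner_commute norm_eq_sqrt_inner real_div_sqrt divide_inverse[symmetric] mult.commute)
  have est: "\<bar>\<phi> (x + t *\<^sub>R v) - \<phi> x - t * norm g\<bar> \<le> c1 / 2 * s" if "\<bar>t\<bar> = s" for t
  proof -
    have "\<bar>\<phi> (x + t *\<^sub>R v) - \<phi> x - g \<bullet> ((x + t *\<^sub>R v) - x)\<bar> \<le> cH * s * norm ((x + t *\<^sub>R v) - x)"
      unfolding g_def by (rule expansion[OF convex_cball sub]) (use that s v in \<open>auto simp: dist_norm\<close>)
    also have "cH * s * norm ((x + t *\<^sub>R v) - x) = cH * s * s"
      using that v by simp
    also have "\<dots> \<le> c1 / 2 * s"
    proof (rule mult_right_mono)
      have "cH * s \<le> cH * \<delta>"
        using s cH by (intro mult_left_mono)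
      then show "cH * s \<le> c1 / 2"
        using small(3) by simp
    qed (rule s(1))
    finally show ?thesis
      using v by simp
  qed
  have "c1 * s \<le> norm g * s"
    using g s by (intro mult_right_mono) auto
  then have up: "0 \<le> \<phi> (x + s *\<^sub>R v)" and down: "\<phi> (x + (- s) *\<^sub>R v) \<le> 0"
    using est[of s] est[of "- s"] s small(1) by (auto simp: abs_le_iff mult.commute)
  have inb: "x + t *\<^sub>R v \<in> cball x s" if "- s \<le> t" "t \<le> s" for t
    using that v by (simp add: dist_norm abs_le_iff)
  have "\<exists>t. - s \<le> t \<and> t \<le> s \<and> \<phi> (x + t *\<^sub>R v) = 0"
  proof (rule IVT')
    show "continuous_on {- s..s} (\<lambda>t. \<phi> (x + t *\<^sub>R v))"
      by (rule continuous_on_compose2[OF phi_continuous_on[OF sub]])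
        (use inb in \<open>auto intro!: continuous_intros\<close>)
  qed (use up down s in auto)
  then show ?thesis
    using inb unfolding s_def by blast
qed

text \<open>The error \<open>c1 / 4\<close> is at most a quarter of
  \<open>norm (gradient \<phi> x)\<close>, which produces the factors \<open>5 / 4\<close> and
  \<open>3 / 4\<close>.\<close>

lemma direction_bounds:
  assumes "norm (G - gradient \<phi> x) \<le> c1 / 4" "x \<in> U"
  shows "norm G \<le> 2 * c2" "norm G \<le> 5 / 4 * norm (gradient \<phi> x)"
    "gradient \<phi> x \<bullet> G \<ge> 3 / 4 * (norm (gradient \<phi> x))\<^sup>2"
proof -
  define g where "g = gradient \<phi> x"
  have g: "c1 \<le> norm g" "norm g \<le> c2"
    using assms grad_lower grad_upper by (auto simp: g_def)
  have d: "norm (G - g) \<le> 1 / 4 * norm g"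
    using assms g by (simp add: g_def)
  have "norm G \<le> norm g + norm (G - g)"
    using norm_triangle_sub by blast
  then show "norm G \<le> 2 * c2" "norm G \<le> 5 / 4 * norm (gradient \<phi> x)"
    using d g c2 unfolding g_def by auto
  have "\<bar>g \<bullet> (G - g)\<bar> \<le> norm g * norm (G - g)"
    by (rule Cauchy_Schwarz_ineq2)
  also have "\<dots> \<le> norm g * (1 / 4 * norm g)"
    using d by (intro mult_left_mono) auto
  finally have "\<bar>g \<bullet> (G - g)\<bar> \<le> 1 / 4 * (norm g)\<^sup>2"
    by (simp add: power2_eq_square)
  moreover have "g \<bullet> G = (norm g)\<^sup>2 + g \<bullet> (G - g)"
    by (simp add: inner_diff_right power2_norm_eq_inner)
  ultimately show "gradient \<phi> x \<bullet> G \<ge> 3 / 4 * (norm (gradient \<phi> x))\<^sup>2"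
    unfolding g_def by linarith
qed

lemma line_expansion:
  assumes ball: "cball x s \<subseteq> U" and s: "s \<ge> 0" "4 * cH * s \<le> c1"
    and G: "norm (G - gradient \<phi> x) \<le> c1 / 4"
    and d: "\<bar>d\<bar> * (2 * c2) \<le> s" "\<bar>e\<bar> * (2 * c2) \<le> s"
  shows "\<bar>\<phi> (x + d *\<^sub>R G) - \<phi> (x + e *\<^sub>R G) - (d - e) * (gradient \<phi> x \<bullet> G)\<bar>
    \<le> 5 / 16 * (norm (gradient \<phi> x))\<^sup>2 * \<bar>d - e\<bar>"
proof -
  define g where "g = gradient \<phi> x"
  have xU: "x \<in> U"
    using ball s by auto
  note G' = direction_bounds[OF G xU]
  have dG: "\<bar>t\<bar> * norm G \<le> s" if "\<bar>t\<bar> * (2 * c2) \<le> s" for t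
    using mult_left_mono[OF G'(1), of "\<bar>t\<bar>"] that by simp
  have "\<bar>\<phi> (x + d *\<^sub>R G) - \<phi> (x + e *\<^sub>R G) - g \<bullet> ((x + d *\<^sub>R G) - (x + e *\<^sub>R G))\<bar>
      \<le> cH * s * norm ((x + d *\<^sub>R G) - (x + e *\<^sub>R G))"
    unfolding g_def
    by (rule expansion[OF convex_cball ball]) (use dG[OF d(1)] dG[OF d(2)] s in \<open>auto simp: dist_norm\<close>)
  also have "(x + d *\<^sub>R G) - (x + e *\<^sub>R G) = (d - e) *\<^sub>R G"
    by (simp add: scaleR_diff_left)
  \<comment> \<open>\<open>5 / 16\<close> is the product of \<open>1 / 4\<close>, from
    \<open>4 * cH * s \<le> c1\<close>, and of \<open>5 / 4\<close>, from the bound on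
    \<open>norm G\<close>.\<close>
  also have "cH * s * norm ((d - e) *\<^sub>R G) \<le> (1 / 4 * norm g) * ((5 / 4 * norm g) * \<bar>d - e\<bar>)"
  proof (rule mult_mono)
    show "cH * s \<le> 1 / 4 * norm g"
      using s(2) grad_lower[OF xU] by (simp add: g_def)
    show "norm ((d - e) *\<^sub>R G) \<le> (5 / 4 * norm g) * \<bar>d - e\<bar>"
      using mult_left_mono[OF G'(2), of "\<bar>d - e\<bar>"] by (simp add: g_def mult_ac)
  qed auto
  finally show ?thesis
    by (simp add: g_def power2_eq_square mult_ac)
qed

text \<open>The slope \<open>3 / 4\<close> beats the error \<open>5 / 16\<close> and leaves
  \<open>7 / 16\<close>, more than \<open>1 / 4\<close>, of the squared gradient norm: a
  quantitative strict monotonicity of \<phi> along \<open>G\<close>.\<close>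

lemma line_injective:
  assumes ball: "cball x s \<subseteq> U" and s: "s \<ge> 0" "4 * cH * s \<le> c1"
    and G: "norm (G - gradient \<phi> x) \<le> c1 / 4"
    and d: "\<bar>d\<bar> * (2 * c2) \<le> s" "\<bar>e\<bar> * (2 * c2) \<le> s"
  shows "\<bar>d - e\<bar> \<le> 4 / c1\<^sup>2 * \<bar>\<phi> (x + d *\<^sub>R G) - \<phi> (x + e *\<^sub>R G)\<bar>"
proof -
  define g where "g = gradient \<phi> x"
  have xU: "x \<in> U"
    using ball s by auto
  have "3 / 4 * (norm g)\<^sup>2 * \<bar>d - e\<bar> \<le> (g \<bullet> G) * \<bar>d - e\<bar>"
    using direction_bounds(3)[OF G xU] by (intro mult_right_mono) (auto simp: g_def)
  also have "\<dots> \<le> \<bar>(d - e) * (g \<bullet> G)\<bar>"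
    using mult_right_mono[OF abs_ge_self[of "g \<bullet> G"], of "\<bar>d - e\<bar>"]
    by (simp add: abs_mult mult.commute)
  finally have "3 / 4 * (norm g)\<^sup>2 * \<bar>d - e\<bar>
      \<le> \<bar>\<phi> (x + d *\<^sub>R G) - \<phi> (x + e *\<^sub>R G)\<bar> + 5 / 16 * (norm g)\<^sup>2 * \<bar>d - e\<bar>"
    using line_expansion[OF assms] unfolding g_def by linarith
  then have 1: "3 / 4 * ((norm g)\<^sup>2 * \<bar>d - e\<bar>)
      \<le> \<bar>\<phi> (x + d *\<^sub>R G) - \<phi> (x + e *\<^sub>R G)\<bar> + 5 / 16 * ((norm g)\<^sup>2 * \<bar>d - e\<bar>)"
    by (simp only: mult.assoc)
  have 2: "c1\<^sup>2 * \<bar>d - e\<bar> \<le> (norm g)\<^sup>2 * \<bar>d - e\<bar>"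
    using grad_lower[OF xU] c1 by (intro mult_right_mono power_mono) (auto simp: g_def)
  have "z \<le> 4 * t" if "3 / 4 * y \<le> t + 5 / 16 * y" "z \<le> y" "0 \<le> t" for y z t :: real
    using that by linarith
  from this[OF 1 2] have "c1\<^sup>2 * \<bar>d - e\<bar> \<le> 4 * \<bar>\<phi> (x + d *\<^sub>R G) - \<phi> (x + e *\<^sub>R G)\<bar>"
    by simp
  then show ?thesis
    using c1 by (simp add: field_simps)
qed

text \<open>\<open>4 / c1\<^sup>2\<close> from \<open>line_injective\<close> times the bound
  \<open>2 * c2\<close> on \<open>norm G\<close>; the factor \<open>1 + c2\<close> absorbs the level
  errors \<open>\<epsilon>\<close> and \<open>c2 * (D * \<eta>)\<close>, and the final 1 the
  displacement caused by the change of direction.\<close>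

definition comparison_const :: real where
  "comparison_const = 8 * c2 / c1\<^sup>2 * (1 + c2) + 1"

lemma comparison_const_pos: "comparison_const > 0"
  using c1 c2 by (simp add: comparison_const_def add_nonneg_pos)

text \<open>The intermediate point with step \<open>e\<close> along \<open>G\<close> is within
  \<open>D * \<eta>\<close> of the second point, and its distance to the first is controlled by
  injectivity along their common line.\<close>

lemma compare_points:
  assumes ball: "cball x s \<subseteq> U" and s: "s \<ge> 0" "4 * cH * s \<le> c1"
    and G: "norm (G - gradient \<phi> x) \<le> \<eta>" "\<eta> \<le> c1 / 4"
    and d: "\<bar>d\<bar> \<le> D" "\<bar>e\<bar> \<le> D" "D * (2 * c2) \<le> s"
    and close: "\<bar>\<phi> (x + d *\<^sub>R G) - \<phi> (x + e *\<^sub>R gradient \<phi> x)\<bar> \<le> \<epsilon>"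
  shows "norm ((x + d *\<^sub>R G) - (x + e *\<^sub>R gradient \<phi> x)) \<le> comparison_const * (\<epsilon> + D * \<eta>)"
proof -
  define g where "g = gradient \<phi> x"
  have xU: "x \<in> U"
    using ball s by auto
  have G1: "norm (G - gradient \<phi> x) \<le> c1 / 4"
    using G by simp
  note Gb = direction_bounds[OF G1 xU]
  have D0: "D \<ge> 0"
    using d by simp
  have \<eta>0: "\<eta> \<ge> 0"
    using G(1) norm_ge_zero order_trans by blast
  have \<epsilon>0: "\<epsilon> \<ge> 0"
    using close abs_ge_zero order_trans by blast
  have ds: "\<bar>t\<bar> * (2 * c2) \<le> s" if "\<bar>t\<bar> \<le> D" for t
  proof -
    have "\<bar>t\<bar> * (2 * c2) \<le> D * (2 * c2)"
      using that c2 by (intro mult_right_mono) auto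
    then show ?thesis
      using d(3) by simp
  qed
  have eG: "norm (e *\<^sub>R G - e *\<^sub>R g) \<le> D * \<eta>"
    unfolding scaleR_diff_right[symmetric] norm_scaleR
    using d(2) G(1) D0 by (intro mult_mono) (auto simp: g_def)
  have in1: "x + e *\<^sub>R v \<in> cball x s" if "norm v \<le> 2 * c2" for v
    using mult_left_mono[OF that, of "\<bar>e\<bar>"] ds[OF d(2)] by (simp add: dist_norm)
  have "\<bar>\<phi> (x + e *\<^sub>R G) - \<phi> (x + e *\<^sub>R g)\<bar> \<le> c2 * norm ((x + e *\<^sub>R G) - (x + e *\<^sub>R g))"
    using in1[OF Gb(1)] in1[of g] grad_upper[OF xU] c2
    by (intro phi_lipschitz[OF convex_cball ball]) (auto simp: g_def)
  also have "\<dots> \<le> c2 * (D * \<eta>)"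
    using eG c2 by (intro mult_left_mono) auto
  finally have "\<bar>\<phi> (x + d *\<^sub>R G) - \<phi> (x + e *\<^sub>R G)\<bar> \<le> \<epsilon> + c2 * (D * \<eta>)"
    using close unfolding g_def by linarith
  then have "4 / c1\<^sup>2 * \<bar>\<phi> (x + d *\<^sub>R G) - \<phi> (x + e *\<^sub>R G)\<bar> \<le> 4 / c1\<^sup>2 * (\<epsilon> + c2 * (D * \<eta>))"
    using c1 by (intro mult_left_mono) auto
  with line_injective[OF ball s G1 ds[OF d(1)] ds[OF d(2)]]
  have de: "\<bar>d - e\<bar> \<le> 4 / c1\<^sup>2 * (\<epsilon> + c2 * (D * \<eta>))"
    by simp
  have "norm ((x + d *\<^sub>R G) - (x + e *\<^sub>R g)) = norm ((d - e) *\<^sub>R G + (e *\<^sub>R G - e *\<^sub>R g))"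
    by (simp add: algebra_simps)
  also have "\<dots> \<le> \<bar>d - e\<bar> * norm G + norm (e *\<^sub>R G - e *\<^sub>R g)"
    using norm_triangle_ineq[of "(d - e) *\<^sub>R G" "e *\<^sub>R G - e *\<^sub>R g"] by simp
  also have "\<dots> \<le> (4 / c1\<^sup>2 * (\<epsilon> + c2 * (D * \<eta>))) * (2 * c2) + D * \<eta>"
    using de Gb(1) eG by (intro add_mono mult_mono) auto
  also have "\<dots> \<le> comparison_const * (\<epsilon> + D * \<eta>)"
  proof -
    define w where "w = 8 * c2 / c1\<^sup>2"
    have w: "w \<ge> 0"
      using c1 c2 by (simp add: w_def)
    have "(4 / c1\<^sup>2 * (\<epsilon> + c2 * (D * \<eta>))) * (2 * c2) + D * \<eta> = w * \<epsilon> + w * c2 * (D * \<eta>) + D * \<eta>"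
      by (simp add: w_def add_divide_distrib algebra_simps)
    moreover have "comparison_const * (\<epsilon> + D * \<eta>)
        = w * \<epsilon> + w * c2 * (D * \<eta>) + D * \<eta> + (w * c2 * \<epsilon> + \<epsilon> + w * (D * \<eta>))"
    proof -
      have "comparison_const = w * (1 + c2) + 1"
        by (simp add: comparison_const_def w_def)
      then show ?thesis
        by (simp add: algebra_simps)
    qed
    moreover have "w * c2 * \<epsilon> + \<epsilon> + w * (D * \<eta>) \<ge> 0"
      using w \<epsilon>0 D0 \<eta>0 c2 by (intro add_nonneg_nonneg mult_nonneg_nonneg) auto
    ultimately show ?thesis
      by linarith
  qed
  finally show ?thesis
    unfolding g_def .
qed

end

section \<open>A polynomial approximation of the exact mapping\<close>

text \<open>\<open>A\<close> stands for a neighbourhood of the zero set that contains all cut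
  elements; the fixed \<open>r\<close> and \<open>M\<close> make every constant independent of the
  base point.\<close>

locale level_set_nbhd = level_set \<phi> U k c1 c2 cH
  for \<phi> :: "'a::euclidean_space \<Rightarrow> real" and U k c1 c2 cH +
  fixes A :: "'a set" and r M :: real
  assumes r: "r > 0" and M: "M \<ge> 0" and A: "\<And>x0. x0 \<in> A \<Longrightarrow> cball x0 r \<subseteq> U"
    and partials_bound: "\<And>x0 y bs. x0 \<in> A \<Longrightarrow> y \<in> cball x0 r \<Longrightarrow> set bs \<subseteq> Basis \<Longrightarrow>
      length bs \<le> k + 2 \<Longrightarrow> \<bar>partials bs \<phi> y\<bar> \<le> M"
begin

lemma A_subset: "x0 \<in> A \<Longrightarrow> x0 \<in> U"
  using A r by fastforce

text \<open>\<open>g\<close> is expanded from the partial derivatives of \<phi> themselves; the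
  gradient of \<open>P\<close> would be accurate to one order less.\<close>

definition taylor_data :: "real \<Rightarrow> real \<Rightarrow> 'a \<Rightarrow> ('a \<Rightarrow> real) \<Rightarrow> ('a \<Rightarrow> 'a) \<Rightarrow> bool" where
  "taylor_data CP CT x0 P g \<longleftrightarrow> bpoly x0 k CP P \<and> (\<forall>b\<in>Basis. bpoly x0 k CP (\<lambda>x. g x \<bullet> b)) \<and>
     (\<forall>x\<in>cball x0 r. \<bar>\<phi> x - P x\<bar> \<le> CT * dist x0 x ^ Suc k
       \<and> norm (g x - gradient \<phi> x) \<le> CT * dist x0 x ^ Suc k)"

lemma taylor_data_exists: "\<exists>CP\<ge>0. \<exists>CT\<ge>0. \<forall>x0\<in>A. \<exists>P g. taylor_data CP CT x0 P g"
proof -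
  define CP where "CP = (\<Sum>m<Suc k. real (DIM('a)) ^ m * M)"
  define CT where "CT = real (DIM('a)) ^ Suc k * M"
  have CP: "CP \<ge> 0" and CT: "CT \<ge> 0"
    using M by (auto simp: CP_def CT_def simp del: sum.lessThan_Suc intro!: sum_nonneg)
  \<comment> \<open>The factor \<open>DIM('a)\<close> arises when the coordinate errors of
    \<open>g\<close> are summed; \<open>P\<close> is given the same constant.\<close>
  have CT': "CT \<le> real DIM('a) * CT"
    using CT by (simp add: mult_le_cancel_right1 DIM_positive Suc_leI)
  show ?thesis
  proof (rule exI[of _ CP], intro conjI CP, rule exI[of _ "real DIM('a) * CT"], intro conjI ballI)
    show "0 \<le> real DIM('a) * CT"
      using CT by simp
    fix x0 assume x0: "x0 \<in> A"
    have "\<exists>P. bpoly x0 k CP P \<and> (\<forall>x\<in>cball x0 r. \<bar>\<phi> x - P x\<bar> \<le> CT * dist x0 x ^ Suc k)"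
    proof (rule taylor_bpoly[OF Cm_on_mono[OF smooth] open_U A[OF x0]])
      show "\<bar>partials bs \<phi> y\<bar> \<le> M" if "set bs \<subseteq> Basis" "length bs \<le> Suc k" "y \<in> cball x0 r" for bs y
        using partials_bound[OF x0] that by simp
    qed (use r in \<open>auto simp: CP_def CT_def\<close>)
    then obtain P where P: "bpoly x0 k CP P" "\<And>x. x \<in> cball x0 r \<Longrightarrow> \<bar>\<phi> x - P x\<bar> \<le> CT * dist x0 x ^ Suc k"
      by blast
    have "\<forall>b\<in>Basis. \<exists>Q. bpoly x0 k CP Q
        \<and> (\<forall>x\<in>cball x0 r. \<bar>partials [b] \<phi> x - Q x\<bar> \<le> CT * dist x0 x ^ Suc k)"
    proof
      fix b :: 'a assume b: "b \<in> Basis"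
      \<comment> \<open>Expanding a first partial derivative to degree \<open>k\<close> uses
        derivatives of \<phi> up to order \<open>k + 2\<close>.\<close>
      have "Cm_on (Suc k) (partials [b] \<phi>) U"
        using smooth b by (intro Cm_on_partials) auto
      then show "\<exists>Q. bpoly x0 k CP Q \<and> (\<forall>x\<in>cball x0 r. \<bar>partials [b] \<phi> x - Q x\<bar> \<le> CT * dist x0 x ^ Suc k)"
      proof (rule taylor_bpoly[OF _ open_U A[OF x0]])
        show "\<bar>partials bs (partials [b] \<phi>) y\<bar> \<le> M"
          if "set bs \<subseteq> Basis" "length bs \<le> Suc k" "y \<in> cball x0 r" for bs y
          using partials_bound[OF x0, of y "b # bs"] that b by simp
      qed (use r in \<open>auto simp: CP_def CT_def\<close>)
    qed
    then obtain Q where Q: "\<And>b. b \<in> Basis \<Longrightarrow> bpoly x0 k CP (Q b)"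
      "\<And>b x. b \<in> Basis \<Longrightarrow> x \<in> cball x0 r \<Longrightarrow> \<bar>partials [b] \<phi> x - Q b x\<bar> \<le> CT * dist x0 x ^ Suc k"
      unfolding bchoice_iff by blast
    define g where "g x = (\<Sum>b\<in>Basis. Q b x *\<^sub>R b)" for x
    have gb: "g x \<bullet> b = Q b x" if "b \<in> Basis" for x b
      using that by (simp add: g_def inner_sum_left_Basis)
    have "taylor_data CP (real DIM('a) * CT) x0 P g"
      unfolding taylor_data_def
    proof (intro conjI ballI)
      show "bpoly x0 k CP (\<lambda>x. g x \<bullet> b)" if "b \<in> Basis" for b
        using Q(1)[OF that] gb[OF that] by simp
      fix x assume x: "x \<in> cball x0 r"
      have "CT * dist x0 x ^ Suc k \<le> real DIM('a) * CT * dist x0 x ^ Suc k"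
        using CT' by (intro mult_right_mono) auto
      then show "\<bar>\<phi> x - P x\<bar> \<le> real DIM('a) * CT * dist x0 x ^ Suc k"
        using P(2)[OF x] by linarith
      have xU: "x \<in> U"
        using A[OF x0] x by blast
      have "norm (g x - gradient \<phi> x) \<le> real DIM('a) * (CT * dist x0 x ^ Suc k)"
      proof (rule norm_le_sum_Basis)
        fix b :: 'a assume b: "b \<in> Basis"
        have "gradient \<phi> x \<bullet> b = partials [b] \<phi> x"
          using Cm_on_gderiv(2)[OF smooth open_U _ xU b] by simp
        then show "\<bar>(g x - gradient \<phi> x) \<bullet> b\<bar> \<le> CT * dist x0 x ^ Suc k"
          using Q(2)[OF b x] gb[OF b, of x] by (simp only: inner_diff_left abs_minus_commute)
      qed
      then show "norm (g x - gradient \<phi> x) \<le> real DIM('a) * CT * dist x0 x ^ Suc k"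
        by (simp only: mult.assoc)
    qed (rule P(1))
    then show "\<exists>P g. taylor_data CP (real DIM('a) * CT) x0 P g"
      by blast
  qed
qed

text \<open>One step of the simplified Newton iteration for \<open>\<phi> (x + d *\<^sub>R g) = l\<close>, with the derivative
  frozen at \<open>x0\<close>, so that the iterates stay polynomial in \<open>x\<close>. It gains one power of \<open>h\<close>.\<close>

lemma newton_step_estimate:
  assumes x0: "x0 \<in> A" and h: "0 < h" "(R + 1) * h \<le> r" "R \<ge> 0"
    and x: "x \<in> cball x0 (R * h)"
    and P: "\<And>y. y \<in> cball x0 r \<Longrightarrow> \<bar>\<phi> y - P y\<bar> \<le> CT * dist x0 y ^ Suc k" "CT \<ge> 0"
    and g: "norm (g - gradient \<phi> x0) \<le> Cg * h" "Cg * h \<le> c2"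
    and d: "\<bar>d\<bar> * (2 * c2) \<le> h" "\<bar>\<phi> (x + d *\<^sub>R g) - l\<bar> \<le> E"
    and d': "d' = d - (P (x + d *\<^sub>R g) - l) / (norm (gradient \<phi> x0))\<^sup>2" "\<bar>d'\<bar> * (2 * c2) \<le> h"
    and W: "(E + CT * ((R + 1) * h) ^ Suc k) / c1\<^sup>2 \<le> W"
  shows "\<bar>\<phi> (x + d' *\<^sub>R g) - l\<bar> \<le> CT * ((R + 1) * h) ^ Suc k + W * ((c2 * Cg + cH * (R + 1) * (2 * c2)) * h)"
proof -
  define g0 where "g0 = gradient \<phi> x0"
  define y where "y = x + d *\<^sub>R g"
  define y' where "y' = x + d' *\<^sub>R g"
  define eP where "eP = P y - l"
  have x0U: "x0 \<in> U"
    using x0 by (rule A_subset)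
  have g0: "c1 \<le> norm g0" "norm g0 \<le> c2"
    using grad_lower[OF x0U] grad_upper[OF x0U] by (auto simp: g0_def)
  then have g0pos: "norm g0 > 0"
    using c1 by linarith
  have gn: "norm g \<le> 2 * c2"
    using norm_triangle_sub[of g g0] g g0 by (simp add: g0_def)
  have inb: "x + t *\<^sub>R g \<in> cball x0 ((R + 1) * h)" if "\<bar>t\<bar> * (2 * c2) \<le> h" for t
  proof -
    have "norm (t *\<^sub>R g) \<le> \<bar>t\<bar> * (2 * c2)"
      using gn by (simp add: mult_left_mono)
    moreover have "norm (x - x0) \<le> R * h"
      using x by (simp add: dist_norm norm_minus_commute)
    moreover have "norm ((x - x0) + t *\<^sub>R g) \<le> norm (x - x0) + norm (t *\<^sub>R g)"
      by (rule norm_triangle_ineq)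
    ultimately have "norm ((x + t *\<^sub>R g) - x0) \<le> R * h + h"
      using that by (simp add: algebra_simps)
    then show ?thesis
      by (simp add: dist_norm norm_minus_commute algebra_simps)
  qed
  note yb = inb[OF d(1), folded y_def] and y'b = inb[OF d'(2), folded y'_def]
  have sub: "cball x0 ((R + 1) * h) \<subseteq> U"
    using A[OF x0] h(2) by (meson order_trans subset_cball)
  have Py: "\<bar>\<phi> y - P y\<bar> \<le> CT * ((R + 1) * h) ^ Suc k"
  proof -
    have "\<bar>\<phi> y - P y\<bar> \<le> CT * dist x0 y ^ Suc k"
      using yb h(2) by (intro P) auto
    also have "\<dots> \<le> CT * ((R + 1) * h) ^ Suc k"
      using yb P(2) by (intro mult_left_mono power_mono) auto
    finally show ?thesis .
  qed
  have dd: "d' - d = - (eP / (norm g0)\<^sup>2)"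
    unfolding d'(1) eP_def y_def g0_def by simp
  have eP_le: "\<bar>eP\<bar> \<le> E + CT * ((R + 1) * h) ^ Suc k"
    using Py d(2) unfolding eP_def y_def by linarith
  have "\<bar>d' - d\<bar> = \<bar>eP\<bar> / (norm g0)\<^sup>2"
    by (simp add: dd)
  also have "\<dots> \<le> (E + CT * ((R + 1) * h) ^ Suc k) / c1\<^sup>2"
    using eP_le g0 c1 by (intro frac_le power_mono) auto
  finally have dW: "\<bar>d' - d\<bar> \<le> W"
    using W by simp
  have yy: "y' - y = (d' - d) *\<^sub>R g"
    by (simp add: y_def y'_def algebra_simps)
  have nyy: "norm (y' - y) \<le> W * (2 * c2)"
    unfolding yy norm_scaleR using dW gn by (intro mult_mono) auto
  have "\<bar>\<phi> y' - \<phi> y - g0 \<bullet> (y' - y)\<bar> \<le> cH * ((R + 1) * h) * norm (y' - y)"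
    unfolding g0_def by (rule expansion[OF convex_cball sub]) (use yb y'b h in auto)
  also have "\<dots> \<le> cH * ((R + 1) * h) * (W * (2 * c2))"
    using nyy cH h by (intro mult_left_mono) auto
  finally have 1: "\<bar>\<phi> y' - \<phi> y - g0 \<bullet> (y' - y)\<bar> \<le> cH * ((R + 1) * h) * (W * (2 * c2))" .
  have "g0 \<bullet> (y' - y) = (d' - d) * (g0 \<bullet> g)"
    by (simp add: yy)
  also have "g0 \<bullet> g = (norm g0)\<^sup>2 + g0 \<bullet> (g - g0)"
    by (simp add: inner_diff_right power2_norm_eq_inner)
  also have "(d' - d) * ((norm g0)\<^sup>2 + g0 \<bullet> (g - g0)) = - eP + (d' - d) * (g0 \<bullet> (g - g0))"
    unfolding dd using g0pos by (simp add: field_simps)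
  finally have 2: "g0 \<bullet> (y' - y) = - eP + (d' - d) * (g0 \<bullet> (g - g0))" .
  have "\<bar>g0 \<bullet> (g - g0)\<bar> \<le> norm g0 * norm (g - g0)"
    by (rule Cauchy_Schwarz_ineq2)
  also have "\<dots> \<le> c2 * (Cg * h)"
    using g0 g c2 by (intro mult_mono) (auto simp: g0_def)
  finally have "\<bar>(d' - d) * (g0 \<bullet> (g - g0))\<bar> \<le> W * (c2 * (Cg * h))"
    unfolding abs_mult using dW by (intro mult_mono) auto
  moreover have "\<phi> y' - l = (\<phi> y' - \<phi> y - g0 \<bullet> (y' - y)) + (d' - d) * (g0 \<bullet> (g - g0)) + (\<phi> y - P y)"
    unfolding 2 eP_def by simp
  ultimately have "\<bar>\<phi> y' - l\<bar> \<le> cH * ((R + 1) * h) * (W * (2 * c2)) + W * (c2 * (Cg * h))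
      + CT * ((R + 1) * h) ^ Suc k"
    using 1 Py by linarith
  then show ?thesis
    unfolding y'_def by (simp add: algebra_simps)
qed

text \<open>\<open>l\<close> stands for the linear interpolant on an element \<open>S\<close>. This
  is all that the Newton iteration has to know about the mesh, hence its constants are
  uniform.\<close>

definition admissible :: "real \<Rightarrow> real \<Rightarrow> real \<Rightarrow> real \<Rightarrow> 'a \<Rightarrow> ('a \<Rightarrow> real) \<Rightarrow> 'a set \<Rightarrow> bool" where
  "admissible R C1 C2 h x0 l S \<longleftrightarrow> x0 \<in> A \<and> bpoly x0 1 C1 l \<and> S \<subseteq> cball x0 (R * h)
     \<and> (\<forall>x\<in>S. \<bar>l x - \<phi> x\<bar> \<le> C2 * h\<^sup>2)"

text \<open>Step 0 leaves the residual \<open>l x - \<phi> x\<close>, hence the exponent 2 for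
  \<open>j = 0\<close>; each step adds one until the Taylor error of order \<open>k + 1\<close>
  dominates. \<open>N\<close> and \<open>C\<close> depend on \<open>j\<close> but not on
  \<open>h\<close> or the element.\<close>

lemma newton_iteration:
  assumes R: "R \<ge> 0" and CP: "CP \<ge> 0" and CT: "CT \<ge> 0" and C: "C1 \<ge> 0" "C2 \<ge> 0"
  shows "\<exists>N C. C \<ge> 0 \<and> (\<forall>\<^sub>F h in at_right 0. \<forall>x0 P g l S.
    taylor_data CP CT x0 P g \<longrightarrow> admissible R C1 C2 h x0 l S \<longrightarrow>
    (\<exists>\<delta>. bpoly x0 N C \<delta> \<and> (\<forall>x\<in>S. \<bar>\<delta> x\<bar> \<le> C * h\<^sup>2 \<and>
      \<bar>\<phi> (x + \<delta> x *\<^sub>R g x) - l x\<bar> \<le> C * h ^ min (j + 2) (k + 1))))"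
proof (induction j)
  case 0
  have "min (0 + 2) (k + 1) = 2"
    using k by simp
  show ?case
  proof (rule exI[of _ 0], rule exI[of _ C2], intro conjI C always_eventually allI impI)
    fix h x0 P g l S assume "admissible R C1 C2 h x0 l S"
    then show "\<exists>\<delta>. bpoly x0 0 C2 \<delta> \<and> (\<forall>x\<in>S. \<bar>\<delta> x\<bar> \<le> C2 * h\<^sup>2 \<and>
      \<bar>\<phi> (x + \<delta> x *\<^sub>R g x) - l x\<bar> \<le> C2 * h ^ min (0 + 2) (k + 1))"
      unfolding \<open>min (0 + 2) (k + 1) = 2\<close> using C
      by (intro exI[of _ "\<lambda>_. 0"]) (auto simp: admissible_def bpoly_const abs_minus_commute)
  qed
next
  case (Suc j)
  then obtain N C where C0: "C \<ge> 0" and ev: "\<forall>\<^sub>F h in at_right 0. \<forall>x0 P g l S.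
    taylor_data CP CT x0 P g \<longrightarrow> admissible R C1 C2 h x0 l S \<longrightarrow>
    (\<exists>\<delta>. bpoly x0 N C \<delta> \<and> (\<forall>x\<in>S. \<bar>\<delta> x\<bar> \<le> C * h\<^sup>2 \<and>
      \<bar>\<phi> (x + \<delta> x *\<^sub>R g x) - l x\<bar> \<le> C * h ^ min (j + 2) (k + 1)))"
    by blast
  define m where "m = min (j + 2) (k + 1)"
  have m: "m \<ge> 2" "m \<le> k + 1" "min (Suc j + 2) (k + 1) \<le> m + 1" "min (Suc j + 2) (k + 1) \<le> k + 1"
    using k by (auto simp: m_def)
  \<comment> \<open>\<open>D\<close> and \<open>Cb\<close> bound coefficients: \<open>D\<close>
    those of \<open>x + \<delta> x *\<^sub>R g x - x0\<close>, \<open>Cb\<close> those of the Newton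
    correction. The correction has size at most \<open>w * h ^ m\<close>, and the new residual is at
    most this times \<open>B * h\<close> plus the Taylor error; \<open>C'\<close> dominates all
    contributions.\<close>
  define D where "D = 1 + C * CP"
  define Cg where "Cg = CT * R ^ Suc k + cH * R"
  define w where "w = (C + CT * (R + 1) ^ Suc k) / c1\<^sup>2"
  define B where "B = c2 * Cg + cH * (R + 1) * (2 * c2)"
  define N' where "N' = N + (k * (N + k + 1) + 1)"
  define Cb where "Cb = 1 / c1\<^sup>2 * (CP * D ^ k + C1)"
  define C' where "C' = C + Cb + w + CT * (R + 1) ^ Suc k + w * B"
  have nonneg: "D \<ge> 1" "Cg \<ge> 0" "w \<ge> 0" "B \<ge> 0" "Cb \<ge> 0"
    using C0 CP CT R cH c2 c1 C
    by (auto simp: D_def Cg_def w_def B_def Cb_def intro!: add_nonneg_nonneg mult_nonneg_nonneg divide_nonneg_nonneg)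
  have C'0: "C + Cb \<le> C'" "C + w \<le> C'" "CT * (R + 1) ^ Suc k + w * B \<le> C'" "C' \<ge> 0"
    using nonneg C0 CT R by (auto simp: C'_def)
  have "\<forall>\<^sub>F h in at_right 0. \<forall>x0 P g l S.
    taylor_data CP CT x0 P g \<longrightarrow> admissible R C1 C2 h x0 l S \<longrightarrow>
    (\<exists>\<delta>. bpoly x0 N' C' \<delta> \<and> (\<forall>x\<in>S. \<bar>\<delta> x\<bar> \<le> C' * h\<^sup>2 \<and>
      \<bar>\<phi> (x + \<delta> x *\<^sub>R g x) - l x\<bar> \<le> C' * h ^ min (Suc j + 2) (k + 1)))"
    using ev eventually_at_right_less[of 0] eventually_at_right_mult_le[of 1 1, simplified]
      eventually_at_right_mult_le[OF r, of "R + 1"] eventually_at_right_mult_le[OF c2, of Cg]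
      eventually_at_right_mult_le[of 1 "C' * (2 * c2)", simplified]
  proof eventually_elim
    case (elim h)
    show ?case
    proof (intro allI impI)
      fix x0 P g l S
      assume td: "taylor_data CP CT x0 P g" and adm: "admissible R C1 C2 h x0 l S"
      then obtain \<delta> where \<delta>: "bpoly x0 N C \<delta>" "\<And>x. x \<in> S \<Longrightarrow> \<bar>\<delta> x\<bar> \<le> C * h\<^sup>2"
        "\<And>x. x \<in> S \<Longrightarrow> \<bar>\<phi> (x + \<delta> x *\<^sub>R g x) - l x\<bar> \<le> C * h ^ m"
        using elim(1) unfolding m_def by blast
      have x0: "x0 \<in> A" and l: "bpoly x0 1 C1 l" and S: "S \<subseteq> cball x0 (R * h)"
        using adm by (auto simp: admissible_def)
      define q where "q = (norm (gradient \<phi> x0))\<^sup>2"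
      have q: "c1\<^sup>2 \<le> q"
        unfolding q_def using grad_lower[OF A_subset[OF x0]] c1 by (intro power_mono) auto
      define \<delta>' where "\<delta>' x = \<delta> x - (P (x + \<delta> x *\<^sub>R g x) - l x) / q" for x
      have bp: "bpoly x0 N' C' \<delta>'"
      proof -
        have "bpoly x0 (N + k + 1) D (\<lambda>x. (x + \<delta> x *\<^sub>R g x - x0) \<bullet> b)" if b: "b \<in> Basis" for b
        proof -
          have "bpoly x0 (N + k + 1) (C * CP) (\<lambda>x. \<delta> x * (g x \<bullet> b))"
            by (rule bpoly_mono[OF bpoly_mult[OF \<delta>(1)]]) (use td b in \<open>auto simp: taylor_data_def\<close>)
          from bpoly_add[OF bpoly_coord[OF b, of "N + k + 1" x0] this] show ?thesis
            by (simp add: D_def inner_add_left inner_diff_left algebra_simps)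
        qed
        then have "bpoly x0 (k * (N + k + 1)) (CP * D ^ k) (\<lambda>x. P (x + \<delta> x *\<^sub>R g x))"
          using td nonneg(1) by (intro bpoly_compose) (auto simp: taylor_data_def)
        then have "bpoly x0 N' (CP * D ^ k + C1) (\<lambda>x. P (x + \<delta> x *\<^sub>R g x) - l x)"
          by (intro bpoly_diff) (auto intro: bpoly_mono l simp: N'_def)
        then have "bpoly x0 N' Cb (\<lambda>x. (1 / q) * (P (x + \<delta> x *\<^sub>R g x) - l x))"
          unfolding Cb_def using q c1
          by (intro bpoly_cmult) (auto intro!: divide_left_mono mult_pos_pos simp: order_less_le_trans[OF _ q])
        then have "bpoly x0 N' (C + Cb) (\<lambda>x. \<delta> x - (1 / q) * (P (x + \<delta> x *\<^sub>R g x) - l x))"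
          by (intro bpoly_diff bpoly_mono[OF \<delta>(1)]) (auto simp: N'_def)
        then show ?thesis
          unfolding \<delta>'_def by (auto intro: bpoly_mono C'0(1))
      qed
      have "\<bar>\<delta>' x\<bar> \<le> C' * h\<^sup>2 \<and> \<bar>\<phi> (x + \<delta>' x *\<^sub>R g x) - l x\<bar> \<le> C' * h ^ min (Suc j + 2) (k + 1)"
        if x: "x \<in> S" for x
      proof -
        have h: "0 < h" "h \<le> 1" "(R + 1) * h \<le> r" "Cg * h \<le> c2" "C' * (2 * c2) * h \<le> 1"
          using elim by auto
        have xb: "x \<in> cball x0 (R * h)"
          using S x by auto
        have xr: "x \<in> cball x0 r"
          using xb h by (auto simp: algebra_simps)
        have pw: "h ^ Suc k \<le> h ^ m"
          using h m by (intro power_decreasing) auto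
        have gx: "norm (g x - gradient \<phi> x0) \<le> Cg * h"
        proof -
          have "norm (g x - gradient \<phi> x) \<le> CT * dist x0 x ^ Suc k"
            using td xr by (auto simp: taylor_data_def)
          also have "\<dots> \<le> CT * (R * h) ^ Suc k"
            using xb CT by (intro mult_left_mono power_mono) auto
          also have "\<dots> = CT * R ^ Suc k * h ^ Suc k"
            by (simp add: power_mult_distrib del: power_Suc)
          also have "\<dots> \<le> CT * R ^ Suc k * h"
            using h CT R power_decreasing[of 1 "Suc k" h] by (intro mult_left_mono) auto
          finally have 1: "norm (g x - gradient \<phi> x) \<le> CT * R ^ Suc k * h" .
          have "norm (gradient \<phi> x - gradient \<phi> x0) \<le> cH * norm (x - x0)"
            using xr r by (intro grad_lipschitz[OF convex_cball A[OF x0]]) auto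
          also have "\<dots> \<le> cH * (R * h)"
            using xb cH by (intro mult_left_mono) (auto simp: dist_norm norm_minus_commute)
          finally show ?thesis
            using 1 norm_triangle_ineq[of "g x - gradient \<phi> x" "gradient \<phi> x - gradient \<phi> x0"]
            by (simp add: Cg_def algebra_simps)
        qed
        have small: "\<bar>t\<bar> * (2 * c2) \<le> h" if "\<bar>t\<bar> \<le> C' * h\<^sup>2" for t
        proof -
          have "\<bar>t\<bar> * (2 * c2) \<le> (C' * h\<^sup>2) * (2 * c2)"
            using that c2 by (intro mult_right_mono) auto
          also have "\<dots> = (C' * (2 * c2) * h) * h"
            by (simp add: power2_eq_square mult_ac)
          also have "\<dots> \<le> 1 * h"
            using h by (intro mult_right_mono) auto
          finally show ?thesis
            by simp
        qed
        have CC: "C * h\<^sup>2 \<le> C' * h\<^sup>2"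
          using C'0 nonneg by (intro mult_right_mono) auto
        have W: "(C * h ^ m + CT * ((R + 1) * h) ^ Suc k) / c1\<^sup>2 \<le> w * h ^ m"
        proof -
          have "CT * ((R + 1) * h) ^ Suc k = CT * (R + 1) ^ Suc k * h ^ Suc k"
            by (simp add: power_mult_distrib del: power_Suc)
          also have "\<dots> \<le> CT * (R + 1) ^ Suc k * h ^ m"
            using CT R pw by (intro mult_left_mono) auto
          finally have "(C * h ^ m + CT * ((R + 1) * h) ^ Suc k) / c1\<^sup>2
              \<le> ((C + CT * (R + 1) ^ Suc k) * h ^ m) / c1\<^sup>2"
            using c1 by (intro divide_right_mono) (auto simp: distrib_right)
          then show ?thesis
            by (simp add: w_def)
        qed
        define W where "W = w * h ^ m"
        have d'0: "\<bar>\<delta>' x - \<delta> x\<bar> \<le> W"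
        proof -
          have "\<bar>\<phi> (x + \<delta> x *\<^sub>R g x) - P (x + \<delta> x *\<^sub>R g x)\<bar> \<le> CT * ((R + 1) * h) ^ Suc k"
          proof -
            have "norm (g x) \<le> 2 * c2"
              using norm_triangle_sub[of "g x" "gradient \<phi> x0"] gx h(4) grad_upper[OF A_subset[OF x0]] by simp
            then have "norm (\<delta> x *\<^sub>R g x) \<le> h"
              using small[of "\<delta> x"] \<delta>(2)[OF x] CC mult_left_mono[of "norm (g x)" "2 * c2" "\<bar>\<delta> x\<bar>"] by simp
            then have in1: "dist x0 (x + \<delta> x *\<^sub>R g x) \<le> (R + 1) * h"
              using xb norm_triangle_ineq4[of "x0 - x" "\<delta> x *\<^sub>R g x"]
              by (simp add: dist_norm algebra_simps)
            then have "\<bar>\<phi> (x + \<delta> x *\<^sub>R g x) - P (x + \<delta> x *\<^sub>R g x)\<bar> \<le> CT * dist x0 (x + \<delta> x *\<^sub>R g x) ^ Suc k"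
              using td h(3) by (auto simp: taylor_data_def)
            also have "\<dots> \<le> CT * ((R + 1) * h) ^ Suc k"
              using in1 CT by (intro mult_left_mono power_mono) auto
            finally show ?thesis .
          qed
          then have "\<bar>P (x + \<delta> x *\<^sub>R g x) - l x\<bar> \<le> C * h ^ m + CT * ((R + 1) * h) ^ Suc k"
            using \<delta>(3)[OF x] by linarith
          then have "\<bar>P (x + \<delta> x *\<^sub>R g x) - l x\<bar> / q \<le> (C * h ^ m + CT * ((R + 1) * h) ^ Suc k) / c1\<^sup>2"
            using q c1 by (intro frac_le) auto
          moreover have "\<bar>\<delta>' x - \<delta> x\<bar> = \<bar>P (x + \<delta> x *\<^sub>R g x) - l x\<bar> / q"
            using q c1 by (simp add: \<delta>'_def abs_divide order_trans[OF zero_le_power2 q])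
          ultimately show ?thesis
            using W unfolding W_def by linarith
        qed
        have "w * h ^ m \<le> w * h\<^sup>2"
          using h m nonneg by (intro mult_left_mono power_decreasing) auto
        then have "\<bar>\<delta>' x\<bar> \<le> (C + w) * h\<^sup>2"
          using d'0 \<delta>(2)[OF x] unfolding W_def by (simp add: distrib_right)
        also have "\<dots> \<le> C' * h\<^sup>2"
          using C'0 by (intro mult_right_mono) auto
        finally have d'1: "\<bar>\<delta>' x\<bar> \<le> C' * h\<^sup>2" .
        have "\<bar>\<phi> (x + \<delta>' x *\<^sub>R g x) - l x\<bar>
            \<le> CT * ((R + 1) * h) ^ Suc k + W * ((c2 * Cg + cH * (R + 1) * (2 * c2)) * h)"
        proof (rule newton_step_estimate[OF x0 h(1,3) R xb _ CT gx h(4)])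
          show "\<bar>\<phi> y - P y\<bar> \<le> CT * dist x0 y ^ Suc k" if "y \<in> cball x0 r" for y
            using td that by (auto simp: taylor_data_def)
          show "\<bar>\<delta> x\<bar> * (2 * c2) \<le> h"
            using \<delta>(2)[OF x] CC by (intro small) linarith
          show "\<bar>\<phi> (x + \<delta> x *\<^sub>R g x) - l x\<bar> \<le> C * h ^ m"
            by (rule \<delta>(3)[OF x])
          show "\<delta>' x = \<delta> x - (P (x + \<delta> x *\<^sub>R g x) - l x) / (norm (gradient \<phi> x0))\<^sup>2"
            by (simp add: \<delta>'_def q_def)
          show "\<bar>\<delta>' x\<bar> * (2 * c2) \<le> h"
            by (rule small[OF d'1])
          show "(C * h ^ m + CT * ((R + 1) * h) ^ Suc k) / c1\<^sup>2 \<le> W"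
            using W by (simp add: W_def)
        qed
        also have "\<dots> = CT * (R + 1) ^ Suc k * h ^ (k + 1) + w * B * h ^ (m + 1)"
          by (simp add: W_def B_def power_mult_distrib mult_ac)
        also have "\<dots> \<le> CT * (R + 1) ^ Suc k * h ^ min (Suc j + 2) (k + 1) + w * B * h ^ min (Suc j + 2) (k + 1)"
          using h m(3,4) nonneg CT R
          by (intro add_mono mult_left_mono power_decreasing) auto
        also have "\<dots> \<le> C' * h ^ min (Suc j + 2) (k + 1)"
          using C'0(3) h by (simp only: distrib_right[symmetric]) (intro mult_right_mono, auto)
        finally show ?thesis
          using d'1 by simp
      qed
      then show "\<exists>\<delta>. bpoly x0 N' C' \<delta> \<and> (\<forall>x\<in>S. \<bar>\<delta> x\<bar> \<le> C' * h\<^sup>2 \<and>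
        \<bar>\<phi> (x + \<delta> x *\<^sub>R g x) - l x\<bar> \<le> C' * h ^ min (Suc j + 2) (k + 1))"
        using bp by blast
    qed
  qed
  then show ?case
    using C'0(4) by blast
qed

text \<open>After \<open>k - 1\<close> Newton steps the exponent has reached \<open>k + 1\<close>.
  Only then are the coordinates of the result cut down to degree \<open>k\<close>, and
  \<open>g\<close> is exchanged for the true gradient; either change costs a multiple of
  \<open>h ^ (k + 1)\<close>.\<close>

lemma approximate_map:
  assumes R: "R \<ge> 0" and C: "C1 \<ge> 0" "C2 \<ge> 0"
  shows "\<exists>C\<ge>0. \<forall>\<^sub>F h in at_right 0. \<forall>x0 l S. admissible R C1 C2 h x0 l S \<longrightarrow>
    (\<exists>Y d. poly_deg_le k Y \<and> (\<forall>x\<in>S. \<bar>d x\<bar> \<le> C * h\<^sup>2 \<and>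
      norm (Y x - (x + d x *\<^sub>R gradient \<phi> x)) \<le> C * h ^ (k + 1) \<and>
      \<bar>\<phi> (x + d x *\<^sub>R gradient \<phi> x) - l x\<bar> \<le> C * h ^ (k + 1)))"
proof -
  obtain CP CT where CP: "CP \<ge> 0" and CT: "CT \<ge> 0" and td: "\<And>x0. x0 \<in> A \<Longrightarrow> \<exists>P g. taylor_data CP CT x0 P g"
    using taylor_data_exists by blast
  have "min (k - 1 + 2) (k + 1) = k + 1"
    using k by simp
  with newton_iteration[OF R CP CT C, of "k - 1"]
  obtain N C0 where C0: "C0 \<ge> 0" and ev: "\<forall>\<^sub>F h in at_right 0. \<forall>x0 P g l S.
    taylor_data CP CT x0 P g \<longrightarrow> admissible R C1 C2 h x0 l S \<longrightarrow>
    (\<exists>\<delta>. bpoly x0 N C0 \<delta> \<and> (\<forall>x\<in>S. \<bar>\<delta> x\<bar> \<le> C0 * h\<^sup>2 \<and>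
      \<bar>\<phi> (x + \<delta> x *\<^sub>R g x) - l x\<bar> \<le> C0 * h ^ (k + 1)))"
    by auto
  define D where "D = 1 + C0 * CP"
  define Gb where "Gb = c2 + CT"
  \<comment> \<open>The summands are the Newton residual, the truncation error of all coordinates at
    radius \<open>R * h\<close>, and the exchange of \<open>g\<close>, felt once in the position and
    once, times \<open>c2\<close>, in the level.\<close>
  define C where "C = C0 + real DIM('a) * (D * R ^ (k + 1)) + (1 + c2) * (C0 * CT * R ^ (k + 1))"
  have nonneg: "D \<ge> 0" "Gb \<ge> 0" "C0 * CT * R ^ (k + 1) \<ge> 0" "D * R ^ (k + 1) \<ge> 0"
    using C0 CP CT c2 R by (auto simp: D_def Gb_def)
  have nonneg2: "real DIM('a) * (D * R ^ (k + 1)) \<ge> 0" "c2 * (C0 * CT * R ^ (k + 1)) \<ge> 0"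
    using nonneg c2 by (auto intro: mult_nonneg_nonneg)
  have C: "C \<ge> 0" "C0 \<le> C" "real DIM('a) * (D * R ^ (k + 1)) + C0 * CT * R ^ (k + 1) \<le> C"
    "C0 + c2 * (C0 * CT * R ^ (k + 1)) \<le> C"
    using nonneg nonneg2 C0 unfolding C_def distrib_right by linarith+
  have "\<forall>\<^sub>F h in at_right 0. \<forall>x0 l S. admissible R C1 C2 h x0 l S \<longrightarrow>
    (\<exists>Y d. poly_deg_le k Y \<and> (\<forall>x\<in>S. \<bar>d x\<bar> \<le> C * h\<^sup>2 \<and>
      norm (Y x - (x + d x *\<^sub>R gradient \<phi> x)) \<le> C * h ^ (k + 1) \<and>
      \<bar>\<phi> (x + d x *\<^sub>R gradient \<phi> x) - l x\<bar> \<le> C * h ^ (k + 1)))"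
    using ev eventually_at_right_less[of 0] eventually_at_right_mult_le[of 1 1, simplified]
      eventually_at_right_mult_le[OF r, of "R + C0 * Gb"] eventually_at_right_mult_le[of 1 R, simplified]
  proof eventually_elim
    case (elim h)
    show ?case
    proof (intro allI impI)
      fix x0 l S assume adm: "admissible R C1 C2 h x0 l S"
      have x0: "x0 \<in> A" and S: "S \<subseteq> cball x0 (R * h)"
        using adm by (auto simp: admissible_def)
      obtain P g where Pg: "taylor_data CP CT x0 P g"
        using td[OF x0] by blast
      then obtain \<delta> where \<delta>: "bpoly x0 N C0 \<delta>" "\<And>x. x \<in> S \<Longrightarrow> \<bar>\<delta> x\<bar> \<le> C0 * h\<^sup>2"
        "\<And>x. x \<in> S \<Longrightarrow> \<bar>\<phi> (x + \<delta> x *\<^sub>R g x) - l x\<bar> \<le> C0 * h ^ (k + 1)"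
        using elim(1) adm by blast
      \<comment> \<open>The bound variable \<open>h\<close> shadows the mesh size; it will be
        instantiated with \<open>R * h\<close>, which is at most 1 by the last smallness
        condition.\<close>
      have "\<forall>b\<in>Basis. \<exists>t. bpoly x0 k D t \<and> (\<forall>x h. norm (x - x0) \<le> h \<longrightarrow> h \<le> 1 \<longrightarrow>
        \<bar>(x - x0) \<bullet> b + \<delta> x * (g x \<bullet> b) - t x\<bar> \<le> D * h ^ Suc k)"
      proof
        fix b :: 'a assume b: "b \<in> Basis"
        have "bpoly x0 (N + k + 1) (C0 * CP) (\<lambda>x. \<delta> x * (g x \<bullet> b))"
          by (rule bpoly_mono[OF bpoly_mult[OF \<delta>(1)]]) (use Pg b in \<open>auto simp: taylor_data_def\<close>)
        from bpoly_add[OF bpoly_coord[OF b, of "N + k + 1" x0] this]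
        have "bpoly x0 (N + k + 1) D (\<lambda>x. (x - x0) \<bullet> b + \<delta> x * (g x \<bullet> b))"
          by (simp add: D_def)
        then obtain t where "bpoly x0 k D t" "\<And>x h. norm (x - x0) \<le> h \<Longrightarrow> h \<le> 1 \<Longrightarrow>
          \<bar>(x - x0) \<bullet> b + \<delta> x * (g x \<bullet> b) - t x\<bar> \<le> D * h ^ Suc k"
          by (rule bpoly_truncate[where n = k]) blast
        then show "\<exists>t. bpoly x0 k D t \<and> (\<forall>x h. norm (x - x0) \<le> h \<longrightarrow> h \<le> 1 \<longrightarrow>
          \<bar>(x - x0) \<bullet> b + \<delta> x * (g x \<bullet> b) - t x\<bar> \<le> D * h ^ Suc k)"
          by blast
      qed
      then obtain t where t: "\<And>b. b \<in> Basis \<Longrightarrow> bpoly x0 k D (t b)"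
        "\<And>b x h. b \<in> Basis \<Longrightarrow> norm (x - x0) \<le> h \<Longrightarrow> h \<le> 1 \<Longrightarrow>
          \<bar>(x - x0) \<bullet> b + \<delta> x * (g x \<bullet> b) - t b x\<bar> \<le> D * h ^ Suc k"
        unfolding bchoice_iff by blast
      define Y where "Y x = x0 + (\<Sum>b\<in>Basis. t b x *\<^sub>R b)" for x
      have "poly_deg_le k (\<lambda>x. x0 + (\<Sum>b\<in>Basis. t b x *\<^sub>R b))"
        by (intro poly_deg_le_add poly_deg_le_const poly_deg_le_sum poly_deg_le_scaleR_const
            bpoly_poly_deg_le[OF t(1)])
      then have Y: "poly_deg_le k Y"
        by (simp add: Y_def[abs_def])
      have "\<bar>\<delta> x\<bar> \<le> C * h\<^sup>2 \<and> norm (Y x - (x + \<delta> x *\<^sub>R gradient \<phi> x)) \<le> C * h ^ (k + 1) \<and>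
          \<bar>\<phi> (x + \<delta> x *\<^sub>R gradient \<phi> x) - l x\<bar> \<le> C * h ^ (k + 1)" if x: "x \<in> S" for x
      proof (intro conjI)
        have h: "0 < h" "h \<le> 1" "(R + C0 * Gb) * h \<le> r" "R * h \<le> 1"
          using elim by auto
        have h2: "h\<^sup>2 \<le> h" "h\<^sup>2 \<le> 1"
          using h by (auto simp: power2_eq_square mult_left_le mult_le_one)
        have xb: "norm (x - x0) \<le> R * h"
          using S x by (auto simp: dist_norm norm_minus_commute)
        have Rr: "R * h + C0 * Gb * h \<le> r"
          using h by (simp add: distrib_right)
        have "0 \<le> C0 * Gb * h"
          using C0 nonneg h by simp
        then have "norm (x - x0) \<le> r"
          using xb Rr by linarith
        then have xr: "x \<in> cball x0 r"
          by (simp add: dist_norm norm_minus_commute)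
        have xU: "x \<in> U"
          using A[OF x0] xr by blast
        have \<delta>x: "\<bar>\<delta> x\<bar> \<le> C0 * h\<^sup>2"
          by (rule \<delta>(2)[OF x])
        also have "\<dots> \<le> C * h\<^sup>2"
          using C by (intro mult_right_mono) auto
        finally show "\<bar>\<delta> x\<bar> \<le> C * h\<^sup>2" .
        have dist: "dist x0 x \<le> R * h"
          using xb by (simp add: dist_norm norm_minus_commute)
        have "norm (g x - gradient \<phi> x) \<le> CT * dist x0 x ^ Suc k"
          using Pg xr by (auto simp: taylor_data_def)
        also have "\<dots> \<le> CT * (R * h) ^ Suc k"
          using dist CT by (intro mult_left_mono power_mono) auto
        finally have gx: "norm (g x - gradient \<phi> x) \<le> CT * (R * h) ^ (k + 1)"
          by simp
        also have "\<dots> \<le> CT * 1"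
          using h R CT by (intro mult_left_mono power_le_one) auto
        finally have "norm (g x) \<le> Gb"
          using norm_triangle_sub[of "g x" "gradient \<phi> x"] grad_upper[OF xU] by (simp add: Gb_def)
        moreover have "norm (gradient \<phi> x) \<le> Gb"
          using grad_upper[OF xU] CT by (simp add: Gb_def)
        moreover have "x + \<delta> x *\<^sub>R v \<in> cball x0 r" if v: "norm v \<le> Gb" for v
        proof -
          have "norm (\<delta> x *\<^sub>R v) \<le> (C0 * h\<^sup>2) * Gb"
            unfolding norm_scaleR using \<delta>x v by (intro mult_mono) auto
          also have "\<dots> = C0 * Gb * h\<^sup>2"
            by simp
          also have "\<dots> \<le> C0 * Gb * h"
            using h2 C0 nonneg by (intro mult_left_mono) auto
          finally have "norm ((x - x0) + \<delta> x *\<^sub>R v) \<le> r"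
            using norm_triangle_ineq[of "x - x0" "\<delta> x *\<^sub>R v"] xb Rr by linarith
          then show ?thesis
            by (simp add: dist_norm norm_minus_commute algebra_simps)
        qed
        ultimately have in2: "x + \<delta> x *\<^sub>R g x \<in> cball x0 r" "x + \<delta> x *\<^sub>R gradient \<phi> x \<in> cball x0 r"
          by auto
        have "norm ((x + \<delta> x *\<^sub>R g x) - (x + \<delta> x *\<^sub>R gradient \<phi> x))
            = \<bar>\<delta> x\<bar> * norm (g x - gradient \<phi> x)"
          by (simp add: scaleR_diff_right[symmetric])
        also have "\<dots> \<le> (C0 * h\<^sup>2) * (CT * (R * h) ^ (k + 1))"
          using \<delta>x gx by (intro mult_mono) auto
        also have "\<dots> = h\<^sup>2 * ((C0 * CT * R ^ (k + 1)) * h ^ (k + 1))"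
          by (simp only: power_mult_distrib mult_ac)
        also have "\<dots> \<le> 1 * ((C0 * CT * R ^ (k + 1)) * h ^ (k + 1))"
          using h2 h nonneg by (intro mult_right_mono) auto
        finally have gg: "norm ((x + \<delta> x *\<^sub>R g x) - (x + \<delta> x *\<^sub>R gradient \<phi> x))
            \<le> (C0 * CT * R ^ (k + 1)) * h ^ (k + 1)"
          by simp
        have "norm (Y x - (x + \<delta> x *\<^sub>R g x)) \<le> real DIM('a) * (D * (R * h) ^ Suc k)"
        proof (rule norm_le_sum_Basis)
          fix b :: 'a assume b: "b \<in> Basis"
          have "(Y x - (x + \<delta> x *\<^sub>R g x)) \<bullet> b = - ((x - x0) \<bullet> b + \<delta> x * (g x \<bullet> b) - t b x)"
            using b by (simp add: Y_def inner_diff_left inner_add_left inner_sum_left_Basis)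
          then show "\<bar>(Y x - (x + \<delta> x *\<^sub>R g x)) \<bullet> b\<bar> \<le> D * (R * h) ^ Suc k"
            using t(2)[OF b xb h(4)] by (simp only: abs_minus_cancel)
        qed
        also have "\<dots> = real DIM('a) * (D * R ^ (k + 1)) * h ^ (k + 1)"
          by (simp add: power_mult_distrib mult_ac)
        finally have Yg: "norm (Y x - (x + \<delta> x *\<^sub>R g x)) \<le> real DIM('a) * (D * R ^ (k + 1)) * h ^ (k + 1)" .
        have "norm (Y x - (x + \<delta> x *\<^sub>R gradient \<phi> x)) \<le> norm (Y x - (x + \<delta> x *\<^sub>R g x))
            + norm ((x + \<delta> x *\<^sub>R g x) - (x + \<delta> x *\<^sub>R gradient \<phi> x))"
          by (rule norm_diff_triangle_le[OF order_refl order_refl])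
        also have "\<dots> \<le> (real DIM('a) * (D * R ^ (k + 1)) + C0 * CT * R ^ (k + 1)) * h ^ (k + 1)"
          unfolding distrib_right by (rule add_mono[OF Yg gg])
        also have "\<dots> \<le> C * h ^ (k + 1)"
          using C h by (intro mult_right_mono) auto
        finally show "norm (Y x - (x + \<delta> x *\<^sub>R gradient \<phi> x)) \<le> C * h ^ (k + 1)" .
        have "\<bar>\<phi> (x + \<delta> x *\<^sub>R g x) - \<phi> (x + \<delta> x *\<^sub>R gradient \<phi> x)\<bar>
            \<le> c2 * norm ((x + \<delta> x *\<^sub>R g x) - (x + \<delta> x *\<^sub>R gradient \<phi> x))"
          by (rule phi_lipschitz[OF convex_cball A[OF x0] in2])
        also have "\<dots> \<le> c2 * ((C0 * CT * R ^ (k + 1)) * h ^ (k + 1))"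
          using gg c2 by (intro mult_left_mono) auto
        finally have "\<bar>\<phi> (x + \<delta> x *\<^sub>R gradient \<phi> x) - l x\<bar>
            \<le> C0 * h ^ (k + 1) + c2 * ((C0 * CT * R ^ (k + 1)) * h ^ (k + 1))"
          using \<delta>(3)[OF x] by linarith
        also have "\<dots> = (C0 + c2 * (C0 * CT * R ^ (k + 1))) * h ^ (k + 1)"
          by (simp only: distrib_right mult.assoc)
        also have "\<dots> \<le> C * h ^ (k + 1)"
          using C h by (intro mult_right_mono) auto
        finally show "\<bar>\<phi> (x + \<delta> x *\<^sub>R gradient \<phi> x) - l x\<bar> \<le> C * h ^ (k + 1)" .
      qed
      with Y show "\<exists>Y d. poly_deg_le k Y \<and> (\<forall>x\<in>S. \<bar>d x\<bar> \<le> C * h\<^sup>2 \<and>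
        norm (Y x - (x + d x *\<^sub>R gradient \<phi> x)) \<le> C * h ^ (k + 1) \<and>
        \<bar>\<phi> (x + d x *\<^sub>R gradient \<phi> x) - l x\<bar> \<le> C * h ^ (k + 1))"
        by blast
    qed
  qed
  with C(1) show ?thesis
    by blast
qed

end

section \<open>Level sets on a mesh\<close>

text \<open>A union of elements is in general not convex, so the elementwise bound is carried along
  the segment, covered by the closed preimages of the elements; the constant does not grow with
  their number.\<close>

lemma segment_lipschitz_union:
  fixes f :: "'a::euclidean_space \<Rightarrow> real"
  assumes S: "finite S" "\<And>T. T \<in> S \<Longrightarrow> closed T" "(\<lambda>t. x + t *\<^sub>R w) ` {0..b} \<subseteq> \<Union>S"
    and L: "L \<ge> 0" "\<And>T y y'. T \<in> S \<Longrightarrow> y \<in> T \<Longrightarrow> y' \<in> T \<Longrightarrow> \<bar>f y - f y'\<bar> \<le> L * dist y y'"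
    and b: "0 \<le> b"
  shows "\<bar>f (x + b *\<^sub>R w) - f x\<bar> \<le> L * norm w * b"
proof -
  define g where "g t = x + t *\<^sub>R w" for t
  have "lipschitz_on (L * norm w) {0..b} (\<lambda>t. f (g t))"
  proof (rule lipschitz_on_closed_Union[where I = S and U = "\<lambda>T. {0..b} \<inter> g -` T"])
    fix T assume T: "T \<in> S"
    show "lipschitz_on (L * norm w) ({0..b} \<inter> g -` T) (\<lambda>t. f (g t))"
    proof (rule lipschitz_onI)
      fix t t' assume t: "t \<in> {0..b} \<inter> g -` T" "t' \<in> {0..b} \<inter> g -` T"
      have "dist (f (g t)) (f (g t')) \<le> L * dist (g t) (g t')"
        using L(2)[OF T, of "g t" "g t'"] t by (simp add: dist_real_def)
      also have "dist (g t) (g t') = norm w * dist t t'"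
        by (simp add: g_def dist_norm scaleR_diff_left[symmetric] mult.commute)
      finally show "dist (f (g t)) (f (g t')) \<le> L * norm w * dist t t'"
        by (simp add: mult.assoc)
    qed (use L in simp)
    show "closed ({0..b} \<inter> g -` T)"
      unfolding g_def by (intro continuous_closed_preimage continuous_intros S(2) T)
  next
    show "{0..b} \<subseteq> (\<Union>T\<in>S. {0..b} \<inter> g -` T)"
      using S(3) by (auto simp: g_def image_subset_iff)
  qed (use S L in auto)
  from lipschitz_onD[OF this, of b 0] b have "dist (f (g b)) (f (g 0)) \<le> L * norm w * dist b 0"
    by simp
  then show ?thesis
    using b by (simp add: g_def dist_real_def)
qed

text \<open>One mesh of the family, measured against constants that do not depend on it.
  \<open>\<phi>h\<close> is only piecewise polynomial, so \<open>err0\<close> and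
  \<open>err1\<close> speak of interiors of elements.\<close>

locale level_set_mesh = level_set \<phi> U k c1 c2 cH
  for \<phi> :: "'a::euclidean_space \<Rightarrow> real" and U k c1 c2 cH +
  fixes S :: "'a set set" and h \<rho> \<tau> c :: real and \<phi>h :: "'a \<Rightarrow> real"
  assumes mesh: "full_mesh S" and U_mesh: "U \<subseteq> \<Union>S" and h: "0 < h" "h \<le> 1"
    and \<rho>: "\<rho> > 0" and \<tau>: "\<tau> \<ge> 0" and c: "c \<ge> 0"
    and diam: "\<And>T. T \<in> S \<Longrightarrow> diameter T \<le> \<tau> * h"
    and inball: "\<And>T. T \<in> S \<Longrightarrow> \<exists>z. cball z (\<rho> * h) \<subseteq> T"
    and fe: "\<phi>h \<in> fe_space k S"
    and err0: "\<And>T x. T \<in> S \<Longrightarrow> x \<in> interior T \<inter> U \<Longrightarrow> \<bar>\<phi>h x - \<phi> x\<bar> \<le> c * h ^ (k + 1)"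
    and err1: "\<And>T x b. T \<in> S \<Longrightarrow> x \<in> interior T \<inter> U \<Longrightarrow> b \<in> Basis \<Longrightarrow>
      \<bar>frechet_derivative (\<lambda>x. \<phi>h x - \<phi> x) (at x) b\<bar> \<le> c * h ^ k"
begin

lemma elem_dist: "T \<in> S \<Longrightarrow> x \<in> T \<Longrightarrow> y \<in> T \<Longrightarrow> dist x y \<le> \<tau> * h"
  using diameter_bounded_bound[of T x y] full_mesh_compact[OF mesh, of T] diam[of T]
  by (meson compact_imp_bounded order_trans)

lemma elem_closure_interior:
  assumes "T \<in> S"
  shows "closure (interior T) = T"
proof -
  obtain z where "cball z (\<rho> * h) \<subseteq> T"
    using inball[OF assms] by blast
  then have "interior (cball z (\<rho> * h)) \<subseteq> interior T"
    by (rule interior_mono)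
  moreover have "z \<in> ball z (\<rho> * h)"
    using \<rho> h by simp
  ultimately have "interior T \<noteq> {}"
    by auto
  then have "closure (interior T) = closure T"
    using full_mesh_convex[OF mesh assms] by (intro convex_closure_interior)
  then show ?thesis
    using full_mesh_compact[OF mesh assms] by (simp add: closure_closed compact_imp_closed)
qed

lemma fe_error:
  assumes T: "T \<in> S" "T \<subseteq> U" and x: "x \<in> T"
  shows "\<bar>\<phi>h x - \<phi> x\<bar> \<le> c * h ^ (k + 1)"
proof -
  have "continuous_on (\<Union>S) \<phi>h"
    using fe by (simp add: fe_space_def)
  then have "continuous_on T \<phi>h"
    by (rule continuous_on_subset) (use T in auto)
  then have "continuous_on (closure (interior T)) (\<lambda>x. \<bar>\<phi>h x - \<phi> x\<bar>)"
    unfolding elem_closure_interior[OF T(1)]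
    by (intro continuous_intros phi_continuous_on T(2))
  then show ?thesis
    by (rule continuous_le_on_closure)
      (use x T err0[OF T(1)] interior_subset in \<open>auto simp: elem_closure_interior subset_iff\<close>)
qed

text \<open>Inside \<open>T\<close> the derivative of \<open>\<phi>h\<close> is that of its
  polynomial extension, to which \<open>err1\<close> applies; both gradients are continuous up to
  the boundary, so the bound passes to the closed element.\<close>

lemma grad_error:
  assumes T: "T \<in> S" "T \<subseteq> U" and x: "x \<in> T"
  shows "norm (elem_gradient k \<phi>h T x - gradient \<phi> x) \<le> real DIM('a) * c * h ^ k"
proof -
  define p where "p = poly_ext k T \<phi>h"
  have p: "poly_deg_le k p" "\<And>x. x \<in> T \<Longrightarrow> p x = \<phi>h x"
    unfolding p_def using poly_ext_poly[OF mesh T(1) k fe] poly_ext_eq[OF mesh T(1) k fe] by auto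
  obtain p' where p': "\<And>x. GDERIV p x :> p' x" "continuous_on UNIV p'"
    using poly_deg_le_gderiv[OF p(1)] by blast
  have grad_cont: "continuous_on U (gradient \<phi>)"
    using Cm_on_gradient_derivative[OF smooth open_U]
    by (auto intro!: continuous_at_imp_continuous_on has_derivative_continuous)
  have "norm (p' x - gradient \<phi> x) \<le> real DIM('a) * (c * h ^ k)"
  proof (rule continuous_le_on_closure[where S = "interior T"
        and f = "\<lambda>x. norm (p' x - gradient \<phi> x)" and x = x])
    show "continuous_on (closure (interior T)) (\<lambda>x. norm (p' x - gradient \<phi> x))"
      unfolding elem_closure_interior[OF T(1)]
      by (intro continuous_intros continuous_on_subset[OF p'(2)] continuous_on_subset[OF grad_cont] T) auto
    show "x \<in> closure (interior T)"
      using x by (simp add: elem_closure_interior[OF T(1)])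
    fix y assume y: "y \<in> interior T"
    then have yU: "y \<in> U"
      using T interior_subset by blast
    have "((\<lambda>x. p x - \<phi> x) has_derivative (\<lambda>w. w \<bullet> (p' y - gradient \<phi> y))) (at y)"
      using GDERIV_diff[OF p'(1) phi_gderiv[OF yU]] by (simp add: gderiv_def)
    then have "((\<lambda>x. \<phi>h x - \<phi> x) has_derivative (\<lambda>w. w \<bullet> (p' y - gradient \<phi> y))) (at y)"
      by (rule has_derivative_transform_within_open[OF _ open_interior y])
        (use p(2) interior_subset in \<open>auto simp: subset_iff\<close>)
    then have fr: "(\<lambda>w. w \<bullet> (p' y - gradient \<phi> y)) = frechet_derivative (\<lambda>x. \<phi>h x - \<phi> x) (at y)"
      by (rule frechet_derivative_at)
    show "norm (p' y - gradient \<phi> y) \<le> real DIM('a) * (c * h ^ k)"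
    proof (rule norm_le_sum_Basis)
      fix b :: 'a assume "b \<in> Basis"
      then show "\<bar>(p' y - gradient \<phi> y) \<bullet> b\<bar> \<le> c * h ^ k"
        using err1[OF T(1), of y b] y yU fun_cong[OF fr, of b] by (simp add: inner_commute)
    qed
  qed
  moreover have "elem_gradient k \<phi>h T x = p' x"
    unfolding elem_gradient_def p_def[symmetric] by (rule gradient_eqI[OF p'(1)])
  ultimately show ?thesis
    by simp
qed

section \<open>The linear interpolant and the position of cut elements\<close>

lemma interp_sum:
  assumes "T \<in> S" "x \<in> T"
  shows "nodal_interp 1 S \<phi>h x = (\<Sum>v\<in>verts T. bary (verts T) v x * \<phi>h v)"
  using nodal_interp_eq[OF mesh _ assms, of 1 \<phi>h] elem_interp_1[OF mesh assms(1), of \<phi>h x] by simp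

lemma verts_subset: "T \<in> S \<Longrightarrow> verts T \<subseteq> T"
  by (auto simp: verts_def extreme_point_of_def)

text \<open>Linear interpolation reproduces affine functions, so the first-order part of \<phi>
  about \<open>x\<close> may be subtracted at the vertices without any change (\<open>zero\<close>);
  a second-order remainder and the error of \<open>\<phi>h\<close> are left.\<close>

lemma interp_error:
  assumes T: "T \<in> S" "T \<subseteq> U" and x: "x \<in> T"
  shows "\<bar>nodal_interp 1 S \<phi>h x - \<phi> x\<bar> \<le> (cH * \<tau>\<^sup>2 + c) * h\<^sup>2"
proof -
  interpret V: full_simplex "verts T"
    by (rule full_mesh_full_simplex[OF mesh T(1)])
  let ?l = "\<lambda>v. bary (verts T) v x" and ?g = "gradient \<phi> x"
  have xh: "x \<in> convex hull (verts T)"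
    using x full_mesh_hull[OF mesh T(1)] by simp
  have "(\<Sum>v\<in>verts T. ?l v * (?g \<bullet> (v - x))) = ?g \<bullet> (\<Sum>v\<in>verts T. ?l v *\<^sub>R (v - x))"
    by (simp add: inner_sum_right)
  also have "(\<Sum>v\<in>verts T. ?l v *\<^sub>R (v - x)) = (\<Sum>v\<in>verts T. ?l v *\<^sub>R v) - (\<Sum>v\<in>verts T. ?l v) *\<^sub>R x"
    by (simp add: scaleR_diff_right sum_subtractf scaleR_sum_left)
  also have "\<dots> = 0"
    by (simp add: V.bary_combination V.sum_bary)
  finally have zero: "(\<Sum>v\<in>verts T. ?l v * (?g \<bullet> (v - x))) = 0"
    by simp
  have "\<phi> x = (\<Sum>v\<in>verts T. ?l v) * \<phi> x"
    by (simp add: V.sum_bary)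
  then have "nodal_interp 1 S \<phi>h x - \<phi> x
      = (\<Sum>v\<in>verts T. ?l v * \<phi>h v) - (\<Sum>v\<in>verts T. ?l v * \<phi> x) - (\<Sum>v\<in>verts T. ?l v * (?g \<bullet> (v - x)))"
    unfolding interp_sum[OF T(1) x] zero by (simp add: sum_distrib_right)
  also have "\<dots> = (\<Sum>v\<in>verts T. ?l v * ((\<phi>h v - \<phi> v) + (\<phi> v - \<phi> x - ?g \<bullet> (v - x))))"
    by (simp add: sum_subtractf[symmetric] sum.distrib[symmetric] algebra_simps)
  finally have "\<bar>nodal_interp 1 S \<phi>h x - \<phi> x\<bar>
      \<le> (\<Sum>v\<in>verts T. ?l v * \<bar>(\<phi>h v - \<phi> v) + (\<phi> v - \<phi> x - ?g \<bullet> (v - x))\<bar>)"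
    using sum_abs[of "\<lambda>v. ?l v * ((\<phi>h v - \<phi> v) + (\<phi> v - \<phi> x - ?g \<bullet> (v - x)))" "verts T"]
    by (simp add: abs_mult V.bary_hull(1)[OF xh])
  also have "\<dots> \<le> (\<Sum>v\<in>verts T. ?l v * ((cH * \<tau>\<^sup>2 + c) * h\<^sup>2))"
  proof (intro sum_mono mult_left_mono V.bary_hull(1)[OF xh])
    fix v assume v: "v \<in> verts T"
    then have vT: "v \<in> T"
      using verts_subset[OF T(1)] by auto
    have d: "dist x v \<le> \<tau> * h"
      by (rule elem_dist[OF T(1) x vT])
    have "\<bar>\<phi> v - \<phi> x - ?g \<bullet> (v - x)\<bar> \<le> cH * (\<tau> * h) * norm (v - x)"
      using full_mesh_convex[OF mesh T(1)] T(2) x vT d \<tau> h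
      by (intro expansion[where S = T]) auto
    also have "\<dots> \<le> cH * (\<tau> * h) * (\<tau> * h)"
      using d cH \<tau> h by (intro mult_left_mono) (auto simp: dist_norm norm_minus_commute)
    finally have 1: "\<bar>\<phi> v - \<phi> x - ?g \<bullet> (v - x)\<bar> \<le> cH * \<tau>\<^sup>2 * h\<^sup>2"
      by (simp add: power2_eq_square mult_ac)
    have "\<bar>\<phi>h v - \<phi> v\<bar> \<le> c * h ^ (k + 1)"
      by (rule fe_error[OF T vT])
    also have "\<dots> \<le> c * h\<^sup>2"
      using c h k by (intro mult_left_mono power_decreasing) auto
    finally show "\<bar>(\<phi>h v - \<phi> v) + (\<phi> v - \<phi> x - ?g \<bullet> (v - x))\<bar> \<le> (cH * \<tau>\<^sup>2 + c) * h\<^sup>2"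
      using 1 unfolding distrib_right by linarith
  qed
  also have "\<dots> = (cH * \<tau>\<^sup>2 + c) * h\<^sup>2"
    by (simp add: sum_distrib_right[symmetric] V.sum_bary)
  finally show ?thesis .
qed

text \<open>The sum of the hat functions of the vertices of \<open>T\<close> is \<open>1\<close> on \<open>T\<close>, vanishes off the patch
  of \<open>T\<close> and has slope of order \<open>1 / h\<close>; hence the patch contains a ball of radius of order \<open>h\<close>
  around each point of \<open>T\<close>.\<close>

lemma patch_ball:
  assumes T: "T \<in> S" and patch: "\<And>T'. T' \<in> S \<Longrightarrow> T' \<inter> T \<noteq> {} \<Longrightarrow> T' \<subseteq> U"
    and x: "x \<in> T" and \<delta>: "\<delta> \<le> \<rho> * h / (2 * (real DIM('a) + 1))"
  shows "cball x \<delta> \<subseteq> U"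
proof
  fix y assume y: "y \<in> cball x \<delta>"
  \<comment> \<open>Nodal values of the sum of the hat functions of the vertices of
    \<open>T\<close>.\<close>
  define ind :: "'a \<Rightarrow> real" where "ind v = (if v \<in> verts T then 1 else 0)" for v
  define f where "f = nodal_interp 1 S ind"
  have f: "f y = (\<Sum>v\<in>verts T'. bary (verts T') v y * (if v \<in> verts T then 1 else 0))"
    if "T' \<in> S" "y \<in> T'" for T' y
    unfolding f_def ind_def[symmetric]
    using nodal_interp_eq[OF mesh _ that, of 1 ind] elem_interp_1[OF mesh that(1), of ind y] by simp
  have f_one: "f y = 1" if "y \<in> T" for y
    unfolding f[OF T that] using full_simplex.sum_bary[OF full_mesh_full_simplex[OF mesh T]] by simp
  have f_zero: "f y = 0" if "T' \<in> S" "y \<in> T'" "T' \<inter> T = {}" for T' y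
    unfolding f[OF that(1,2)]
    using that(3) verts_subset[OF T] verts_subset[OF that(1)] by (intro sum.neutral) auto
  define L where "L = (real DIM('a) + 1) / (\<rho> * h)"
  have L: "L \<ge> 0"
    using \<rho> h by (simp add: L_def)
  have lip: "\<bar>f y - f y'\<bar> \<le> L * dist y y'" if T': "T' \<in> S" and y: "y \<in> T'" "y' \<in> T'" for T' y y'
  proof -
    interpret V: full_simplex "verts T'"
      by (rule full_mesh_full_simplex[OF mesh T'])
    obtain z where z: "cball z (\<rho> * h) \<subseteq> T'"
      using inball[OF T'] by blast
    have "f y - f y' = (\<Sum>v\<in>verts T'. (bary (verts T') v y - bary (verts T') v y') * (if v \<in> verts T then 1 else 0))"
      unfolding f[OF T' y(1)] f[OF T' y(2)] by (simp add: sum_subtractf left_diff_distrib)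
    also have "\<bar>\<dots>\<bar> \<le> (\<Sum>v\<in>verts T'. dist y y' / (\<rho> * h))"
    proof (rule order_trans[OF sum_abs sum_mono])
      fix v assume "v \<in> verts T'"
      have "\<bar>bary (verts T') v y - bary (verts T') v y'\<bar> \<le> dist y y' / (\<rho> * h)"
        using z \<rho> h by (intro V.bary_lipschitz[of z]) (auto simp: full_mesh_hull[OF mesh T'])
      then show "\<bar>(bary (verts T') v y - bary (verts T') v y') * (if v \<in> verts T then 1 else 0)\<bar>
          \<le> dist y y' / (\<rho> * h)"
        using \<rho> h by auto
    qed
    also have "\<dots> = L * dist y y'"
      using full_mesh_card[OF mesh T'] by (simp add: L_def algebra_simps)
    finally show ?thesis .
  qed
  have closed_elem: "closed T'" if "T' \<in> S" for T'
    using full_mesh_compact[OF mesh that] by (rule compact_imp_closed)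
  define Q where "Q = {T' \<in> S. T' \<inter> T \<noteq> {}}"
  have Q: "finite Q" "\<Union>Q \<subseteq> U"
    using full_mesh_finite[OF mesh] patch by (auto simp: Q_def)
  have closedQ: "closed (\<Union>Q)"
    using Q(1) closed_elem by (intro closed_Union) (auto simp: Q_def)
  have contU: "continuous_on U f"
    using nodal_interp_fe_space[OF mesh, of 1] U_mesh
    unfolding f_def fe_space_def by (auto intro: continuous_on_subset)
  define V where "V = U \<inter> f -` {0<..}"
  have openV: "open V"
    unfolding V_def by (rule continuous_open_preimage[OF contU open_U open_greaterThan])
  have VQ: "V \<subseteq> \<Union>Q"
  proof
    fix y assume y: "y \<in> V"
    then obtain T' where "T' \<in> S" "y \<in> T'"
      using U_mesh by (auto simp: V_def)
    moreover from this have "T' \<inter> T \<noteq> {}"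
      using y f_zero[of T' y] by (auto simp: V_def)
    ultimately show "y \<in> \<Union>Q"
      by (auto simp: Q_def)
  qed
  have TU: "T \<subseteq> U"
    using patch[OF T] x by auto
  have xV: "x \<in> V"
    using x TU f_one by (auto simp: V_def)
  show "y \<in> U"
  proof (rule ccontr)
    assume "y \<notin> U"
    define w where "w = y - x"
    define g where "g t = x + t *\<^sub>R w" for t
    have g_cont: "continuous_on A g" for A
      unfolding g_def by (intro continuous_intros)
    \<comment> \<open>\<open>t0\<close> will be the first exit time from the open set
      \<open>V\<close>. Before it the segment lies in the closed patch, hence so does the exit
      point, which thus belongs to \<open>U\<close> and has \<open>f \<le> 0\<close>.\<close>
    define B where "B = {0..1} \<inter> g -` (- V)"
    have "closed B"
      unfolding B_def using openV by (intro continuous_closed_preimage g_cont) auto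
    moreover have "bounded B"
      by (rule bounded_subset[of "{0..1}"]) (auto simp: B_def)
    moreover have "1 \<in> B"
      using \<open>y \<notin> U\<close> by (auto simp: B_def g_def w_def V_def)
    ultimately obtain t0 where t0: "t0 \<in> B" "\<And>t. t \<in> B \<Longrightarrow> t0 \<le> t"
      using compact_attains_inf[of B] by (auto simp: compact_eq_bounded_closed)
    have t01: "0 \<le> t0" "t0 \<le> 1" "g t0 \<notin> V"
      using t0(1) by (auto simp: B_def)
    have "t0 \<noteq> 0"
      using t01(3) xV by (auto simp: g_def)
    then have pos: "0 < t0"
      using t01 by simp
    have before: "g t \<in> \<Union>Q" if "0 \<le> t" "t < t0" for t
    proof -
      have "t \<notin> B"
        using t0(2)[of t] that by auto
      then show ?thesis
        using VQ that t01 by (auto simp: B_def)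
    qed
    have "g t0 \<in> \<Union>Q"
    proof -
      have "g ` closure {0..<t0} \<subseteq> closure (\<Union>Q)"
        using before closedQ by (intro image_closure_subset g_cont) auto
      moreover have "t0 \<in> closure {0..<t0}"
        using pos by (simp add: closure_atLeastLessThan)
      ultimately show ?thesis
        using closedQ by auto
    qed
    have seg: "g t \<in> \<Union>Q" if "t \<in> {0..t0}" for t
    proof (cases "t = t0")
      case True
      then show ?thesis
        using \<open>g t0 \<in> \<Union>Q\<close> by (simp only:)
    next
      case False
      then show ?thesis
        using before[of t] that by simp
    qed
    have "f (g t0) \<le> 0"
      using t01(3) \<open>g t0 \<in> \<Union>Q\<close> Q(2) by (auto simp: V_def)
    moreover have "\<bar>f (g t0) - f x\<bar> \<le> L * norm w * t0"
      unfolding g_def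
    proof (rule segment_lipschitz_union[OF Q(1)])
      show "(\<lambda>t. x + t *\<^sub>R w) ` {0..t0} \<subseteq> \<Union>Q"
        using seg unfolding g_def by blast
      show "\<bar>f y - f y'\<bar> \<le> L * dist y y'" if "T' \<in> Q" "y \<in> T'" "y' \<in> T'" for T' y y'
        using that by (intro lip) (auto simp: Q_def)
      show "closed T'" if "T' \<in> Q" for T'
        using that by (intro closed_elem) (auto simp: Q_def)
    qed (rule L, rule t01)
    moreover have "L * norm w * t0 \<le> L * \<delta> * 1"
      using L y t01 by (intro mult_mono mult_left_mono mult_nonneg_nonneg)
        (auto simp: w_def dist_norm norm_minus_commute intro: order_trans[OF norm_ge_zero])
    moreover have "L * \<delta> \<le> L * (\<rho> * h / (2 * (real DIM('a) + 1)))"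
      using \<delta> L by (rule mult_left_mono)
    \<comment> \<open>\<open>f\<close> would have to drop from 1 to at most 0 over a length of at
      most half of \<open>1 / L\<close>.\<close>
    moreover have "L * (\<rho> * h / (2 * (real DIM('a) + 1))) = 1 / 2"
    proof -
      have "b / a * (a / (2 * b)) = 1 / 2" if "a \<noteq> 0" "b \<noteq> 0" for a b :: real
        using that by simp
      then show ?thesis
        unfolding L_def using \<rho> h by simp
    qed
    ultimately show False
      using f_one[OF x] by simp
  qed
qed

text \<open>At a zero of the linear interpolant in \<open>T\<close>, \<phi> is of order
  \<open>h ^ 2\<close>, while \<open>patch_ball\<close> offers a ball of radius of order
  \<open>h\<close>: enough room for \<open>zero_near\<close>. Hence cut elements end up in a fixed
  neighbourhood of the zero set.\<close>

lemma cut_near_zero: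
  assumes T: "T \<in> cut_elements S \<phi>h" and patch: "\<And>T'. T' \<in> S \<Longrightarrow> T' \<inter> T \<noteq> {} \<Longrightarrow> T' \<subseteq> U"
    and small: "2 * (cH * \<tau>\<^sup>2 + c) * h \<le> c1 * (\<rho> / (2 * (real DIM('a) + 1)))"
      "2 * cH * (\<rho> / (2 * (real DIM('a) + 1))) * h \<le> c1"
    and x: "x \<in> T"
  shows "\<exists>z\<in>U. \<phi> z = 0 \<and> dist z x \<le> (\<tau> + 2 * (cH * \<tau>\<^sup>2 + c) / c1) * h"
proof -
  define \<delta> where "\<delta> = \<rho> / (2 * (real DIM('a) + 1))"
  define \<epsilon> where "\<epsilon> = (cH * \<tau>\<^sup>2 + c) * h\<^sup>2"
  have TS: "T \<in> S"
    using T by (simp add: cut_elements_def)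
  obtain y where y: "y \<in> T" "nodal_interp 1 S \<phi>h y = 0"
    using T by (auto simp: cut_elements_def Gamma_lin_def)
  have TU: "T \<subseteq> U"
    using patch[OF TS] x by auto
  have ball: "cball y (\<delta> * h) \<subseteq> U"
    by (rule patch_ball[OF TS patch y(1)]) (simp_all add: \<delta>_def)
  have "\<exists>z\<in>cball y (2 * \<epsilon> / c1). \<phi> z = 0"
  proof (rule zero_near[OF ball])
    show "\<bar>\<phi> y\<bar> \<le> \<epsilon>"
      using interp_error[OF TS TU y(1)] y(2) by (simp add: \<epsilon>_def)
    have "2 * (cH * \<tau>\<^sup>2 + c) * h * h \<le> c1 * \<delta> * h"
      using small(1) h by (intro mult_right_mono) (auto simp: \<delta>_def)
    then show "2 * \<epsilon> \<le> c1 * (\<delta> * h)"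
      by (simp add: \<epsilon>_def power2_eq_square mult_ac)
    show "2 * cH * (\<delta> * h) \<le> c1"
      using small(2) by (simp add: \<delta>_def mult_ac)
  qed
  then obtain z where z: "dist y z \<le> 2 * \<epsilon> / c1" "\<phi> z = 0"
    by auto
  have e1: "2 * \<epsilon> / c1 \<le> 2 * (cH * \<tau>\<^sup>2 + c) / c1 * h"
  proof -
    have "h\<^sup>2 \<le> h"
      using h by (simp add: power2_eq_square mult_left_le)
    then have "2 * (cH * \<tau>\<^sup>2 + c) / c1 * h\<^sup>2 \<le> 2 * (cH * \<tau>\<^sup>2 + c) / c1 * h"
      using cH \<tau> c c1 by (intro mult_left_mono) auto
    then show ?thesis
      by (simp only: \<epsilon>_def times_divide_eq_left times_divide_eq_right mult.assoc)
  qed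
  have e2: "2 * \<epsilon> / c1 \<le> \<delta> * h"
  proof -
    have "2 * (cH * \<tau>\<^sup>2 + c) * h * h \<le> c1 * \<delta> * h"
      using small(1) h by (intro mult_right_mono) (auto simp: \<delta>_def)
    then show ?thesis
      using c1 by (simp add: \<epsilon>_def power2_eq_square field_simps)
  qed
  have "z \<in> U"
    using ball z(1) e2 by auto
  moreover have "dist z x \<le> (\<tau> + 2 * (cH * \<tau>\<^sup>2 + c) / c1) * h"
    using elem_dist[OF TS x y(1)] z(1) e1 dist_triangle[of x z y] unfolding distrib_right
    by (simp add: dist_commute)
  ultimately show ?thesis
    using z(2) by blast
qed

text \<open>The slopes of the barycentric coordinates are of order \<open>1 / h\<close> but sum to
  zero, so only the differences \<open>\<phi>h v - \<phi> x0\<close> enter. These are of order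
  \<open>h\<close>, and the coefficients stay bounded.\<close>

lemma interp_bpoly:
  assumes T: "T \<in> S" "T \<subseteq> U" and x0: "x0 \<in> T" and M: "\<bar>\<phi> x0\<bar> \<le> M"
  shows "bpoly x0 1 (M + (cH * \<tau>\<^sup>2 + c) + real DIM('a) * ((real DIM('a) + 1) * ((c2 * \<tau> + c) / \<rho>)))
    (elem_interp 1 T \<phi>h)"
proof -
  interpret V: full_simplex "verts T"
    by (rule full_mesh_full_simplex[OF mesh T(1)])
  obtain z where z: "cball z (\<rho> * h) \<subseteq> T"
    using inball[OF T(1)] by blast
  have "\<forall>v. \<exists>m. \<forall>x. bary (verts T) v x = bary (verts T) v x0 + m \<bullet> (x - x0)"
    using V.bary_affine by blast
  then obtain m where m: "\<And>v x. bary (verts T) v x = bary (verts T) v x0 + m v \<bullet> (x - x0)"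
    by metis
  have mb: "\<bar>m v \<bullet> b\<bar> \<le> 1 / (\<rho> * h)" if "b \<in> Basis" for v b
  proof -
    have "\<bar>bary (verts T) v (x0 + b) - bary (verts T) v x0\<bar> \<le> dist (x0 + b) x0 / (\<rho> * h)"
      using z \<rho> h by (intro V.bary_lipschitz[of z]) (auto simp: full_mesh_hull[OF mesh T(1)])
    then show ?thesis
      using m[of v "x0 + b"] that by (simp add: dist_norm)
  qed
  have msum: "(\<Sum>v\<in>verts T. m v \<bullet> w) = 0" for w
  proof -
    have "(\<Sum>v\<in>verts T. bary (verts T) v (x0 + w)) = (\<Sum>v\<in>verts T. bary (verts T) v x0) + (\<Sum>v\<in>verts T. m v \<bullet> w)"
      unfolding sum.distrib[symmetric] using m[of _ "x0 + w"] by (intro sum.cong) auto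
    then show ?thesis
      by (simp add: V.sum_bary)
  qed
  define a where "a b = (\<Sum>v\<in>verts T. (m v \<bullet> b) * (\<phi>h v - \<phi> x0))" for b
  have a: "\<bar>a b\<bar> \<le> (real DIM('a) + 1) * ((c2 * \<tau> + c) / \<rho>)" if b: "b \<in> Basis" for b
  proof -
    have "\<bar>a b\<bar> \<le> (\<Sum>v\<in>verts T. (c2 * \<tau> + c) / \<rho>)"
      unfolding a_def
    proof (rule order_trans[OF sum_abs sum_mono])
      fix v assume "v \<in> verts T"
      then have v: "v \<in> T"
        using verts_subset[OF T(1)] by auto
      have "\<bar>\<phi> v - \<phi> x0\<bar> \<le> c2 * norm (v - x0)"
        by (rule phi_lipschitz[OF full_mesh_convex[OF mesh T(1)] T(2) v x0])
      also have "\<dots> \<le> c2 * (\<tau> * h)"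
        using elem_dist[OF T(1) v x0] c2 by (intro mult_left_mono) (auto simp: dist_norm)
      finally have 1: "\<bar>\<phi> v - \<phi> x0\<bar> \<le> c2 * \<tau> * h"
        by simp
      have "\<bar>\<phi>h v - \<phi> v\<bar> \<le> c * h ^ (k + 1)"
        by (rule fe_error[OF T v])
      also have "\<dots> \<le> c * h ^ 1"
        using c h by (intro mult_left_mono power_decreasing) auto
      finally have "\<bar>\<phi>h v - \<phi> x0\<bar> \<le> (c2 * \<tau> + c) * h"
        using 1 by (simp add: distrib_right)
      then have "\<bar>m v \<bullet> b\<bar> * \<bar>\<phi>h v - \<phi> x0\<bar> \<le> 1 / (\<rho> * h) * ((c2 * \<tau> + c) * h)"
        using mb[OF b, of v] \<rho> h by (intro mult_mono) auto
      also have "\<dots> = (c2 * \<tau> + c) / \<rho>"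
        using h by simp
      finally show "\<bar>(m v \<bullet> b) * (\<phi>h v - \<phi> x0)\<bar> \<le> (c2 * \<tau> + c) / \<rho>"
        by (simp add: abs_mult)
    qed
    also have "\<dots> = (real DIM('a) + 1) * ((c2 * \<tau> + c) / \<rho>)"
      using full_mesh_card[OF mesh T(1)] by (simp add: algebra_simps)
    finally show ?thesis .
  qed
  have eq: "elem_interp 1 T \<phi>h x = nodal_interp 1 S \<phi>h x0 + (\<Sum>b\<in>Basis. a b * ((x - x0) \<bullet> b))" for x
  proof -
    have "elem_interp 1 T \<phi>h x = (\<Sum>v\<in>verts T. (bary (verts T) v x0 + m v \<bullet> (x - x0)) * \<phi>h v)"
      unfolding elem_interp_1[OF mesh T(1)] real_scaleR_def
      by (intro sum.cong refl arg_cong2[of _ _ _ _ times] m)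
    also have "\<dots> = nodal_interp 1 S \<phi>h x0 + (\<Sum>v\<in>verts T. (m v \<bullet> (x - x0)) * \<phi>h v)"
      by (simp only: interp_sum[OF T(1) x0] distrib_right sum.distrib)
    also have "(\<Sum>v\<in>verts T. (m v \<bullet> (x - x0)) * \<phi>h v)
        = (\<Sum>v\<in>verts T. (m v \<bullet> (x - x0)) * (\<phi>h v - \<phi> x0))"
      using msum[of "x - x0"]
      by (simp add: right_diff_distrib sum_subtractf sum_distrib_right[symmetric])
    also have "\<dots> = (\<Sum>v\<in>verts T. \<Sum>b\<in>Basis. (m v \<bullet> b) * (\<phi>h v - \<phi> x0) * ((x - x0) \<bullet> b))"
      by (intro sum.cong refl) (subst euclidean_inner, simp add: sum_distrib_left sum_distrib_right mult_ac)
    also have "\<dots> = (\<Sum>b\<in>Basis. a b * ((x - x0) \<bullet> b))"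
      unfolding a_def by (subst sum.swap) (simp only: sum_distrib_right)
    finally show ?thesis .
  qed
  have "bpoly x0 1 (M + (cH * \<tau>\<^sup>2 + c) + (\<Sum>b\<in>(Basis :: 'a set). (real DIM('a) + 1) * ((c2 * \<tau> + c) / \<rho>)))
    (\<lambda>x. nodal_interp 1 S \<phi>h x0 + (\<Sum>b\<in>Basis. a b * ((x - x0) \<bullet> b)))"
  proof (intro bpoly_add bpoly_const bpoly_sum finite_Basis)
    have "(cH * \<tau>\<^sup>2 + c) * h\<^sup>2 \<le> cH * \<tau>\<^sup>2 + c"
      using cH c h by (intro mult_left_le) (auto simp: power_le_one)
    with interp_error[OF T x0] have "\<bar>nodal_interp 1 S \<phi>h x0 - \<phi> x0\<bar> \<le> cH * \<tau>\<^sup>2 + c"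
      by (rule order_trans)
    then show "\<bar>nodal_interp 1 S \<phi>h x0\<bar> \<le> M + (cH * \<tau>\<^sup>2 + c)"
      using M by linarith
    fix b :: 'a assume b: "b \<in> Basis"
    show "bpoly x0 1 ((real DIM('a) + 1) * ((c2 * \<tau> + c) / \<rho>)) (\<lambda>x. a b * ((x - x0) \<bullet> b))"
      using bpoly_cmult[OF bpoly_coord[OF b, of 1 x0] a[OF b]] by simp
  qed
  then show ?thesis
    by (simp only: eq[abs_def, symmetric] sum_constant)
qed

end

section \<open>The isoparametric mapping\<close>

lemma mean_close:
  fixes v :: "'i \<Rightarrow> 'b::real_normed_vector"
  assumes "finite I" "I \<noteq> {}" "\<And>i. i \<in> I \<Longrightarrow> norm (v i - w) \<le> e"
  shows "norm ((\<Sum>i\<in>I. v i) /\<^sub>R real (card I) - w) \<le> e"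
proof -
  have card: "real (card I) > 0"
    using assms by (simp add: card_gt_0_iff)
  have "(\<Sum>i\<in>I. v i) /\<^sub>R real (card I) - w = (\<Sum>i\<in>I. v i - w) /\<^sub>R real (card I)"
    using card by (simp add: sum_subtractf scaleR_diff_right sum_constant_scaleR)
  also have "norm \<dots> = norm (\<Sum>i\<in>I. v i - w) / real (card I)"
    using card by (simp add: divide_inverse mult.commute)
  also have "\<dots> \<le> (real (card I) * e) / real (card I)"
    using card assms sum_norm_bound[of I "\<lambda>i. v i - w" e] by (intro divide_right_mono) auto
  finally show ?thesis
    using card by simp
qed

lemma node_mean_close:
  assumes "finite S" "T \<in> S" "x \<in> lagrange_nodes k T"
    and "\<And>T'. T' \<in> S \<Longrightarrow> x \<in> lagrange_nodes k T' \<Longrightarrow> norm (v T' x - w) \<le> e"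
  shows "norm (node_mean k S v x - w) \<le> e"
  unfolding node_mean_def using assms by (intro mean_close) auto

text \<open>Closedness makes the minimum attained among the solutions of modulus at most
  \<open>D\<close>, so that \<open>arg_min\<close> is a genuine solution instead of an unspecified
  value.\<close>

lemma arg_min_abs_props:
  fixes P :: "real \<Rightarrow> bool"
  assumes d: "P d" "\<bar>d\<bar> \<le> D" and closed: "closed {d. P d}"
  shows "P (arg_min abs P)" "\<bar>arg_min abs P\<bar> \<le> D"
proof -
  have "compact ({d. P d} \<inter> {- D..D})"
    by (intro closed_Int_compact closed compact_Icc)
  moreover have "d \<in> {d. P d} \<inter> {- D..D}"
    using d by auto
  moreover have "continuous_on ({d. P d} \<inter> {- D..D}) (\<lambda>e. \<bar>e\<bar>)"
    by (intro continuous_intros)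
  ultimately obtain e where e: "e \<in> {d. P d} \<inter> {- D..D}"
    "\<And>y. y \<in> {d. P d} \<inter> {- D..D} \<Longrightarrow> \<bar>e\<bar> \<le> \<bar>y\<bar>"
    using continuous_attains_inf[of "{d. P d} \<inter> {- D..D}" "\<lambda>e. \<bar>e\<bar>"] by blast
  have "is_arg_min abs P e"
    unfolding is_arg_min_def
  proof (intro conjI notI)
    show "P e"
      using e by simp
    assume "\<exists>y. P y \<and> \<bar>y\<bar> < \<bar>e\<bar>"
    then obtain y where "P y" "\<bar>y\<bar> < \<bar>e\<bar>"
      by blast
    moreover have "\<bar>e\<bar> \<le> D"
      using e(1) by (simp add: abs_le_iff)
    ultimately have "\<bar>y\<bar> \<le> D"
      by linarith
    then have "y \<in> {d. P d} \<inter> {- D..D}"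
      using \<open>P y\<close> by (simp add: abs_le_iff)
    from e(2)[OF this] \<open>\<bar>y\<bar> < \<bar>e\<bar>\<close> show False
      by simp
  qed
  then have "is_arg_min abs P (arg_min abs P)"
    unfolding arg_min_def by (rule someI)
  then have *: "P (arg_min abs P)" "\<bar>arg_min abs P\<bar> \<le> \<bar>d\<bar>"
    using d(1) unfolding is_arg_min_def by (auto simp: not_less)
  then show "P (arg_min abs P)" "\<bar>arg_min abs P\<bar> \<le> D"
    using d(2) by auto
qed

text \<open>All constants are parameters: they must not depend on the mesh. The exact mapping moves \<open>x\<close>
  by \<open>d x *\<^sub>R gradient \<phi> x\<close>; \<open>C4\<close> bounds the error of its polynomial approximation on an
  element and \<open>D\<close> the step lengths relative to \<open>h\<^sup>2\<close>.\<close>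

locale level_set_cut =
  level_set_nbhd \<phi> U k c1 c2 cH A r M + level_set_mesh \<phi> U k c1 c2 cH S h \<rho> \<tau> c \<phi>h
  for \<phi> :: "'a::euclidean_space \<Rightarrow> real" and U k c1 c2 cH A r M S h \<rho> \<tau> c \<phi>h +
  fixes CP CT C1 C2 C3 C4 C5 D :: real
  assumes CT: "CT \<ge> 0" and taylor: "\<And>x0. x0 \<in> A \<Longrightarrow> \<exists>P g. taylor_data CP CT x0 P g"
    and C1: "C1 = M + C2 + real DIM('a) * ((real DIM('a) + 1) * ((c2 * \<tau> + c) / \<rho>))"
    and C2: "C2 = cH * \<tau>\<^sup>2 + c"
    and C3: "C3 = growth_const TYPE('a) k 1 * (c + CT * \<tau> ^ (k + 1)) + CT * \<rho> ^ (k + 1)"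
    and C4: "C4 \<ge> 0"
    and D: "D = C4 + 4 * (C2 + C3) / c1\<^sup>2"
    and C5: "C5 = growth_const TYPE('a) k 0 * (comparison_const * (C3 + C4 + D * (real DIM('a) * c)) + C4) + C4"
    and approx: "\<And>x0 l T. admissible \<tau> C1 C2 h x0 l T \<Longrightarrow> \<exists>Y d. poly_deg_le k Y \<and> (\<forall>x\<in>T. \<bar>d x\<bar> \<le> C4 * h\<^sup>2 \<and>
      norm (Y x - (x + d x *\<^sub>R gradient \<phi> x)) \<le> C4 * h ^ (k + 1) \<and>
      \<bar>\<phi> (x + d x *\<^sub>R gradient \<phi> x) - l x\<bar> \<le> C4 * h ^ (k + 1))"
    and cut_A: "\<And>T. T \<in> cut_elements S \<phi>h \<Longrightarrow> T \<subseteq> A"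
    and small: "(\<tau> + \<rho>) * h \<le> r" "2 * \<rho> * h \<le> r" "real DIM('a) * c * h \<le> c1 / 4" "4 * cH * \<rho> * h \<le> c1"
      "D * (2 * c2) * h \<le> \<rho>" "2 * C5 * h \<le> \<rho>" "2 * (c2 * C5 + C4) * h \<le> c1 * \<rho>"
begin

abbreviation "cuts \<equiv> cut_elements S \<phi>h"
abbreviation "\<phi>lin \<equiv> nodal_interp 1 S \<phi>h"

lemma cut_mesh: "full_mesh cuts"
  using mesh by (rule full_mesh_subset) (auto simp: cut_elements_def)

lemma cut_elem: "T \<in> cuts \<Longrightarrow> T \<in> S" "T \<in> cuts \<Longrightarrow> T \<subseteq> U"
  using cut_A A_subset by (auto simp: cut_elements_def)

lemma nodes_in: "T \<in> S \<Longrightarrow> x \<in> lagrange_nodes k T \<Longrightarrow> x \<in> T"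
  using lagrange_nodes_subset[OF mesh _ k] by blast

lemma growth_const_nonneg: "a \<ge> 0 \<Longrightarrow> growth_const TYPE('a) k a \<ge> 0"
  by (simp add: growth_const_def)

lemma const_nonneg: "C2 \<ge> 0" "C3 \<ge> 0" "D \<ge> 0" "C5 \<ge> 0" "D \<ge> C4"
proof -
  show C2': "C2 \<ge> 0"
    using cH c by (simp add: C2)
  show C3': "C3 \<ge> 0"
    using growth_const_nonneg[of 1] c CT \<tau> \<rho> by (simp add: C3)
  show D4: "D \<ge> C4"
    using C2' C3' c1 by (simp add: D)
  then show D': "D \<ge> 0"
    using C4 by simp
  show "C5 \<ge> 0"
    unfolding C5 using growth_const_nonneg[of 0] comparison_const_pos C3' C4 D' c
    by (intro add_nonneg_nonneg mult_nonneg_nonneg) auto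
qed

lemma rho_ball: "x \<in> A \<Longrightarrow> cball x (\<rho> * h) \<subseteq> U" "x \<in> A \<Longrightarrow> cball x (2 * \<rho> * h) \<subseteq> U"
proof -
  have "\<rho> * h \<le> 2 * \<rho> * h"
    using \<rho> h by simp
  then show "x \<in> A \<Longrightarrow> cball x (\<rho> * h) \<subseteq> U" "x \<in> A \<Longrightarrow> cball x (2 * \<rho> * h) \<subseteq> U"
    using A small(2) by (meson order_trans subset_cball)+
qed

lemma step_small: "D * h\<^sup>2 * (2 * c2) \<le> \<rho> * h"
  using mult_right_mono[OF small(5), of h] h by (simp add: power2_eq_square mult_ac)

lemma pow_le: "h ^ (k + 1) \<le> h\<^sup>2"
  using h k by (intro power_decreasing) auto

text \<open>The extension and the Taylor polynomial \<open>P\<close> about \<open>x\<close> both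
  have degree at most \<open>k\<close>; their difference is small at the nodes, where both are close
  to \<phi>, and by \<open>poly_growth\<close> it remains small near the element.\<close>

lemma poly_ext_near:
  assumes T: "T \<in> S" "T \<subseteq> A" and x: "x \<in> T" and y: "dist x y \<le> \<rho> * h"
  shows "\<bar>poly_ext k T \<phi>h y - \<phi> y\<bar> \<le> C3 * h ^ (k + 1)"
proof -
  define p where "p = poly_ext k T \<phi>h"
  have p: "poly_deg_le k p" "\<And>x. x \<in> T \<Longrightarrow> p x = \<phi>h x"
    unfolding p_def using poly_ext_poly[OF mesh T(1) k fe] poly_ext_eq[OF mesh T(1) k fe] by auto
  have TU: "T \<subseteq> U"
    using T A_subset by auto
  have xA: "x \<in> A"
    using T x by auto
  then obtain P g where P: "taylor_data CP CT x P g"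
    using taylor by blast
  have "0 \<le> \<tau> * h" "0 \<le> \<rho> * h"
    using \<tau> \<rho> h by (intro mult_nonneg_nonneg; simp)+
  then have \<tau>r: "\<tau> * h \<le> r" and \<rho>r: "\<rho> * h \<le> r"
    using small(1) unfolding distrib_right by linarith+
  have "poly_deg_le k (\<lambda>y. p y + (-1) *\<^sub>R P y)"
    using p(1) P bpoly_poly_deg_le by (intro poly_deg_le_add poly_deg_le_scaleR) (auto simp: taylor_data_def)
  then have q: "poly_deg_le k (\<lambda>y. p y - P y)"
    by simp
  obtain z where z: "cball z (\<rho> * h) \<subseteq> T"
    using inball[OF T(1)] by blast
  have "norm (p y - P y) \<le> growth_const TYPE('a) k 1 * ((c + CT * \<tau> ^ (k + 1)) * h ^ (k + 1))"
  proof (rule poly_growth[OF mesh T(1) k q z _ x])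
    show "\<rho> * h > 0" "dist x y \<le> 1 * (\<rho> * h)"
      using \<rho> h y by auto
    fix v assume "v \<in> lagrange_nodes k T"
    then have v: "v \<in> T"
      using nodes_in[OF T(1)] by blast
    have d: "dist x v \<le> \<tau> * h"
      by (rule elem_dist[OF T(1) x v])
    then have "\<bar>\<phi> v - P v\<bar> \<le> CT * dist x v ^ Suc k"
      using P \<tau>r by (auto simp: taylor_data_def)
    also have "\<dots> \<le> CT * (\<tau> * h) ^ Suc k"
      using d CT by (intro mult_left_mono power_mono) auto
    also have "\<dots> = CT * \<tau> ^ (k + 1) * h ^ (k + 1)"
      by (simp add: power_mult_distrib)
    finally show "norm (p v - P v) \<le> (c + CT * \<tau> ^ (k + 1)) * h ^ (k + 1)"
      using fe_error[OF T(1) TU v] p(2)[OF v] unfolding distrib_right real_norm_def by linarith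
  qed
  moreover have "\<bar>\<phi> y - P y\<bar> \<le> CT * \<rho> ^ (k + 1) * h ^ (k + 1)"
  proof -
    have "\<bar>\<phi> y - P y\<bar> \<le> CT * dist x y ^ Suc k"
      using P \<rho>r y by (auto simp: taylor_data_def)
    also have "\<dots> \<le> CT * (\<rho> * h) ^ Suc k"
      using y CT by (intro mult_left_mono power_mono) auto
    finally show ?thesis
      by (simp add: power_mult_distrib mult_ac)
  qed
  ultimately show ?thesis
    unfolding C3 p_def[symmetric] distrib_right real_norm_def mult.assoc by linarith
qed

context
  fixes T x G
  assumes T: "T \<in> cuts" and x: "x \<in> T"
    and G: "norm (G T x - gradient \<phi> x) \<le> real DIM('a) * c * h ^ k"
begin

lemma direction_small: "real DIM('a) * c * h ^ k \<le> c1 / 4"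
proof -
  have "real DIM('a) * c * h ^ k \<le> real DIM('a) * c * h ^ 1"
    using c h k by (intro mult_left_mono power_decreasing) auto
  also have "\<dots> \<le> c1 / 4"
    using small(3) by (simp only: power_one_right)
  finally show ?thesis .
qed

lemma x_in: "x \<in> A" "x \<in> U" "T \<in> S" "T \<subseteq> U"
  using cut_A[OF T] x A_subset cut_elem[OF T] by auto

text \<open>At the two ends \<open>t = e\<close> and \<open>t = - e\<close> the extension lies on
  opposite sides of the level \<open>\<phi>lin x\<close>, which yields a solution of size at most
  \<open>e\<close>; minimality passes the bound on to \<open>d_h\<close>.\<close>

lemma d_h_props:
  "\<bar>d_h k S \<phi>h G T x\<bar> \<le> D * h\<^sup>2"
  "poly_ext k T \<phi>h (x + d_h k S \<phi>h G T x *\<^sub>R G T x) = \<phi>lin x"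
proof -
  define p where "p = poly_ext k T \<phi>h"
  define g where "g = gradient \<phi> x"
  define e where "e = D * h\<^sup>2"
  have p_cont: "continuous_on A p" for A
    unfolding p_def by (rule poly_deg_le_continuous_on[OF poly_ext_poly[OF mesh x_in(3) k fe]])
  have G4: "norm (G T x - gradient \<phi> x) \<le> c1 / 4"
    using G direction_small by (rule order_trans)
  have e: "e \<ge> 0" "e * (2 * c2) \<le> \<rho> * h"
    using const_nonneg step_small by (auto simp: e_def)
  have main: "\<bar>p (x + t *\<^sub>R G T x) - \<phi>lin x - t * (g \<bullet> G T x)\<bar>
      \<le> 5 / 16 * (norm g)\<^sup>2 * e + (C2 + C3) * h\<^sup>2" if t: "\<bar>t\<bar> = e" for t
  proof -
    have "\<bar>\<phi> (x + t *\<^sub>R G T x) - \<phi> (x + 0 *\<^sub>R G T x) - (t - 0) * (g \<bullet> G T x)\<bar>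
        \<le> 5 / 16 * (norm g)\<^sup>2 * \<bar>t - 0\<bar>"
      unfolding g_def using \<rho> h e t small(4)
      by (intro line_expansion[OF rho_ball(1)[OF x_in(1)] _ _ G4]) (auto simp: mult.assoc)
    then have "\<bar>\<phi> (x + t *\<^sub>R G T x) - \<phi> x - t * (g \<bullet> G T x)\<bar> \<le> 5 / 16 * (norm g)\<^sup>2 * e"
      using t by simp
    moreover have "\<bar>p (x + t *\<^sub>R G T x) - \<phi> (x + t *\<^sub>R G T x)\<bar> \<le> C3 * h ^ (k + 1)"
      unfolding p_def
    proof (rule poly_ext_near[OF x_in(3) cut_A[OF T] x])
      have "\<bar>t\<bar> * norm (G T x) \<le> e * (2 * c2)"
        using t e direction_bounds(1)[OF G4 x_in(2)] by (intro mult_mono) auto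
      then show "dist x (x + t *\<^sub>R G T x) \<le> \<rho> * h"
        using e by (simp add: dist_norm)
    qed
    moreover have "C3 * h ^ (k + 1) \<le> C3 * h\<^sup>2"
      using pow_le const_nonneg by (intro mult_left_mono)
    moreover have "\<bar>\<phi>lin x - \<phi> x\<bar> \<le> C2 * h\<^sup>2"
      using interp_error[OF x_in(3,4) x] by (simp add: C2)
    ultimately show ?thesis
      unfolding distrib_right by linarith
  qed
  \<comment> \<open>The summand \<open>4 * (C2 + C3) / c1\<^sup>2\<close> of \<open>D\<close> is
    made for this; \<open>7 / 16\<close> here and \<open>5 / 16\<close> from \<open>main\<close> add
    up to the slope \<open>3 / 4\<close> along \<open>G\<close>.\<close>
  have "(C2 + C3) * h\<^sup>2 \<le> 7 / 16 * (norm g)\<^sup>2 * e"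
  proof -
    have "(C2 + C3) \<le> 1 / 4 * c1\<^sup>2 * D"
      using C4 c1 by (simp add: D field_simps)
    then have "(C2 + C3) * h\<^sup>2 \<le> 1 / 4 * c1\<^sup>2 * D * h\<^sup>2"
      by (rule mult_right_mono) simp
    also have "\<dots> = 1 / 4 * c1\<^sup>2 * e"
      by (simp add: e_def)
    also have "\<dots> \<le> 7 / 16 * (norm g)\<^sup>2 * e"
      using grad_lower[OF x_in(2)] c1 e power_mono[of c1 "norm g" 2]
      by (intro mult_right_mono mult_mono) (auto simp: g_def)
    finally show ?thesis .
  qed
  moreover have "3 / 4 * (norm g)\<^sup>2 * e \<le> e * (g \<bullet> G T x)"
    using mult_right_mono[OF direction_bounds(3)[OF G4 x_in(2)] e(1)] by (simp add: g_def mult.commute)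
  ultimately have up: "\<phi>lin x \<le> p (x + e *\<^sub>R G T x)" and down: "p (x + (- e) *\<^sub>R G T x) \<le> \<phi>lin x"
    using main[of e] main[of "- e"] e(1) by (auto simp: abs_le_iff)
  have cont: "continuous_on A (\<lambda>t. p (x + t *\<^sub>R G T x))" for A
    by (intro continuous_on_compose2[OF p_cont[of UNIV]] continuous_intros) auto
  have "\<exists>t. - e \<le> t \<and> t \<le> e \<and> p (x + t *\<^sub>R G T x) = \<phi>lin x"
    using up down e by (intro IVT' cont) auto
  then obtain t where t: "p (x + t *\<^sub>R G T x) = \<phi>lin x" "\<bar>t\<bar> \<le> e"
    by (auto simp: abs_le_iff)
  have "closed {t. p (x + t *\<^sub>R G T x) = \<phi>lin x}"
    using continuous_closed_preimage_constant[OF cont[of UNIV] closed_UNIV] by simp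
  from arg_min_abs_props[OF t this]
  show "\<bar>d_h k S \<phi>h G T x\<bar> \<le> D * h\<^sup>2"
    "poly_ext k T \<phi>h (x + d_h k S \<phi>h G T x *\<^sub>R G T x) = \<phi>lin x"
    unfolding d_h_def p_def e_def by auto
qed

text \<open>\<open>compare_points\<close> applies with a level error of order
  \<open>h ^ (k + 1)\<close>; the direction error of order \<open>h ^ k\<close> meets a step of
  order \<open>h ^ 2\<close> and is absorbed. The two points may use different directions.\<close>

lemma Psi_h_close:
  assumes d: "\<bar>d\<bar> \<le> C4 * h\<^sup>2" "\<bar>\<phi> (x + d *\<^sub>R gradient \<phi> x) - \<phi>lin x\<bar> \<le> C4 * h ^ (k + 1)"
  shows "norm (Psi_h k S \<phi>h G T x - (x + d *\<^sub>R gradient \<phi> x))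
    \<le> comparison_const * (C3 + C4 + D * (real DIM('a) * c)) * h ^ (k + 1)"
proof -
  define t where "t = d_h k S \<phi>h G T x"
  have t: "\<bar>t\<bar> \<le> D * h\<^sup>2" "poly_ext k T \<phi>h (x + t *\<^sub>R G T x) = \<phi>lin x"
    unfolding t_def by (rule d_h_props)+
  have G4: "norm (G T x - gradient \<phi> x) \<le> c1 / 4"
    using G direction_small by (rule order_trans)
  have "\<bar>t\<bar> * norm (G T x) \<le> D * h\<^sup>2 * (2 * c2)"
    using t direction_bounds(1)[OF G4 x_in(2)] by (intro mult_mono) auto
  then have "dist x (x + t *\<^sub>R G T x) \<le> \<rho> * h"
    using step_small by (simp add: dist_norm)
  from poly_ext_near[OF x_in(3) cut_A[OF T] x this]
  have close: "\<bar>\<phi> (x + t *\<^sub>R G T x) - \<phi> (x + d *\<^sub>R gradient \<phi> x)\<bar> \<le> (C3 + C4) * h ^ (k + 1)"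
    using d(2) t(2) unfolding distrib_right by linarith
  have "D * h\<^sup>2 * (real DIM('a) * c * h ^ k) = D * (real DIM('a) * c) * h ^ (k + 2)"
    by (simp add: power_add power2_eq_square mult_ac)
  also have "\<dots> \<le> D * (real DIM('a) * c) * h ^ (k + 1)"
    using const_nonneg c h by (intro mult_left_mono power_decreasing mult_nonneg_nonneg) auto
  finally have 1: "(C3 + C4) * h ^ (k + 1) + D * h\<^sup>2 * (real DIM('a) * c * h ^ k)
      \<le> (C3 + C4 + D * (real DIM('a) * c)) * h ^ (k + 1)"
    by (simp only: distrib_right)
  have dD: "\<bar>d\<bar> \<le> D * h\<^sup>2"
    using d(1) const_nonneg(5) mult_right_mono[of C4 D "h\<^sup>2"] by simp
  have "norm ((x + t *\<^sub>R G T x) - (x + d *\<^sub>R gradient \<phi> x))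
      \<le> comparison_const * ((C3 + C4) * h ^ (k + 1) + D * h\<^sup>2 * (real DIM('a) * c * h ^ k))"
    using \<rho> h small(4)
    by (intro compare_points[OF rho_ball(1)[OF x_in(1)] _ _ G direction_small t(1) dD step_small close])
      (auto simp: mult.assoc)
  also have "\<dots> \<le> comparison_const * ((C3 + C4 + D * (real DIM('a) * c)) * h ^ (k + 1))"
    using 1 comparison_const_pos by (intro mult_left_mono) auto
  finally show ?thesis
    by (simp only: Psi_h_def t_def[symmetric] mult.assoc)
qed

end

text \<open>At a node the averaging returns the mean of elementwise gradients that all satisfy
  \<open>grad_error\<close>, so both choices of the direction obey one estimate. Nodes suffice
  because \<open>Theta_h\<close> is built from nodal values of \<open>Psi_h\<close>.\<close>

lemma search_direction_close:
  assumes G: "search_direction k S \<phi>h G" and T: "T \<in> cuts" and x: "x \<in> lagrange_nodes k T"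
  shows "norm (G T x - gradient \<phi> x) \<le> real DIM('a) * c * h ^ k"
proof -
  have elem: "norm (elem_gradient k \<phi>h T x - gradient \<phi> x) \<le> real DIM('a) * c * h ^ k"
    if "T \<in> cuts" "x \<in> lagrange_nodes k T" for T
    using grad_error[OF cut_elem[OF that(1)] nodes_in[OF cut_elem(1)[OF that(1)] that(2)]] .
  have "node_averaging k cuts v x = node_mean k cuts v x" for v :: "'a set \<Rightarrow> 'a \<Rightarrow> 'a"
    unfolding node_averaging_def
      nodal_interp_eq[OF cut_mesh k T nodes_in[OF cut_elem(1)[OF T] x]]
    by (rule elem_interp_node[OF cut_mesh T k x])
  moreover have "norm (node_mean k cuts (elem_gradient k \<phi>h) x - gradient \<phi> x) \<le> real DIM('a) * c * h ^ k"
    by (rule node_mean_close[OF full_mesh_finite[OF cut_mesh] T x]) (rule elem)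
  ultimately have "norm (node_averaging k cuts (elem_gradient k \<phi>h) x - gradient \<phi> x) \<le> real DIM('a) * c * h ^ k"
    by simp
  then show ?thesis
    using G elem[OF T x] unfolding search_direction_def by auto
qed

text \<open>On \<open>T\<close> the difference of \<open>Theta_h\<close> and the approximation
  \<open>Y\<close> is a polynomial of degree at most \<open>k\<close>, so its nodal values control
  it.\<close>

lemma Theta_h_close:
  assumes G: "search_direction k S \<phi>h G" and T: "T \<in> cuts" and x: "x \<in> T"
  shows "\<exists>d. \<bar>d\<bar> \<le> C4 * h\<^sup>2 \<and> \<bar>\<phi> (x + d *\<^sub>R gradient \<phi> x) - \<phi>lin x\<bar> \<le> C4 * h ^ (k + 1) \<and>
    norm (Theta_h k S \<phi>h G x - (x + d *\<^sub>R gradient \<phi> x)) \<le> C5 * h ^ (k + 1)"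
proof -
  note T' = cut_elem[OF T]
  have lin: "elem_interp 1 T \<phi>h y = \<phi>lin y" if "y \<in> T" for y
    using nodal_interp_eq[OF mesh _ T'(1) that, of 1 \<phi>h] by simp
  \<comment> \<open>The expansion is centred at the evaluated point \<open>x\<close> itself; the
    constants do not depend on it.\<close>
  have "admissible \<tau> C1 C2 h x (elem_interp 1 T \<phi>h) T"
    unfolding admissible_def
  proof (intro conjI ballI)
    show "x \<in> A"
      using cut_A[OF T] x by auto
    then have "\<bar>\<phi> x\<bar> \<le> M"
      using partials_bound[of x x "[]"] r by simp
    then show "bpoly x 1 C1 (elem_interp 1 T \<phi>h)"
      unfolding C1 C2 by (rule interp_bpoly[OF T' x])
    show "T \<subseteq> cball x (\<tau> * h)"
      using elem_dist[OF T'(1) x] by auto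
    show "\<bar>elem_interp 1 T \<phi>h y - \<phi> y\<bar> \<le> C2 * h\<^sup>2" if "y \<in> T" for y
      using interp_error[OF T' that] lin[OF that] by (simp add: C2)
  qed
  from approx[OF this] obtain Y d where Y: "poly_deg_le k Y"
    and d: "\<And>y. y \<in> T \<Longrightarrow> \<bar>d y\<bar> \<le> C4 * h\<^sup>2"
      "\<And>y. y \<in> T \<Longrightarrow> norm (Y y - (y + d y *\<^sub>R gradient \<phi> y)) \<le> C4 * h ^ (k + 1)"
      "\<And>y. y \<in> T \<Longrightarrow> \<bar>\<phi> (y + d y *\<^sub>R gradient \<phi> y) - \<phi>lin y\<bar> \<le> C4 * h ^ (k + 1)"
    using lin by (metis (no_types, lifting))
  define C6 where "C6 = comparison_const * (C3 + C4 + D * (real DIM('a) * c))"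
  define \<Theta> where "\<Theta> = elem_interp k T (node_mean k cuts (Psi_h k S \<phi>h G))"
  have \<Theta>: "Theta_h k S \<phi>h G y = \<Theta> y" if "y \<in> T" for y
    unfolding Theta_h_def node_averaging_def \<Theta>_def
    by (rule nodal_interp_eq[OF cut_mesh k T that])
  have "poly_deg_le k (\<lambda>y. \<Theta> y + (-1) *\<^sub>R Y y)"
    unfolding \<Theta>_def by (intro poly_deg_le_add poly_deg_le_scaleR Y poly_deg_le_elem_interp[OF cut_mesh T])
  then have q: "poly_deg_le k (\<lambda>y. \<Theta> y - Y y)"
    by simp
  obtain z where z: "cball z (\<rho> * h) \<subseteq> T"
    using inball[OF T'(1)] by blast
  have "norm (\<Theta> x - Y x) \<le> growth_const TYPE('a) k 0 * ((C6 + C4) * h ^ (k + 1))"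
  proof (rule poly_growth[OF mesh T'(1) k q z _ x])
    show "\<rho> * h > 0" "dist x x \<le> 0 * (\<rho> * h)"
      using \<rho> h by auto
    fix v assume v: "v \<in> lagrange_nodes k T"
    then have vT: "v \<in> T"
      using nodes_in[OF T'(1)] by blast
    have "\<Theta> v = node_mean k cuts (Psi_h k S \<phi>h G) v"
      unfolding \<Theta>_def by (rule elem_interp_node[OF cut_mesh T k v])
    moreover have "norm (node_mean k cuts (Psi_h k S \<phi>h G) v - (v + d v *\<^sub>R gradient \<phi> v)) \<le> C6 * h ^ (k + 1)"
    proof (rule node_mean_close[OF full_mesh_finite[OF cut_mesh] T v])
      \<comment> \<open>The step \<open>d v\<close> was obtained on \<open>T\<close> but is usable
        for every element with node \<open>v\<close>: its equation involves only \<phi> and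
        \<open>\<phi>lin v\<close>.\<close>
      fix T2 assume T2: "T2 \<in> cuts" "v \<in> lagrange_nodes k T2"
      show "norm (Psi_h k S \<phi>h G T2 v - (v + d v *\<^sub>R gradient \<phi> v)) \<le> C6 * h ^ (k + 1)"
        unfolding C6_def
        by (rule Psi_h_close[where G = G and T = T2 and x = v and d = "d v", OF T2(1) nodes_in[OF cut_elem(1)[OF T2(1)] T2(2)]
              search_direction_close[OF G T2] d(1)[OF vT] d(3)[OF vT]])
    qed
    ultimately have "norm (\<Theta> v - (v + d v *\<^sub>R gradient \<phi> v)) \<le> C6 * h ^ (k + 1)"
      by simp
    then show "norm (\<Theta> v - Y v) \<le> (C6 + C4) * h ^ (k + 1)"
      using d(2)[OF vT] norm_triangle_ineq4[of "\<Theta> v - (v + d v *\<^sub>R gradient \<phi> v)" "Y v - (v + d v *\<^sub>R gradient \<phi> v)"]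
      by (simp add: distrib_right)
  qed
  moreover have "norm (\<Theta> x - (x + d x *\<^sub>R gradient \<phi> x))
      \<le> norm (\<Theta> x - Y x) + norm (Y x - (x + d x *\<^sub>R gradient \<phi> x))"
    by (rule norm_diff_triangle_le[OF order_refl order_refl])
  moreover have "C5 * h ^ (k + 1)
      = growth_const TYPE('a) k 0 * ((C6 + C4) * h ^ (k + 1)) + C4 * h ^ (k + 1)"
    by (simp add: C5 C6_def algebra_simps)
  ultimately have "norm (\<Theta> x - (x + d x *\<^sub>R gradient \<phi> x)) \<le> C5 * h ^ (k + 1)"
    using d(2)[OF x] by linarith
  then show ?thesis
    using d(1,3)[OF x] \<Theta>[OF x] by (intro exI[of _ "d x"]) simp
qed

section \<open>The two one-sided distances\<close>

lemma Gamma_lin_elem: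
  assumes "x \<in> Gamma_lin S \<phi>h"
  obtains T where "T \<in> cuts" "x \<in> T" "\<phi>lin x = 0"
  using assms that unfolding Gamma_lin_def cut_elements_def by blast

text \<open>As \<open>\<phi>lin x = 0\<close>, the value of \<phi> at \<open>w\<close> is of order
  \<open>h ^ (k + 1)\<close>; the Lipschitz bound carries this over to \<open>y\<close>, and
  \<open>zero_near\<close> turns it into a distance.\<close>

lemma Gamma_h_near_zero:
  assumes G: "search_direction k S \<phi>h G" and y: "y \<in> Gamma_h k S \<phi>h G"
  shows "\<exists>z\<in>U. \<phi> z = 0 \<and> dist y z \<le> 2 * (c2 * C5 + C4) / c1 * h ^ (k + 1)"
proof -
  obtain x where x: "x \<in> Gamma_lin S \<phi>h" "y = Theta_h k S \<phi>h G x"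
    using y by (auto simp: Gamma_h_def)
  then obtain T where T: "T \<in> cuts" "x \<in> T" "\<phi>lin x = 0"
    by (elim Gamma_lin_elem)
  obtain d where d: "\<bar>d\<bar> \<le> C4 * h\<^sup>2" "\<bar>\<phi> (x + d *\<^sub>R gradient \<phi> x)\<bar> \<le> C4 * h ^ (k + 1)"
    "norm (y - (x + d *\<^sub>R gradient \<phi> x)) \<le> C5 * h ^ (k + 1)"
    using Theta_h_close[OF G T(1,2)] T(3) x(2) by auto
  define w where "w = x + d *\<^sub>R gradient \<phi> x"
  have xA: "x \<in> A" and xU: "x \<in> U"
    using cut_A[OF T(1)] T(2) A_subset by auto
  have "\<bar>d\<bar> * norm (gradient \<phi> x) \<le> (D * h\<^sup>2) * c2"
  proof (rule mult_mono)
    show "\<bar>d\<bar> \<le> D * h\<^sup>2"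
      using d(1) const_nonneg(5) mult_right_mono[of C4 D "h\<^sup>2"] by simp
  qed (use grad_upper[OF xU] const_nonneg in auto)
  also have "\<dots> \<le> \<rho> * h / 2"
    using step_small by simp
  finally have wx: "dist x w \<le> \<rho> * h / 2"
    by (simp add: w_def dist_norm)
  have "C5 * h ^ (k + 1) \<le> C5 * h\<^sup>2"
    using pow_le const_nonneg by (intro mult_left_mono)
  also have "\<dots> \<le> \<rho> * h / 2"
    using mult_right_mono[OF small(6), of h] h by (simp add: power2_eq_square mult_ac)
  finally have "dist w y \<le> \<rho> * h / 2"
    using d(3) by (simp add: w_def dist_norm norm_minus_commute)
  with wx have yx: "dist x y \<le> \<rho> * h"
    using dist_triangle[of x y w] by simp
  have "w \<in> cball x (\<rho> * h)"
    using wx mult_pos_pos[OF \<rho> h(1)] unfolding mem_cball by linarith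
  then have "\<bar>\<phi> y - \<phi> w\<bar> \<le> c2 * norm (y - w)"
    using yx by (intro phi_lipschitz[OF convex_cball rho_ball(1)[OF xA]]) auto
  also have "\<dots> \<le> c2 * (C5 * h ^ (k + 1))"
    using d(3) c2 by (intro mult_left_mono) (auto simp: w_def)
  finally have \<phi>y: "\<bar>\<phi> y\<bar> \<le> (c2 * C5 + C4) * h ^ (k + 1)"
    using d(2) by (simp add: w_def distrib_right mult.assoc)
  have sub: "cball y (\<rho> * h) \<subseteq> U"
  proof -
    have "cball y (\<rho> * h) \<subseteq> cball x (2 * \<rho> * h)"
    proof
      fix v assume "v \<in> cball y (\<rho> * h)"
      then show "v \<in> cball x (2 * \<rho> * h)"
        using yx dist_triangle[of x v y] by simp
    qed
    then show ?thesis
      using rho_ball(2)[OF xA] by blast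
  qed
  define \<epsilon> where "\<epsilon> = (c2 * C5 + C4) * h ^ (k + 1)"
  have \<epsilon>: "2 * \<epsilon> \<le> c1 * (\<rho> * h)"
  proof -
    have "2 * \<epsilon> \<le> 2 * ((c2 * C5 + C4) * h\<^sup>2)"
      unfolding \<epsilon>_def using pow_le const_nonneg c2 C4 by (intro mult_left_mono) auto
    also have "\<dots> \<le> c1 * (\<rho> * h)"
      using mult_right_mono[OF small(7), of h] h by (simp add: power2_eq_square mult_ac)
    finally show ?thesis .
  qed
  have "\<exists>z\<in>cball y (2 * \<epsilon> / c1). \<phi> z = 0"
  proof (rule zero_near[OF sub])
    have "0 \<le> cH * (\<rho> * h)"
      using cH \<rho> h by simp
    then show "2 * cH * (\<rho> * h) \<le> c1"
      using small(4) by (simp add: mult.assoc)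
  qed (use \<phi>y \<epsilon> in \<open>auto simp: \<epsilon>_def\<close>)
  then obtain z where z: "dist y z \<le> 2 * \<epsilon> / c1" "\<phi> z = 0"
    by auto
  have "2 * \<epsilon> / c1 \<le> \<rho> * h"
    using \<epsilon> c1 by (simp add: field_simps)
  then have "z \<in> U"
    using z(1) sub by auto
  moreover have "2 * \<epsilon> / c1 = 2 * (c2 * C5 + C4) / c1 * h ^ (k + 1)"
    by (simp add: \<epsilon>_def)
  ultimately show ?thesis
    using z by auto
qed

text \<open>The curve \<open>\<xi> s\<close> of points that the exact mapping would move to \<open>z\<close> with step \<open>s\<close> is found by a
  contraction; a sign change of the linear interpolant along it gives the preimage of \<open>z\<close>.\<close>

lemma zero_near_Gamma_h:
  assumes G: "search_direction k S \<phi>h G" and z: "z \<in> A" "\<phi> z = 0"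
  shows "\<exists>y\<in>Gamma_h k S \<phi>h G. dist z y \<le> (C5 + comparison_const * C4) * h ^ (k + 1)"
proof -
  define e where "e = D * h\<^sup>2"
  define B where "B = cball z (\<rho> * h)"
  have B: "B \<subseteq> U" "convex B" "complete B" "B \<noteq> {}" "z \<in> B"
    using rho_ball(1)[OF z(1)] less_imp_le[OF mult_pos_pos[OF \<rho> h(1)]]
    by (auto simp: B_def complete_eq_closed simp del: zero_le_mult_iff)
  have zU: "z \<in> U"
    using A_subset[OF z(1)] .
  have c12: "c1 \<le> c2"
    using grad_lower[OF zU] grad_upper[OF zU] by simp
  have e: "0 \<le> e" "e * c2 \<le> \<rho> * h / 2"
    using step_small const_nonneg by (auto simp: e_def)
  \<comment> \<open>Makes the displacement by a step of length at most \<open>e\<close> a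
    contraction with factor \<open>1 / 2\<close> on \<open>B\<close>.\<close>
  have e_cH: "e * cH \<le> 1 / 2"
  proof -
    have "(e * c2) * cH \<le> (\<rho> * h / 2) * cH"
      using e cH by (intro mult_right_mono) auto
    also have "\<dots> \<le> c1 / 8"
      using small(4) by (simp add: mult_ac)
    also have "\<dots> \<le> c2 / 2"
      using c12 c2 by simp
    finally show ?thesis
      using c2 by (simp add: field_simps)
  qed
  have contr: "norm (s *\<^sub>R gradient \<phi> x - s *\<^sub>R gradient \<phi> y) \<le> 1 / 2 * norm (x - y)"
    if "\<bar>s\<bar> \<le> e" "x \<in> B" "y \<in> B" for s x y
  proof -
    have "norm (s *\<^sub>R gradient \<phi> x - s *\<^sub>R gradient \<phi> y) \<le> e * (cH * norm (x - y))"
      unfolding scaleR_diff_right[symmetric] norm_scaleR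
      using that grad_lipschitz[OF B(2,1) that(2,3)] e by (intro mult_mono) auto
    also have "\<dots> \<le> 1 / 2 * norm (x - y)"
      using mult_right_mono[OF e_cH, of "norm (x - y)"] by (simp add: mult.assoc)
    finally show ?thesis .
  qed
  have "\<exists>x\<in>B. x + s *\<^sub>R gradient \<phi> x = z" if s: "\<bar>s\<bar> \<le> e" for s
  proof -
    have "\<exists>!x\<in>B. z - s *\<^sub>R gradient \<phi> x = x"
    proof (rule Banach_fix[OF B(3,4), of "1 / 2"])
      show "(\<lambda>x. z - s *\<^sub>R gradient \<phi> x) ` B \<subseteq> B"
      proof (rule image_subsetI)
        fix x assume x: "x \<in> B"
        have "norm (s *\<^sub>R gradient \<phi> x) \<le> e * c2"
          unfolding norm_scaleR using s grad_upper[of x] x B(1) e(1) by (intro mult_mono) auto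
        then show "z - s *\<^sub>R gradient \<phi> x \<in> B"
          using e mult_pos_pos[OF \<rho> h(1)] by (simp add: B_def dist_norm)
      qed
      show "dist (z - s *\<^sub>R gradient \<phi> x) (z - s *\<^sub>R gradient \<phi> y) \<le> 1 / 2 * dist x y"
        if "x \<in> B" "y \<in> B" for x y
        using contr[OF s that] by (simp add: dist_norm norm_minus_commute)
    qed auto
    then show ?thesis
      by (metis diff_add_cancel)
  qed
  then obtain \<xi> where \<xi>: "\<And>s. \<bar>s\<bar> \<le> e \<Longrightarrow> \<xi> s \<in> B" "\<And>s. \<bar>s\<bar> \<le> e \<Longrightarrow> \<xi> s + s *\<^sub>R gradient \<phi> (\<xi> s) = z"
    by metis
  have \<xi>_lip: "norm (\<xi> s - \<xi> t) \<le> 2 * c2 * \<bar>s - t\<bar>" if st: "\<bar>s\<bar> \<le> e" "\<bar>t\<bar> \<le> e" for s t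
  proof -
    \<comment> \<open>With the same step \<open>t\<close> at both points split off,
      \<open>contr\<close> absorbs half of the left-hand side.\<close>
    have "\<xi> s - \<xi> t = (t *\<^sub>R gradient \<phi> (\<xi> t) - t *\<^sub>R gradient \<phi> (\<xi> s)) + (t - s) *\<^sub>R gradient \<phi> (\<xi> s)"
    proof -
      have "\<xi> s = z - s *\<^sub>R gradient \<phi> (\<xi> s)" "\<xi> t = z - t *\<^sub>R gradient \<phi> (\<xi> t)"
        using \<xi>(2)[OF st(1)] \<xi>(2)[OF st(2)] by (metis add_diff_cancel_right')+
      then have "\<xi> s - \<xi> t = t *\<^sub>R gradient \<phi> (\<xi> t) - s *\<^sub>R gradient \<phi> (\<xi> s)"
        by (metis add_diff_cancel_left diff_diff_eq2 diff_add_cancel minus_diff_eq add.commute diff_diff_add)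
      then show ?thesis
        by (simp add: scaleR_diff_left)
    qed
    then have "norm (\<xi> s - \<xi> t) \<le> norm (t *\<^sub>R gradient \<phi> (\<xi> t) - t *\<^sub>R gradient \<phi> (\<xi> s))
        + norm ((t - s) *\<^sub>R gradient \<phi> (\<xi> s))"
      by (metis norm_triangle_ineq)
    also have "norm (t *\<^sub>R gradient \<phi> (\<xi> t) - t *\<^sub>R gradient \<phi> (\<xi> s)) \<le> 1 / 2 * norm (\<xi> s - \<xi> t)"
      using contr[OF st(2) \<xi>(1)[OF st(2)] \<xi>(1)[OF st(1)]] by (simp add: norm_minus_commute)
    also have "norm ((t - s) *\<^sub>R gradient \<phi> (\<xi> s)) \<le> \<bar>s - t\<bar> * c2"
      unfolding norm_scaleR using grad_upper[of "\<xi> s"] \<xi>(1)[OF st(1)] B(1)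
      by (intro mult_mono) (auto simp: abs_minus_commute)
    finally show ?thesis
      by (simp add: mult_ac)
  qed
  have \<xi>_cont: "continuous_on {- e..e} \<xi>"
  proof (rule lipschitz_on_continuous_on[of "2 * c2"])
    show "lipschitz_on (2 * c2) {- e..e} \<xi>"
      using \<xi>_lip c2 by (intro lipschitz_onI) (auto simp: dist_norm abs_le_iff)
  qed
  \<comment> \<open>The element containing \<open>x\<close> is not yet known to be cut;
    \<open>(\<tau> + \<rho>) * h \<le> r\<close> keeps it in the ball of radius \<open>r\<close>
    about \<open>z\<close>, hence in \<open>U\<close>.\<close>
  have lin_err: "\<bar>\<phi>lin x - \<phi> x\<bar> \<le> C2 * h\<^sup>2" if x: "x \<in> B" for x
  proof -
    obtain T where T: "T \<in> S" "x \<in> T"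
      using x B(1) U_mesh by blast
    have "T \<subseteq> cball z r"
    proof
      fix y assume "y \<in> T"
      then have "dist x y \<le> \<tau> * h"
        by (rule elem_dist[OF T])
      then show "y \<in> cball z r"
        using x small(1) dist_triangle[of z y x] by (simp add: B_def distrib_right)
    qed
    then have "T \<subseteq> U"
      using A[OF z(1)] by blast
    then show ?thesis
      using interp_error[OF T(1) _ T(2)] by (simp add: C2)
  qed
  \<comment> \<open>The step \<open>s\<close> leads from \<open>\<xi> s\<close> to \<open>z\<close>,
    where \<phi> vanishes, so \<phi> at \<open>\<xi> s\<close> is about \<open>- s\<close> times the
    squared gradient norm.\<close>
  have val: "\<bar>\<phi> (\<xi> s) + s * (norm (gradient \<phi> (\<xi> s)))\<^sup>2\<bar> \<le> 5 / 16 * (norm (gradient \<phi> (\<xi> s)))\<^sup>2 * \<bar>s\<bar>"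
    if s: "\<bar>s\<bar> \<le> e" for s
  proof -
    define x where "x = \<xi> s"
    have x: "x \<in> B" "x + s *\<^sub>R gradient \<phi> x = z"
      using \<xi>[OF s] by (auto simp: x_def)
    have "dist z x \<le> \<rho> * h"
      using x(1) by (simp add: B_def)
    then have "cball x (\<rho> * h) \<subseteq> cball z (2 * \<rho> * h)"
    proof (intro subsetI)
      fix v assume "dist z x \<le> \<rho> * h" "v \<in> cball x (\<rho> * h)"
      then show "v \<in> cball z (2 * \<rho> * h)"
        using dist_triangle[of z v x] by simp
    qed
    then have ball: "cball x (\<rho> * h) \<subseteq> U"
      using rho_ball(2)[OF z(1)] by blast
    have "\<bar>s\<bar> * (2 * c2) \<le> e * (2 * c2)"
      using s c2 by (intro mult_right_mono) auto
    then have sd: "\<bar>s\<bar> * (2 * c2) \<le> \<rho> * h"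
      using e by simp
    have "\<bar>\<phi> (x + s *\<^sub>R gradient \<phi> x) - \<phi> (x + 0 *\<^sub>R gradient \<phi> x) - (s - 0) * (gradient \<phi> x \<bullet> gradient \<phi> x)\<bar>
        \<le> 5 / 16 * (norm (gradient \<phi> x))\<^sup>2 * \<bar>s - 0\<bar>"
      using \<rho> h small(4) sd c1 by (intro line_expansion[OF ball]) (auto simp: mult.assoc)
    then show ?thesis
      using x(2) z(2) by (simp add: x_def power2_norm_eq_inner abs_if split: if_splits)
  qed
  \<comment> \<open>\<open>11 / 16\<close> is what the relative error \<open>5 / 16\<close> of
    \<open>val\<close> leaves of the slope; \<open>D\<close> is large enough for it to outweigh the
    interpolation error, which fixes the signs at both ends.\<close>
  have gap: "C2 * h\<^sup>2 \<le> 11 / 16 * (norm (gradient \<phi> (\<xi> s)))\<^sup>2 * e" if s: "\<bar>s\<bar> \<le> e" for s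
  proof -
    have "C2 \<le> 1 / 4 * c1\<^sup>2 * D"
      using C4 c1 const_nonneg by (simp add: D field_simps)
    then have "C2 * h\<^sup>2 \<le> 1 / 4 * c1\<^sup>2 * D * h\<^sup>2"
      by (rule mult_right_mono) simp
    also have "\<dots> = 1 / 4 * c1\<^sup>2 * e"
      by (simp add: e_def)
    also have "\<dots> \<le> 11 / 16 * (norm (gradient \<phi> (\<xi> s)))\<^sup>2 * e"
      using grad_lower[of "\<xi> s"] \<xi>(1)[OF s] B(1) c1 e power_mono[of c1 "norm (gradient \<phi> (\<xi> s))" 2]
      by (intro mult_right_mono mult_mono) auto
    finally show ?thesis .
  qed
  have ends: "\<bar>e\<bar> \<le> e" "\<bar>- e\<bar> \<le> e"
    using e by auto
  have "\<phi>lin (\<xi> e) \<le> 0"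
  proof -
    have "\<phi> (\<xi> e) \<le> - (11 / 16 * (norm (gradient \<phi> (\<xi> e)))\<^sup>2 * e)"
      using val[OF ends(1)] e(1) unfolding abs_le_iff abs_of_nonneg[OF e(1)]
      by (simp add: algebra_simps)
    then show ?thesis
      using lin_err[OF \<xi>(1)[OF ends(1)]] gap[OF ends(1)] by linarith
  qed
  moreover have "\<phi>lin (\<xi> (- e)) \<ge> 0"
  proof -
    have "\<phi> (\<xi> (- e)) \<ge> 11 / 16 * (norm (gradient \<phi> (\<xi> (- e))))\<^sup>2 * e"
      using val[OF ends(2)] e(1) unfolding abs_le_iff abs_minus_cancel abs_of_nonneg[OF e(1)]
      by (simp add: algebra_simps)
    then show ?thesis
      using lin_err[OF \<xi>(1)[OF ends(2)]] gap[OF ends(2)] by linarith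
  qed
  moreover have "continuous_on {- e..e} (\<lambda>s. \<phi>lin (\<xi> s))"
  proof (rule continuous_on_compose2[OF _ \<xi>_cont])
    show "continuous_on (\<Union>S) \<phi>lin"
      using nodal_interp_fe_space[OF mesh, of 1 \<phi>h] by (simp add: fe_space_def)
    show "\<xi> ` {- e..e} \<subseteq> \<Union>S"
    proof (rule image_subsetI)
      fix s assume "s \<in> {- e..e}"
      then have "\<xi> s \<in> B"
        by (intro \<xi>(1)) (simp add: abs_le_iff)
      then show "\<xi> s \<in> \<Union>S"
        using B(1) U_mesh by blast
    qed
  qed
  ultimately have "\<exists>s. - e \<le> s \<and> s \<le> e \<and> \<phi>lin (\<xi> s) = 0"
    using e(1) by (intro IVT2') auto
  then obtain s where "- e \<le> s" "s \<le> e" "\<phi>lin (\<xi> s) = 0"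
    by blast
  then have s: "\<bar>s\<bar> \<le> e" "\<phi>lin (\<xi> s) = 0"
    by auto
  define x where "x = \<xi> s"
  have xB: "x \<in> B" and xz: "x + s *\<^sub>R gradient \<phi> x = z"
    using \<xi>[OF s(1)] by (auto simp: x_def)
  have "x \<in> Gamma_lin S \<phi>h"
    using s(2) xB B(1) U_mesh by (auto simp: Gamma_lin_def x_def)
  then obtain T where T: "T \<in> cuts" "x \<in> T" "\<phi>lin x = 0"
    by (elim Gamma_lin_elem)
  obtain d where d: "\<bar>d\<bar> \<le> C4 * h\<^sup>2" "\<bar>\<phi> (x + d *\<^sub>R gradient \<phi> x)\<bar> \<le> C4 * h ^ (k + 1)"
    "norm (Theta_h k S \<phi>h G x - (x + d *\<^sub>R gradient \<phi> x)) \<le> C5 * h ^ (k + 1)"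
    using Theta_h_close[OF G T(1,2)] T(3) by auto
  have xA: "x \<in> A"
    using cut_A[OF T(1)] T(2) by auto
  \<comment> \<open>Both steps follow the gradient, so the direction error is 0; the step
    \<open>s\<close> ends exactly in the zero set, so the levels differ only by the residual of
    \<open>d\<close>.\<close>
  have "norm ((x + d *\<^sub>R gradient \<phi> x) - (x + s *\<^sub>R gradient \<phi> x)) \<le> comparison_const * (C4 * h ^ (k + 1) + e * 0)"
  proof (rule compare_points[OF rho_ball(1)[OF xA]])
    show "\<bar>d\<bar> \<le> e"
      using d(1) const_nonneg(5) mult_right_mono[of C4 D "h\<^sup>2"] by (simp add: e_def)
    show "\<bar>\<phi> (x + d *\<^sub>R gradient \<phi> x) - \<phi> (x + s *\<^sub>R gradient \<phi> x)\<bar> \<le> C4 * h ^ (k + 1)"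
      using d(2) xz z(2) by simp
  qed (use \<rho> h small(4) c1 s(1) step_small in \<open>auto simp: e_def mult.assoc\<close>)
  then have "norm ((x + d *\<^sub>R gradient \<phi> x) - z) \<le> comparison_const * C4 * h ^ (k + 1)"
    unfolding xz by simp
  then have "dist z (Theta_h k S \<phi>h G x) \<le> (C5 + comparison_const * C4) * h ^ (k + 1)"
    using d(3) norm_triangle_ineq[of "Theta_h k S \<phi>h G x - (x + d *\<^sub>R gradient \<phi> x)"
        "(x + d *\<^sub>R gradient \<phi> x) - z"]
    by (simp add: dist_norm norm_minus_commute distrib_right)
  moreover have "Theta_h k S \<phi>h G x \<in> Gamma_h k S \<phi>h G"
    using \<open>x \<in> Gamma_lin S \<phi>h\<close> by (simp add: Gamma_h_def)
  ultimately show ?thesis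
    by blast
qed

end

section \<open>The Hausdorff distance\<close>

lemma hausdorff_distance_le:
  assumes "\<And>x. x \<in> A \<Longrightarrow> \<exists>y\<in>B. dist x y \<le> e" "\<And>y. y \<in> B \<Longrightarrow> \<exists>x\<in>A. dist y x \<le> e"
  shows "hausdorff_distance A B \<le> ennreal e"
  unfolding hausdorff_distance_def
proof (rule max.boundedI; rule SUP_least)
  fix x assume "x \<in> A"
  then obtain y where "y \<in> B" "dist x y \<le> e"
    using assms(1) by blast
  then show "(INF y\<in>B. ennreal (dist x y)) \<le> ennreal e"
    by (intro INF_lower2[of y]) (auto intro: ennreal_leI)
next
  fix y assume "y \<in> B"
  then obtain x where "x \<in> A" "dist y x \<le> e"
    using assms(2) by blast
  then show "(INF x\<in>A. ennreal (dist x y)) \<le> ennreal e"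
    by (intro INF_lower2[of x]) (auto intro: ennreal_leI simp: dist_commute)
qed

text \<open>\<open>ennreal\<close> sends a negative bound to 0, so a real bound is recovered with a
  nonnegative majorant \<open>B'\<close>.\<close>

lemma seminorm_inf_bound:
  assumes "seminorm_inf m f S \<le> ennreal B" "B \<le> B'" "0 \<le> B'"
    and "x \<in> S" "set bs \<subseteq> Basis" "length bs = m"
  shows "\<bar>partials bs f x\<bar> \<le> B'"
proof -
  have "ennreal \<bar>partials bs f x\<bar> \<le> (SUP x\<in>S. ennreal \<bar>partials bs f x\<bar>)"
    using assms by (intro SUP_upper)
  also have "\<dots> \<le> seminorm_inf m f S"
    unfolding seminorm_inf_def using assms
    by (intro SUP_upper[where f = "\<lambda>bs. SUP x\<in>S. ennreal \<bar>partials bs f x\<bar>"]) auto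
  also have "\<dots> \<le> ennreal B'"
    using assms(1,2) by (meson ennreal_leI order_trans)
  finally show ?thesis
    using assms(3) by (simp add: ennreal_le_iff)
qed

lemma Cm_on_partials_bounded:
  fixes f :: "'a::euclidean_space \<Rightarrow> real"
  assumes "Cm_on m f U" "compact K" "K \<subseteq> U"
  obtains M where "M \<ge> 0"
    "\<And>bs x. set bs \<subseteq> Basis \<Longrightarrow> length bs \<le> m \<Longrightarrow> x \<in> K \<Longrightarrow> \<bar>partials bs f x\<bar> \<le> M"
proof -
  define L where "L = {bs. set bs \<subseteq> (Basis :: 'a set) \<and> length bs \<le> m}"
  have L: "finite L"
    unfolding L_def by (rule finite_lists_length_le[OF finite_Basis])
  have "\<forall>bs\<in>L. \<exists>B. \<forall>x\<in>K. \<bar>partials bs f x\<bar> \<le> B"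
  proof
    fix bs assume "bs \<in> L"
    then have "continuous_on K (partials bs f)"
      using assms unfolding Cm_on_def L_def by (blast intro: continuous_on_subset)
    then have "bounded (partials bs f ` K)"
      using assms(2) by (intro compact_imp_bounded compact_continuous_image)
    then show "\<exists>B. \<forall>x\<in>K. \<bar>partials bs f x\<bar> \<le> B"
      unfolding bounded_iff by auto
  qed
  then obtain B where B: "\<And>bs x. bs \<in> L \<Longrightarrow> x \<in> K \<Longrightarrow> \<bar>partials bs f x\<bar> \<le> B bs"
    unfolding bchoice_iff by blast
  show ?thesis
  proof (rule that[of "\<Sum>bs\<in>L. \<bar>B bs\<bar>"])
    fix bs :: "'a list" and x assume *: "set bs \<subseteq> Basis" "length bs \<le> m" "x \<in> K"
    then have "bs \<in> L"
      by (simp add: L_def)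
    then have "\<bar>partials bs f x\<bar> \<le> \<bar>B bs\<bar>"
      using B[of bs x] * by simp
    also have "\<dots> \<le> (\<Sum>bs\<in>L. \<bar>B bs\<bar>)"
      using L \<open>bs \<in> L\<close> by (intro member_le_sum) auto
    finally show "\<bar>partials bs f x\<bar> \<le> (\<Sum>bs\<in>L. \<bar>B bs\<bar>)" .
  qed (simp add: sum_nonneg)
qed

text \<open>\<open>h0\<close> and \<open>C\<close> are chosen before the index \<open>i\<close>,
  hence uniformly in the mesh and the position of the cut. The premise \<open>h i \<le> h0\<close>
  together with the patch condition expresses that the mesh is sufficiently fine.\<close>

theorem lemma3p7:
  fixes \<Omega> U :: "'a::euclidean_space set"
    and \<phi> :: "'a \<Rightarrow> real"
    and k :: nat
    and \<T> :: "'i \<Rightarrow> 'a set set"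
    and h :: "'i \<Rightarrow> real"
    and \<phi>h :: "'i \<Rightarrow> 'a \<Rightarrow> real"
    and G :: "'i \<Rightarrow> 'a set \<Rightarrow> 'a \<Rightarrow> 'a"
  assumes "DIM('a) \<in> {2, 3}" and "k \<ge> 1"
    and "polyhedral_domain \<Omega>"
    and "compact {x \<in> \<Omega>. \<phi> x = 0}"
    and "open U" and "{x \<in> \<Omega>. \<phi> x = 0} \<subseteq> U" and "U \<subseteq> \<Omega>"
    and "Cm_on (k + 2) \<phi> U"
    and "\<exists>c1>0. \<exists>c2. \<forall>x\<in>U. c1 \<le> norm (gradient \<phi> x) \<and> norm (gradient \<phi> x) \<le> c2"
    and "\<exists>c. \<forall>x\<in>U. onorm (frechet_derivative (gradient \<phi>) (at x)) \<le> c"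
    and "\<And>i. triangulation_of (\<T> i) \<Omega>"
    and "quasi_uniform \<T> h"
    and "\<And>i. \<phi>h i \<in> fe_space k (\<T> i)"
    and "\<exists>c. \<forall>i. \<forall>T\<in>\<T> i. \<forall>m\<le>k + 1.
           seminorm_inf m (\<lambda>x. \<phi>h i x - \<phi> x) (interior T \<inter> U) \<le> ennreal (c * h i ^ (k + 1 - m))"
    and "\<And>i. search_direction k (\<T> i) (\<phi>h i) (G i)"
  shows "\<exists>h0>0. \<exists>C>0. \<forall>i.
           h i \<le> h0 \<and>
           (\<forall>T\<in>cut_elements (\<T> i) (\<phi>h i). \<forall>T'\<in>\<T> i. T' \<inter> T \<noteq> {} \<longrightarrow> T' \<subseteq> U) \<longrightarrow>
           hausdorff_distance (Gamma_h k (\<T> i) (\<phi>h i) (G i)) {x \<in> \<Omega>. \<phi> x = 0}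
             \<le> ennreal (C * h i ^ (k + 1))"
proof -
  define \<Gamma> where "\<Gamma> = {x \<in> \<Omega>. \<phi> x = 0}"
  note k = assms(2) and open_U = assms(5) and smooth = assms(8)
  have \<Gamma>: "compact \<Gamma>" "\<Gamma> \<subseteq> U"
    using assms(4,6) by (auto simp: \<Gamma>_def)
  obtain c1 c2' where c1: "c1 > 0" and grad: "\<And>x. x \<in> U \<Longrightarrow> c1 \<le> norm (gradient \<phi> x)"
    "\<And>x. x \<in> U \<Longrightarrow> norm (gradient \<phi> x) \<le> c2'"
    using assms(9) by blast
  obtain cH' where hess: "\<And>x. x \<in> U \<Longrightarrow> onorm (frechet_derivative (gradient \<phi>) (at x)) \<le> cH'"
    using assms(10) by blast
  \<comment> \<open>The given bounds may be nonpositive, for instance when \<open>U\<close> is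
    empty; the maxima secure \<open>c2 > 0\<close> and \<open>cH \<ge> 0\<close>.\<close>
  define c2 where "c2 = max c2' 1"
  define cH where "cH = max cH' 0"
  have level: "level_set \<phi> U k c1 c2 cH"
  proof
    show "norm (gradient \<phi> x) \<le> c2" "onorm (frechet_derivative (gradient \<phi>) (at x)) \<le> cH" if "x \<in> U" for x
      using grad(2)[OF that] hess[OF that] by (auto simp: c2_def cH_def)
  qed (use k open_U smooth c1 grad in \<open>auto simp: c2_def cH_def\<close>)
  obtain \<epsilon> where \<epsilon>: "\<epsilon> > 0" "(\<Union>z\<in>\<Gamma>. cball z \<epsilon>) \<subseteq> U"
    using compact_subset_open_imp_cball_epsilon_subset[OF \<Gamma>(1) open_U \<Gamma>(2)] by blast
  \<comment> \<open>Half of \<open>\<epsilon>\<close>, so that balls of radius \<open>r\<close>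
    about points of \<open>A\<close> stay in the compact set where the partial derivatives are
    bounded.\<close>
  define r where "r = \<epsilon> / 2"
  define A where "A = (\<Union>z\<in>\<Gamma>. cball z r)"
  have "compact (\<Union>z\<in>\<Gamma>. cball z \<epsilon>)"
    using \<Gamma>(1) by (rule compact_minkowski_sum_cball)
  then obtain M where M: "M \<ge> 0" "\<And>bs x. set bs \<subseteq> Basis \<Longrightarrow> length bs \<le> k + 2 \<Longrightarrow>
      x \<in> (\<Union>z\<in>\<Gamma>. cball z \<epsilon>) \<Longrightarrow> \<bar>partials bs \<phi> x\<bar> \<le> M"
    using Cm_on_partials_bounded[OF smooth _ \<epsilon>(2)] by blast
  have A_ball: "cball x r \<subseteq> (\<Union>z\<in>\<Gamma>. cball z \<epsilon>)" if x: "x \<in> A" for x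
  proof
    fix y assume y: "y \<in> cball x r"
    obtain z where z: "z \<in> \<Gamma>" "dist z x \<le> r"
      using x by (auto simp: A_def)
    then have "dist z y \<le> \<epsilon>"
      using y dist_triangle[of z y x] by (simp add: r_def)
    then show "y \<in> (\<Union>z\<in>\<Gamma>. cball z \<epsilon>)"
      using z(1) by auto
  qed
  have \<Gamma>_A: "\<Gamma> \<subseteq> A"
    using \<epsilon>(1) by (force simp: A_def r_def)
  have nbhd: "level_set_nbhd \<phi> U k c1 c2 cH A r M"
  proof (intro level_set_nbhd.intro level level_set_nbhd_axioms.intro)
    show "cball x r \<subseteq> U" if "x \<in> A" for x
      using A_ball[OF that] \<epsilon>(2) by blast
    show "\<bar>partials bs \<phi> y\<bar> \<le> M"
      if "x \<in> A" "y \<in> cball x r" "set bs \<subseteq> Basis" "length bs \<le> k + 2" for x y bs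
      using M(2)[OF that(3,4)] A_ball[OF that(1)] that(2) by blast
  qed (use \<epsilon>(1) M(1) in \<open>auto simp: r_def\<close>)
  interpret N: level_set_nbhd \<phi> U k c1 c2 cH A r M
    by (rule nbhd)

  \<comment> \<open>Uniform mesh constants\<close>
  obtain m1 m2 where m1: "m1 > 0" and diam: "\<And>i T. T \<in> \<T> i \<Longrightarrow> m1 * h i \<le> diameter T"
    "\<And>i T. T \<in> \<T> i \<Longrightarrow> diameter T \<le> m2 * h i"
    using assms(12) unfolding quasi_uniform_def by blast
  obtain \<rho>' where \<rho>': "\<rho>' > 0" "\<And>i T. T \<in> \<T> i \<Longrightarrow> \<exists>z. cball z (\<rho>' * diameter T) \<subseteq> T"
    using assms(12) unfolding quasi_uniform_def by blast
  have h_pos: "h i > 0" for i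
    using assms(12) unfolding quasi_uniform_def by blast
  \<comment> \<open>\<open>\<rho>'\<close> relates the inscribed ball to the diameter; the factor
    \<open>m1\<close> converts this to the mesh size.\<close>
  define \<rho> where "\<rho> = \<rho>' * m1"
  define \<tau> where "\<tau> = max m2 0"
  obtain c' where c': "\<And>i T m. T \<in> \<T> i \<Longrightarrow> m \<le> k + 1 \<Longrightarrow>
      seminorm_inf m (\<lambda>x. \<phi>h i x - \<phi> x) (interior T \<inter> U) \<le> ennreal (c' * h i ^ (k + 1 - m))"
    using assms(14) by blast
  define c where "c = max c' 0"
  have \<rho>: "\<rho> > 0" and \<tau>: "\<tau> \<ge> 0" and c: "c \<ge> 0"
    using \<rho>' m1 by (auto simp: \<rho>_def \<tau>_def c_def)
  have mesh: "level_set_mesh \<phi> U k c1 c2 cH (\<T> i) (h i) \<rho> \<tau> c (\<phi>h i)" if h1: "h i \<le> 1" for i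
  proof (intro level_set_mesh.intro level level_set_mesh_axioms.intro)
    show "full_mesh (\<T> i)"
      using assms(11) by (rule triangulation_of_imp_full_mesh)
    show "U \<subseteq> \<Union>(\<T> i)"
      using assms(7) assms(11)[of i] closure_subset unfolding triangulation_of_def by blast
    show "diameter T \<le> \<tau> * h i" if "T \<in> \<T> i" for T
    proof -
      have "m2 * h i \<le> \<tau> * h i"
        using h_pos[of i] by (intro mult_right_mono) (auto simp: \<tau>_def)
      then show ?thesis
        using diam(2)[OF that] by simp
    qed
    show "\<exists>z. cball z (\<rho> * h i) \<subseteq> T" if T: "T \<in> \<T> i" for T
    proof -
      have "\<rho> * h i \<le> \<rho>' * diameter T"
        using mult_left_mono[OF diam(1)[OF T], of \<rho>'] \<rho>' by (simp add: \<rho>_def mult_ac)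
      then show ?thesis
        using \<rho>'(2)[OF T] subset_cball by (meson order_trans)
    qed
    fix T x assume T: "T \<in> \<T> i" and x: "x \<in> interior T \<inter> U"
    have le: "c' * h i ^ n \<le> c * h i ^ n" "0 \<le> c * h i ^ n" for n
      using h_pos[of i] c by (auto simp: c_def intro: mult_right_mono)
    show "\<bar>\<phi>h i x - \<phi> x\<bar> \<le> c * h i ^ (k + 1)"
      using seminorm_inf_bound[OF c'[OF T, of 0] _ _ x, of "c * h i ^ (k + 1)" "[]"] le[of "k + 1"] by simp
    show "\<bar>frechet_derivative (\<lambda>x. \<phi>h i x - \<phi> x) (at x) b\<bar> \<le> c * h i ^ k" if "b \<in> Basis" for b
      using seminorm_inf_bound[OF c'[OF T, of 1] _ _ x, of "c * h i ^ k" "[b]"] le[of k] that by simp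
  qed (use h_pos h1 \<rho> \<tau> c assms(13) in auto)

  \<comment> \<open>Constants of the estimate and the smallness conditions\<close>
  obtain CP CT where CT: "CT \<ge> 0" and taylor: "\<And>x0. x0 \<in> A \<Longrightarrow> \<exists>P g. N.taylor_data CP CT x0 P g"
    using N.taylor_data_exists by blast
  define C2 where "C2 = cH * \<tau>\<^sup>2 + c"
  define C1 where "C1 = M + C2 + real DIM('a) * ((real DIM('a) + 1) * ((c2 * \<tau> + c) / \<rho>))"
  define C3 where "C3 = growth_const TYPE('a) k 1 * (c + CT * \<tau> ^ (k + 1)) + CT * \<rho> ^ (k + 1)"
  have C2: "C2 \<ge> 0"
    using N.cH c by (simp add: C2_def)
  then have C1: "C1 \<ge> 0"
    unfolding C1_def using M(1) N.c2 \<tau> c \<rho>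
    by (intro add_nonneg_nonneg mult_nonneg_nonneg divide_nonneg_nonneg) auto
  obtain C4 where C4: "C4 \<ge> 0" and approx: "\<forall>\<^sub>F h in at_right 0. \<forall>x0 l S. N.admissible \<tau> C1 C2 h x0 l S \<longrightarrow>
    (\<exists>Y d. poly_deg_le k Y \<and> (\<forall>x\<in>S. \<bar>d x\<bar> \<le> C4 * h\<^sup>2 \<and>
      norm (Y x - (x + d x *\<^sub>R gradient \<phi> x)) \<le> C4 * h ^ (k + 1) \<and>
      \<bar>\<phi> (x + d x *\<^sub>R gradient \<phi> x) - l x\<bar> \<le> C4 * h ^ (k + 1)))"
    using N.approximate_map[OF \<tau> C1 C2] by blast
  define D where "D = C4 + 4 * (C2 + C3) / c1\<^sup>2"
  define C5 where "C5 = growth_const TYPE('a) k 0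
    * (N.comparison_const * (C3 + C4 + D * (real DIM('a) * c)) + C4) + C4"
  define \<sigma> where "\<sigma> = \<rho> / (2 * (real DIM('a) + 1))"
  \<comment> \<open>\<open>E1\<close> belongs to the distance from \<open>Gamma_h\<close> to
    \<Gamma>, \<open>E2\<close> to the reverse one.\<close>
  define E1 where "E1 = 2 * (c2 * C5 + C4) / c1"
  define E2 where "E2 = C5 + N.comparison_const * C4"
  define C where "C = max 1 (max E1 E2)"
  have \<sigma>: "\<sigma> > 0" and c1_4: "c1 / 4 > 0"
    using \<rho> c1 by (simp_all add: \<sigma>_def)
  \<comment> \<open>The event concerns a real \<open>\<eta>\<close>, and the index enters only
    through \<open>h i = \<eta>\<close>; one threshold then serves all meshes at once.\<close>
  have "\<forall>\<^sub>F \<eta> in at_right 0. \<forall>i. h i = \<eta> \<longrightarrow>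
      (\<forall>T\<in>cut_elements (\<T> i) (\<phi>h i). \<forall>T'\<in>\<T> i. T' \<inter> T \<noteq> {} \<longrightarrow> T' \<subseteq> U) \<longrightarrow>
      hausdorff_distance (Gamma_h k (\<T> i) (\<phi>h i) (G i)) \<Gamma> \<le> ennreal (C * h i ^ (k + 1))"
    using approx
      eventually_at_right_mult_le[OF zero_less_one, of 1]
      eventually_at_right_mult_le[OF mult_pos_pos[OF c1 \<sigma>], of "2 * (cH * \<tau>\<^sup>2 + c)"]
      eventually_at_right_mult_le[OF c1, of "2 * cH * \<sigma>"]
      eventually_at_right_mult_le[OF N.r, of "\<tau> + 2 * (cH * \<tau>\<^sup>2 + c) / c1"]
      eventually_at_right_mult_le[OF N.r, of "\<tau> + \<rho>"]
      eventually_at_right_mult_le[OF N.r, of "2 * \<rho>"]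
      eventually_at_right_mult_le[OF c1_4, of "real DIM('a) * c"]
      eventually_at_right_mult_le[OF c1, of "4 * cH * \<rho>"]
      eventually_at_right_mult_le[OF \<rho>, of "D * (2 * c2)"]
      eventually_at_right_mult_le[OF \<rho>, of "2 * C5"]
      eventually_at_right_mult_le[OF mult_pos_pos[OF c1 \<rho>], of "2 * (c2 * C5 + C4)"]
  proof eventually_elim
    case (elim \<eta>)
    show ?case
    proof (intro allI impI)
      fix i assume \<eta>: "h i = \<eta>"
        and patch: "\<forall>T\<in>cut_elements (\<T> i) (\<phi>h i). \<forall>T'\<in>\<T> i. T' \<inter> T \<noteq> {} \<longrightarrow> T' \<subseteq> U"
      have h1: "h i \<le> 1"
        using elim(2) \<eta> by simp
      interpret L: level_set_mesh \<phi> U k c1 c2 cH "\<T> i" "h i" \<rho> \<tau> c "\<phi>h i"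
        using h1 by (rule mesh)
      \<comment> \<open>The distance from \<open>cut_near_zero\<close>, a multiple of
        \<open>h i\<close>, has dropped below \<open>r\<close>.\<close>
      have cut_A: "T \<subseteq> A" if T: "T \<in> cut_elements (\<T> i) (\<phi>h i)" for T
      proof
        fix x assume x: "x \<in> T"
        have "\<exists>z\<in>U. \<phi> z = 0 \<and> dist z x \<le> (\<tau> + 2 * (cH * \<tau>\<^sup>2 + c) / c1) * h i"
          using patch T elim(3,4) \<eta> x unfolding \<sigma>_def by (intro L.cut_near_zero) auto
        then obtain z where z: "z \<in> U" "\<phi> z = 0" "dist z x \<le> (\<tau> + 2 * (cH * \<tau>\<^sup>2 + c) / c1) * h i"
          by blast
        then have "z \<in> \<Gamma>" "dist z x \<le> r"
          using assms(7) elim(5) \<eta> by (auto simp: \<Gamma>_def)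
        then show "x \<in> A"
          by (auto simp: A_def)
      qed
      have "level_set_cut \<phi> U k c1 c2 cH A r M (\<T> i) (h i) \<rho> \<tau> c (\<phi>h i) CP CT C1 C2 C3 C4 C5 D"
        by (intro level_set_cut.intro nbhd mesh h1 level_set_cut_axioms.intro)
          (use CT taylor C4 cut_A elim \<eta> in
            \<open>auto simp only: C1_def C2_def C3_def D_def C5_def \<eta>\<close>)
      then interpret K: level_set_cut \<phi> U k c1 c2 cH A r M "\<T> i" "h i" \<rho> \<tau> c "\<phi>h i" CP CT C1 C2 C3 C4 C5 D .
      have hk: "E1 * h i ^ (k + 1) \<le> C * h i ^ (k + 1)" "E2 * h i ^ (k + 1) \<le> C * h i ^ (k + 1)"
        using h_pos[of i] by (auto simp: C_def intro!: mult_right_mono)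
      show "hausdorff_distance (Gamma_h k (\<T> i) (\<phi>h i) (G i)) \<Gamma> \<le> ennreal (C * h i ^ (k + 1))"
      proof (rule hausdorff_distance_le)
        fix y assume "y \<in> Gamma_h k (\<T> i) (\<phi>h i) (G i)"
        from K.Gamma_h_near_zero[OF assms(15) this]
        obtain z where "z \<in> U" "\<phi> z = 0" "dist y z \<le> E1 * h i ^ (k + 1)"
          unfolding E1_def by blast
        then show "\<exists>z\<in>\<Gamma>. dist y z \<le> C * h i ^ (k + 1)"
          using assms(7) hk(1) by (intro bexI[of _ z]) (auto simp: \<Gamma>_def)
      next
        fix z assume z: "z \<in> \<Gamma>"
        then have "z \<in> A" "\<phi> z = 0"
          using \<Gamma>_A by (auto simp: \<Gamma>_def)
        from K.zero_near_Gamma_h[OF assms(15) this]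
        obtain y where "y \<in> Gamma_h k (\<T> i) (\<phi>h i) (G i)" "dist z y \<le> E2 * h i ^ (k + 1)"
          unfolding E2_def by blast
        then show "\<exists>y\<in>Gamma_h k (\<T> i) (\<phi>h i) (G i). dist z y \<le> C * h i ^ (k + 1)"
          using hk(2) by (intro bexI[of _ y]) auto
      qed
    qed
  qed
  then obtain b where b: "b > 0" "\<And>\<eta> i. 0 < \<eta> \<Longrightarrow> \<eta> < b \<Longrightarrow> h i = \<eta> \<Longrightarrow>
      (\<forall>T\<in>cut_elements (\<T> i) (\<phi>h i). \<forall>T'\<in>\<T> i. T' \<inter> T \<noteq> {} \<longrightarrow> T' \<subseteq> U) \<Longrightarrow>
      hausdorff_distance (Gamma_h k (\<T> i) (\<phi>h i) (G i)) \<Gamma> \<le> ennreal (C * h i ^ (k + 1))"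
    unfolding eventually_at_right_field by blast
  show ?thesis
  \<comment> \<open>The event holds for \<open>\<eta> < b\<close>, while the claim allows
    \<open>h i = h0\<close>; hence half of \<open>b\<close>.\<close>
  proof (rule exI[of _ "b / 2"], rule conjI, use b in simp, rule exI[of _ C], intro conjI allI impI)
    show "C > 0"
      by (simp add: C_def)
    fix i assume i: "h i \<le> b / 2 \<and>
      (\<forall>T\<in>cut_elements (\<T> i) (\<phi>h i). \<forall>T'\<in>\<T> i. T' \<inter> T \<noteq> {} \<longrightarrow> T' \<subseteq> U)"
    then show "hausdorff_distance (Gamma_h k (\<T> i) (\<phi>h i) (G i)) {x \<in> \<Omega>. \<phi> x = 0}
        \<le> ennreal (C * h i ^ (k + 1))"
      using b(2)[OF h_pos[of i] _ refl] b(1) unfolding \<Gamma>_def by simp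
  qed
qed

end
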